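(* Let $A\in\mathcal B_0(T)$ be arbitrary. Then there exists a constant $C_5(A)>0$ such that, for any $Z\in\mathcal Z(T)$ satisfying $\operatorname{supp}Z\subset A$ and $\|Z\|_\infty<C_5(A)$, the following equality of operators in $\mathscr L(\mathcal G\otimes\mathbb F)$ holds: $$G(Z,\omega)=\left(\mathbf 1-\left\langle\omega,\Psi_{\lambda(\cdot),\eta(\cdot)}(Z(\cdot))\right\rangle+\int_T C_{\lambda(t),\eta(t)}\big(\Psi_{\lambda(t),\eta(t)}(Z(t))\big)\,\sigma(dt)\right)^{-1}$$ $$=\left(\mathbf 1-\left\langle\omega,\frac{Z}{\mathbf 1+\lambda Z+\eta Z^2}\right\rangle+\int_T\frac{Z(t)^2}{\mathbf 1+\lambda(t)Z(t)+\eta(t)Z(t)^2}\,\sigma(dt)\right)^{-1}.$$ Furthermore, for such $Z$, $$G(Z,\omega)=\Big(\mathbf 1-f(Z)\big\langle\omega(\cdot),\Psi_{\lambda(\cdot),\eta(\cdot)}(Z(\cdot))\big\rangle\Big)^{-1}f(Z),\qquad f(Z):=\left(\mathbf 1+\int_T\frac{Z(t)^2}{\mathbf 1+\lambda(t)Z(t)+\eta(t)Z(t)^2}\,\sigma(dt)\right)^{-1}.$$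
   Context: **Setting.** $T$ is a locally compact Polish space, $\mathcal B(T)$ its Borel $\sigma$-algebra, $\mathcal B_0(T)$ the collection of relatively compact Borel sets. $\sigma$ is a Radon non-atomic measure on $(T,\mathcal B(T))$ with $\sigma(O)>0$ for each non-empty open $O\subset T$. $\lambda:T\to\mathbb R$ and $\eta:T\to[0,\infty)$ are fixed continuous functions. $B_0(T)$ is the space of bounded measurable functions $T\to\mathbb R$ with compact support (i.e. vanishing outside a set from $\mathcal B_0(T)$). $\mathcal G$ is a fixed real separable Hilbert space; $\mathscr L(\cdot)$ denotes bounded linear operators. For $n=0,1,2,\dots$, $[n]_0:=0$ if $n=0$ and $[n]_0:=1$ if $n\ge1$. **Extended Fock space.** $\mathbb F=\mathbb R\oplus\bigoplus_{n=1}^\infty L^2(T^n,\gamma_n)$ (real Hilbert space), where $\gamma_1=\sigma$ and, for $n\ge2$, $$\int_{T^n}h\,d\gamma_n=\int_{T^{n-1}}\Big[\int_T h(t_1,t_2,\dots,t_n)\,\sigma(dt_1)+\eta(t_2)h(t_2,t_2,t_3,\dots,t_n)\Big]\gamma_{n-1}(dt_2\cdots dt_n)$$ for measurable $h\ge0$. **Free Meixner process.** For $f\in B_0(T)$, $X(f)=X^+(f)+X^0(f)+X^-(f)\in\mathscr L(\mathbb F)$, where for $F\in L^2(T^n,\gamma_n)$ (and $F\in\mathbb R$ if $n=0$): - $X^+(f)F=f\otimes F$, i.e. $(X^+(f)F)(t_1,\dots,t_{n+1})=f(t_1)F(t_2,\dots,t_{n+1})$; - $(X^0(f)F)(t_1,\dots,t_n)=\lambda(t_1)f(t_1)F(t_1,\dots,t_n)$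 for $n\ge1$, and $X^0(f)F=0$ for $n=0$; - $X^-(f)F=0$ for $n=0$, $X^-(f)F=\int_T f F\,d\sigma$ for $n=1$, and for $n\ge2$, $(X^-(f)F)(t_1,\dots,t_{n-1})=\int_T f(t)F(t,t_1,\dots,t_{n-1})\,\sigma(dt)+\eta(t_1)f(t_1)F(t_1,t_1,t_2,\dots,t_{n-1})$. One writes $\langle\omega,f\rangle:=X(f)$; $\omega$ is the free Meixner process corresponding to $\lambda,\eta$. **Operator-valued test functions.** A mapping $Z:T\to\mathscr L(\mathcal G)$ is simple if $Z(t)=\sum_{i=1}^nZ_i\chi_{\Delta_i}(t)$ with $Z_i\in\mathscr L(\mathcal G)$, $\Delta_i\in\mathcal B_0(T)$. $\mathcal Z(T)$ is the set of all $Z:T\to\mathscr L(\mathcal G)$ for which there are $A\in\mathcal B_0(T)$ and simple mappings $Z_n$ vanishing outside $A$ with $\sup_{t}\|Z(t)-Z_n(t)\|_{\mathscr L(\mathcal G)}\to0$. Put $\|Z\|_\infty:=\sup_t\|Z(t)\|_{\mathscr L(\mathcal G)}$ and $\operatorname{supp}Z:=\{t:Z(t)\neq 0\}$. $\mathcal Z(T)$ is closed under pointwise products and under multiplication by $\lambda$ and $\eta$. **Pairing $\langle\omega,Z\rangle$.** For a simple $Z=\sum_iZ_i\chi_{\Delta_i}$, $\langle\omega,Z\rangle:=\sum_iZ_i\otimes X(\chi_{\Delta_i})\in\mathscr L(\mathcal G\otimes\mathbb F)$. For general $Z\in\mathcal Z(T)$, $\langle\omega,Z\rangle$ is the operator-norm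 limit of $\langle\omega,Z_n\rangle$ for simple $Z_n\to Z$ uniformly, all vanishing outside a common $A\in\mathcal B_0(T)$ (this limit exists and is independent of the approximating sequence). Operators $\mathscr X\in\mathscr L(\mathcal G)$ and $\mathscr Y\in\mathscr L(\mathbb F)$ are identified with $\mathscr X\otimes\mathbf 1$ and $\mathbf 1\otimes\mathscr Y$ in $\mathscr L(\mathcal G\otimes\mathbb F)$. Integrals $\int_TZ(t)\,\sigma(dt)$ are Bochner integrals in $\mathscr L(\mathcal G)$. **Polynomials.** For $Z_1,\dots,Z_n\in\mathcal Z(T)$ the operators $\langle P^{(n)}(\omega),Z_1\circledast\dots\circledast Z_n\rangle\in\mathscr L(\mathcal G\otimes\mathbb F)$ are defined recursively by $\langle P^{(0)}(\omega),Z^{\circledast 0}\rangle:=\mathbf 1$, $\langle P^{(1)}(\omega),Z\rangle:=\langle\omega,Z\rangle$ and, for $n\ge2$, $$\langle P^{(n)}(\omega),Z_1\circledast\dots\circledast Z_n\rangle=\langle\omega,Z_1\rangle\langle P^{(n-1)}(\omega),Z_2\circledast\dots\circledast Z_n\rangle-\langle P^{(n-1)}(\omega),(\lambda Z_1Z_2)\circledast Z_3\circledast\dots\circledast Z_n\rangle$$ $$-\int_TZ_1(t)Z_2(t)\,\sigma(dt)\,\langle P^{(n-2)}(\omega),Z_3\circledast\dots\circledast Z_n\rangle-[n-2]_0\langle P^{(n-2)}(\omega),(\eta Z_1Z_2Z_3)\circledast Z_4\circledast\dots\circledast Z_n\rangle$$ (the last term is absent for $n=2$). Write $Z^{\circledast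 n}=Z\circledast\dots\circledast Z$ ($n$ times). **Generating function.** $G(Z,\omega):=\mathbf 1+\sum_{n=1}^\infty\langle P^{(n)}(\omega),Z^{\circledast n}\rangle$; for each $A\in\mathcal B_0(T)$ this series converges in $\mathscr L(\mathcal G\otimes\mathbb F)$ for all $Z\in\mathcal Z(T)$ with support in $A$ and $\|Z\|_\infty$ small enough (depending on $A$). **Functions.** $\Psi_{\lambda,\eta}(z)=\dfrac{z}{1+\lambda z+\eta z^2}$ and $C_{\lambda,\eta}(\Psi_{\lambda,\eta}(z))=\dfrac{z^2}{1+\lambda z+\eta z^2}$. If $f(x)=\sum_{n\ge0}a_nx^n$ is real-analytic on $(-r,r)$ and $B$ is a bounded linear operator with norm less than $r$, then $f(B):=\sum_{n\ge0}a_nB^n$; the expressions $\frac{Z^l}{\mathbf 1+\lambda Z+\eta Z^2}$, $l=1,2$, are understood pointwise in this sense (for $\|Z\|_\infty$ small they belong to $\mathcal Z(T)$). *)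

theory Defs
  imports "HOL-Analysis.Analysis"
begin

section \<open>The underlying space and the measure\<close>

definition radon_measure :: "'t::topological_space measure \<Rightarrow> bool" where
  "radon_measure M \<longleftrightarrow> sets M = sets borel \<and>
     (\<forall>K. compact K \<longrightarrow> emeasure M K < \<infinity>) \<and>
     (\<forall>B\<in>sets borel. emeasure M B = (SUP K\<in>{K. compact K \<and> K \<subseteq> B}. emeasure M K))"

definition non_atomic :: "'t measure \<Rightarrow> bool" where
  "non_atomic M \<longleftrightarrow> (\<forall>A\<in>sets M. 0 < emeasure M A \<longrightarrow>
     (\<exists>B\<in>sets M. B \<subseteq> A \<and> 0 < emeasure M B \<and> emeasure M B < emeasure M A))"

definition rel_compact_borel :: "'t::topological_space set set" where
  "rel_compact_borel = {A \<in> sets borel. compact (closure A)}"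


section \<open>The measures on the powers of T\<close>

text \<open>A point \<open>(t\<^sub>1, \<dots>, t\<^sub>n)\<close> of \<open>T\<^sup>n\<close> is the extensional function \<open>\<omega>\<close> on
  \<open>{..<n}\<close> with \<open>\<omega> i = t\<^sub>i\<^sub>+\<^sub>1\<close>; prepending a coordinate \<open>s\<close> to \<open>\<omega>\<close> is \<open>case_nat s \<omega>\<close>, and
  the only point of \<open>T\<^sup>0\<close> is \<open>\<lambda>_. undefined\<close>.\<close>

definition tuples :: "nat \<Rightarrow> (nat \<Rightarrow> 't::topological_space) measure" where
  "tuples n = PiM {..<n} (\<lambda>_. borel)"

fun fock_measure :: "'t::topological_space measure \<Rightarrow> ('t \<Rightarrow> real) \<Rightarrow> nat \<Rightarrow> (nat \<Rightarrow> 't) measure" where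
  "fock_measure \<sigma> \<eta> 0 = count_space {\<lambda>_. undefined}"
| "fock_measure \<sigma> \<eta> (Suc 0) = distr \<sigma> (tuples 1) (\<lambda>t. case_nat t (\<lambda>_. undefined))"
| "fock_measure \<sigma> \<eta> (Suc (Suc n)) =
     measure_of (space (tuples (Suc (Suc n)))) (sets (tuples (Suc (Suc n))))
       (\<lambda>A. \<integral>\<^sup>+\<omega>. ((\<integral>\<^sup>+s. indicator A (case_nat s \<omega>) \<partial>\<sigma>)
                   + ennreal (\<eta> (\<omega> 0)) * indicator A (case_nat (\<omega> 0) \<omega>))
            \<partial>fock_measure \<sigma> \<eta> (Suc n))"

lemma measurable_cons_tuples:
  assumes "f \<in> measurable M (borel :: 't::second_countable_topology measure)" "g \<in> measurable M (tuples n)"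
  shows "(\<lambda>x. case_nat (f x) (g x)) \<in> measurable M (tuples (Suc n))"
  unfolding tuples_def
proof (rule measurable_PiM_single')
  fix i assume "i \<in> {..<Suc n}"
  then show "(\<lambda>x. case_nat (f x) (g x) i) \<in> borel_measurable M"
    using assms unfolding tuples_def
    by (cases i) (auto intro!: measurable_compose[OF assms(2)[unfolded tuples_def] measurable_component_singleton])
next
  show "(\<lambda>x. case_nat (f x) (g x)) \<in> space M \<rightarrow> (\<Pi>\<^sub>E i\<in>{..<Suc n}. space borel)"
    using measurable_space[OF assms(2)] unfolding tuples_def
    by (auto simp: space_PiM PiE_iff extensional_def split: nat.splits)
qed

lemma sets_fock_measure: "sets (fock_measure \<sigma> \<eta> n) = sets (tuples n)"
proof -
  consider "n = 0" | "n = Suc 0" | m where "n = Suc (Suc m)"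
    by (metis not0_implies_Suc)
  then show ?thesis
  proof cases
    case 1
    have "{..<0::nat} = {}" by simp
    then show ?thesis
      unfolding 1 tuples_def by (simp only: fock_measure.simps sets_PiM_empty sets_count_space) blast
  next
    case 2
    then show ?thesis by (simp only: fock_measure.simps sets_distr One_nat_def)
  next
    case 3
    then show ?thesis by (simp only: fock_measure.simps sets.sets_measure_of_eq)
  qed
qed

declare fock_measure.simps[simp del]

text \<open>The set function above is a measure, and integration against it satisfies the recursion for
  all non-negative measurable integrands.\<close>

lemma nn_integral_fock_measure:
  fixes \<sigma> :: "'t::second_countable_topology measure"
  assumes sf: "sigma_finite_measure \<sigma>" and bor: "sets \<sigma> = sets borel"
    and eta: "\<eta> \<in> borel_measurable borel"
    and h: "h \<in> borel_measurable (tuples (Suc (Suc n)))"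
  shows "(\<integral>\<^sup>+\<omega>. h \<omega> \<partial>fock_measure \<sigma> \<eta> (Suc (Suc n))) =
    (\<integral>\<^sup>+\<omega>. ((\<integral>\<^sup>+s. h (case_nat s \<omega>) \<partial>\<sigma>) + ennreal (\<eta> (\<omega> 0)) * h (case_nat (\<omega> 0) \<omega>)) \<partial>fock_measure \<sigma> \<eta> (Suc n))"
proof -
  interpret sigma_finite_measure \<sigma> by fact
  define N where "N = fock_measure \<sigma> \<eta> (Suc n)"
  define K where "K = fock_measure \<sigma> \<eta> (Suc (Suc n))"
  define T where "T = (tuples (Suc (Suc n)) :: (nat \<Rightarrow> 't) measure)"
  define g where "g k \<omega> = (\<integral>\<^sup>+s. k (case_nat s \<omega>) \<partial>\<sigma>) + ennreal (\<eta> (\<omega> 0)) * k (case_nat (\<omega> 0) \<omega>)" for k :: "(nat \<Rightarrow> 't) \<Rightarrow> ennreal" and \<omega>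
  have N: "sets N = sets (tuples (Suc n))" and K: "sets K = sets T"
    unfolding N_def K_def T_def by (rule sets_fock_measure)+
  have p0: "(\<lambda>\<omega>. \<omega> 0) \<in> measurable N (borel::'t measure)"
    unfolding measurable_cong_sets[OF N refl] tuples_def by (rule measurable_component_singleton) simp
  have id: "(\<lambda>x. x) \<in> measurable N (tuples (Suc n))" unfolding measurable_cong_sets[OF N refl] by simp
  have c1: "(\<lambda>p. case_nat (snd p) (fst p)) \<in> measurable (N \<Otimes>\<^sub>M \<sigma>) T" unfolding T_def
    by (rule measurable_cons_tuples) (auto intro!: measurable_compose[OF measurable_fst id] simp: measurable_cong_sets[OF refl bor[symmetric]])
  have c2: "(\<lambda>\<omega>. case_nat (\<omega> 0) \<omega>) \<in> measurable N T" unfolding T_def by (rule measurable_cons_tuples[OF p0 id])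
  have c3: "(\<lambda>s. case_nat s \<omega>) \<in> measurable \<sigma> T" if "\<omega> \<in> space N" for \<omega>
    using measurable_compose[OF measurable_Pair1'[OF that] c1] by simp
  have e: "(\<lambda>\<omega>. ennreal (\<eta> (\<omega> 0))) \<in> borel_measurable N"
    using measurable_compose[OF p0 eta] by simp
  have gm: "g k \<in> borel_measurable N" if k: "k \<in> borel_measurable T" for k
  proof -
    have "case_prod (\<lambda>\<omega> s. k (case_nat s \<omega>)) \<in> borel_measurable (N \<Otimes>\<^sub>M \<sigma>)"
      using measurable_compose[OF c1 k] by (simp add: case_prod_beta')
    from borel_measurable_nn_integral[OF this] show ?thesis
      unfolding g_def using e measurable_compose[OF c2 k] by (intro borel_measurable_add borel_measurable_times) auto
  qed
  have gsuminf: "g (\<lambda>x. \<Sum>i. u i x) \<omega> = (\<Sum>i. g (u i) \<omega>)" if "\<And>i. u i \<in> borel_measurable T" "\<omega> \<in> space N" for u :: "nat \<Rightarrow> _" and \<omega>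
    unfolding g_def
    apply (subst nn_integral_suminf)
    subgoal using measurable_compose[OF c3[OF that(2)] that(1)] by simp
    by (simp add: suminf_add[symmetric])
  have em: "emeasure K A = (\<integral>\<^sup>+\<omega>. g (indicator A) \<omega> \<partial>N)" if A: "A \<in> sets T" for A
  proof (rule emeasure_measure_of[where M=K])
    show "K = measure_of (space T) (sets T) (\<lambda>A. \<integral>\<^sup>+\<omega>. g (indicator A) \<omega> \<partial>N)"
      unfolding K_def T_def N_def g_def by (simp only: fock_measure.simps)
    show "sets T \<subseteq> Pow (space T)" by (rule sets.space_closed)
    show "A \<in> sets K" using A K by simp
    show "positive (sets K) (\<lambda>A. \<integral>\<^sup>+\<omega>. g (indicator A) \<omega> \<partial>N)" by (simp add: positive_def g_def)
    show "countably_additive (sets K) (\<lambda>A. \<integral>\<^sup>+\<omega>. g (indicator A) \<omega> \<partial>N)"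
    proof (rule countably_additiveI)
      fix B :: "nat \<Rightarrow> (nat \<Rightarrow> 't) set" assume B: "range B \<subseteq> sets K" "disjoint_family B"
      then have m: "(indicator (B i) :: _ \<Rightarrow> ennreal) \<in> borel_measurable T" for i using K by auto
      have "indicator (\<Union>i. B i) = (\<lambda>x. \<Sum>i. indicator (B i) x :: ennreal)"
        using suminf_indicator[OF B(2)] by auto
      then have "(\<integral>\<^sup>+\<omega>. g (indicator (\<Union>i. B i)) \<omega> \<partial>N) = (\<integral>\<^sup>+\<omega>. (\<Sum>i. g (indicator (B i)) \<omega>) \<partial>N)"
        using gsuminf[of "\<lambda>i. indicator (B i)", OF m] by (auto intro!: nn_integral_cong)
      also have "\<dots> = (\<Sum>i. \<integral>\<^sup>+\<omega>. g (indicator (B i)) \<omega> \<partial>N)" by (intro nn_integral_suminf gm m)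
      finally show "(\<Sum>i. \<integral>\<^sup>+\<omega>. g (indicator (B i)) \<omega> \<partial>N) = (\<integral>\<^sup>+\<omega>. g (indicator (\<Union>i. B i)) \<omega> \<partial>N)" ..
    qed
  qed
  have st: "space K = space T" using K by (rule sets_eq_imp_space_eq)
  have KT: "k \<in> borel_measurable K" if "k \<in> borel_measurable T" for k :: "(nat \<Rightarrow> 't) \<Rightarrow> ennreal"
    using that unfolding measurable_cong_sets[OF K refl] .
  have h': "h \<in> borel_measurable T" using h unfolding T_def .
  have "(\<integral>\<^sup>+\<omega>. h \<omega> \<partial>K) = (\<integral>\<^sup>+\<omega>. g h \<omega> \<partial>N)" using h'
  proof (induction rule: borel_measurable_induct)
    case (cong f f')
    have ff: "f x = f' x" if "x \<in> space T" for x using cong that by blast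
    have IH: "(\<integral>\<^sup>+\<omega>. f' \<omega> \<partial>K) = (\<integral>\<^sup>+\<omega>. g f' \<omega> \<partial>N)" using cong by blast
    have "g f \<omega> = g f' \<omega>" if "\<omega> \<in> space N" for \<omega>
    proof -
      have "(\<integral>\<^sup>+s. f (case_nat s \<omega>) \<partial>\<sigma>) = (\<integral>\<^sup>+s. f' (case_nat s \<omega>) \<partial>\<sigma>)"
        by (rule nn_integral_cong) (rule ff[OF measurable_space[OF c3[OF that]]])
      then show ?thesis unfolding g_def using ff[OF measurable_space[OF c2 that]] by simp
    qed
    then have "(\<integral>\<^sup>+\<omega>. g f \<omega> \<partial>N) = (\<integral>\<^sup>+\<omega>. g f' \<omega> \<partial>N)" by (rule nn_integral_cong)
    moreover have "(\<integral>\<^sup>+\<omega>. f \<omega> \<partial>K) = (\<integral>\<^sup>+\<omega>. f' \<omega> \<partial>K)"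
      by (rule nn_integral_cong) (simp add: st ff)
    ultimately show ?case using IH by metis
  next
    case (set A)
    then show ?case using em[of A] nn_integral_indicator[of A K] K by metis
  next
    case (mult u c)
    have um: "u \<in> borel_measurable T" using mult by blast
    have IH: "(\<integral>\<^sup>+\<omega>. u \<omega> \<partial>K) = (\<integral>\<^sup>+\<omega>. g u \<omega> \<partial>N)" using mult by blast
    have "g (\<lambda>x. c * u x) \<omega> = c * g u \<omega>" if "\<omega> \<in> space N" for \<omega>
      unfolding g_def nn_integral_cmult[OF measurable_compose[OF c3[OF that] um]]
      by (simp only: distrib_left mult.left_commute)
    then have "(\<integral>\<^sup>+\<omega>. g (\<lambda>x. c * u x) \<omega> \<partial>N) = (\<integral>\<^sup>+\<omega>. c * g u \<omega> \<partial>N)" by (rule nn_integral_cong)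
    also have "\<dots> = c * (\<integral>\<^sup>+\<omega>. g u \<omega> \<partial>N)" by (rule nn_integral_cmult[OF gm[OF um]])
    also have "\<dots> = (\<integral>\<^sup>+\<omega>. c * u \<omega> \<partial>K)"
      unfolding IH[symmetric] by (rule nn_integral_cmult[OF KT[OF um], symmetric])
    finally show ?case ..
  next
    case (add u v)
    have um: "u \<in> borel_measurable T" and vm: "v \<in> borel_measurable T" using add by blast+
    have IH: "(\<integral>\<^sup>+\<omega>. u \<omega> \<partial>K) = (\<integral>\<^sup>+\<omega>. g u \<omega> \<partial>N)" "(\<integral>\<^sup>+\<omega>. v \<omega> \<partial>K) = (\<integral>\<^sup>+\<omega>. g v \<omega> \<partial>N)"
      using add by blast+
    have "g (\<lambda>x. v x + u x) \<omega> = g v \<omega> + g u \<omega>" if "\<omega> \<in> space N" for \<omega>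
      unfolding g_def
        nn_integral_add[OF measurable_compose[OF c3[OF that] vm] measurable_compose[OF c3[OF that] um]]
      by (simp only: distrib_left ac_simps)
    then have "(\<integral>\<^sup>+\<omega>. g (\<lambda>x. v x + u x) \<omega> \<partial>N) = (\<integral>\<^sup>+\<omega>. g v \<omega> + g u \<omega> \<partial>N)" by (rule nn_integral_cong)
    also have "\<dots> = (\<integral>\<^sup>+\<omega>. g v \<omega> \<partial>N) + (\<integral>\<^sup>+\<omega>. g u \<omega> \<partial>N)"
      by (rule nn_integral_add[OF gm[OF vm] gm[OF um]])
    also have "\<dots> = (\<integral>\<^sup>+\<omega>. v \<omega> + u \<omega> \<partial>K)"
      unfolding IH[symmetric] by (rule nn_integral_add[OF KT[OF vm] KT[OF um], symmetric])
    finally show ?case ..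
  next
    case (seq U)
    have Um: "U i \<in> borel_measurable T" for i using seq by blast
    have Ui: "incseq U" using seq by blast
    have IH: "(\<integral>\<^sup>+\<omega>. U i \<omega> \<partial>K) = (\<integral>\<^sup>+\<omega>. g (U i) \<omega> \<partial>N)" for i using seq by blast
    have le: "U i x \<le> U j x" if "i \<le> j" for i j x using incseqD[OF Ui that] by (rule le_funD)
    have gle: "g (U i) \<omega> \<le> g (U j) \<omega>" if "i \<le> j" for i j \<omega>
      unfolding g_def by (intro add_mono nn_integral_mono mult_left_mono le[OF that]) simp
    have gi: "g (SUP i. U i) \<omega> = (SUP i. g (U i) \<omega>)" if w: "\<omega> \<in> space N" for \<omega>
    proof -
      have 1: "(\<integral>\<^sup>+s. (SUP i. U i (case_nat s \<omega>)) \<partial>\<sigma>) = (SUP i. \<integral>\<^sup>+s. U i (case_nat s \<omega>) \<partial>\<sigma>)"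
        by (rule nn_integral_monotone_convergence_SUP)
           (auto intro!: incseq_SucI le_funI le measurable_compose[OF c3[OF w] Um])
      have 2: "incseq (\<lambda>i. \<integral>\<^sup>+s. U i (case_nat s \<omega>) \<partial>\<sigma>)"
        by (intro incseq_SucI nn_integral_mono le) simp
      have 3: "incseq (\<lambda>i. ennreal (\<eta> (\<omega> 0)) * U i (case_nat (\<omega> 0) \<omega>))"
        by (intro incseq_SucI mult_left_mono le) simp_all
      show ?thesis unfolding g_def SUP_apply 1 SUP_mult_left_ennreal
        by (rule ennreal_SUP_add[OF 2 3, symmetric])
    qed
    have "(\<integral>\<^sup>+\<omega>. (SUP i. U i) \<omega> \<partial>K) = (SUP i. \<integral>\<^sup>+\<omega>. U i \<omega> \<partial>K)" unfolding SUP_apply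
      by (rule nn_integral_monotone_convergence_SUP[OF Ui KT[OF Um]])
    also have "\<dots> = (SUP i. \<integral>\<^sup>+\<omega>. g (U i) \<omega> \<partial>N)" unfolding IH ..
    also have "\<dots> = (\<integral>\<^sup>+\<omega>. (SUP i. g (U i) \<omega>) \<partial>N)"
      by (rule nn_integral_monotone_convergence_SUP[symmetric, OF _ gm[OF Um]])
         (intro incseq_SucI le_funI gle, simp)
    also have "\<dots> = (\<integral>\<^sup>+\<omega>. g (SUP i. U i) \<omega> \<partial>N)" by (rule nn_integral_cong) (simp only: gi)
    finally show ?case .
  qed
  then show ?thesis unfolding K_def N_def g_def .
qed

definition L2 :: "'a measure \<Rightarrow> ('a \<Rightarrow> real) set" where
  "L2 M = {F \<in> borel_measurable M. integrable M (\<lambda>x. (F x)\<^sup>2)}"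


section \<open>The extended Fock space and Hilbert tensor products\<close>

text \<open>The spaces \<open>L\<^sup>2(T\<^sup>n, \<gamma>\<^sub>n)\<close> depend on the terms \<open>\<sigma>\<close> and \<open>\<eta>\<close>, so their Hilbert sum is not
  a type. It is given, up to unitary equivalence, as a Hilbert space type \<open>'f\<close> with
  maps \<open>J n\<close> that send a representative \<open>F\<close> of a class in \<open>L\<^sup>2(T\<^sup>n, \<gamma>\<^sub>n)\<close> to that class, placed
  in the \<open>n\<close>-th summand. Functions that agree almost everywhere have the same image,
  since the norm of the image of their difference is 0.\<close>

definition extended_fock_space ::
  "'t::topological_space measure \<Rightarrow> ('t \<Rightarrow> real) \<Rightarrow>
   (nat \<Rightarrow> ((nat \<Rightarrow> 't) \<Rightarrow> real) \<Rightarrow> 'f::{real_inner, banach}) \<Rightarrow> bool" where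
  "extended_fock_space \<sigma> \<eta> J \<longleftrightarrow>
     (\<forall>n. \<forall>F\<in>L2 (fock_measure \<sigma> \<eta> n). \<forall>G\<in>L2 (fock_measure \<sigma> \<eta> n). \<forall>a b.
        J n (\<lambda>\<omega>. a * F \<omega> + b * G \<omega>) = a *\<^sub>R J n F + b *\<^sub>R J n G) \<and>
     (\<forall>n. \<forall>F\<in>L2 (fock_measure \<sigma> \<eta> n). \<forall>G\<in>L2 (fock_measure \<sigma> \<eta> n).
        J n F \<bullet> J n G = (LINT \<omega>|fock_measure \<sigma> \<eta> n. F \<omega> * G \<omega>)) \<and>
     (\<forall>m n. \<forall>F\<in>L2 (fock_measure \<sigma> \<eta> m). \<forall>G\<in>L2 (fock_measure \<sigma> \<eta> n).
        m \<noteq> n \<longrightarrow> J m F \<bullet> J n G = 0) \<and>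
     closure (span (\<Union>n. J n ` L2 (fock_measure \<sigma> \<eta> n))) = UNIV"

definition hilbert_tensor ::
  "('g::{real_inner, banach} \<Rightarrow> 'f::{real_inner, banach} \<Rightarrow> 'h::{real_inner, banach}) \<Rightarrow> bool" where
  "hilbert_tensor ten \<longleftrightarrow> bilinear ten \<and>
     (\<forall>a b c d. ten a b \<bullet> ten c d = (a \<bullet> c) * (b \<bullet> d)) \<and>
     closure (span {ten a b | a b. True}) = UNIV"

definition op_tensor ::
  "('g::real_normed_vector \<Rightarrow> 'f::real_normed_vector \<Rightarrow> 'h::real_normed_vector) \<Rightarrow>
   ('g \<Rightarrow>\<^sub>L 'g) \<Rightarrow> ('f \<Rightarrow>\<^sub>L 'f) \<Rightarrow> ('h \<Rightarrow>\<^sub>L 'h)" where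
  "op_tensor ten R S = (THE U. \<forall>a b. blinfun_apply U (ten a b) = ten (R a) (S b))"

abbreviation left_op ::
  "('g::real_normed_vector \<Rightarrow> 'f::real_normed_vector \<Rightarrow> 'h::real_normed_vector) \<Rightarrow>
   ('g \<Rightarrow>\<^sub>L 'g) \<Rightarrow> ('h \<Rightarrow>\<^sub>L 'h)" where
  "left_op ten R \<equiv> op_tensor ten R id_blinfun"


section \<open>Bounded operators\<close>

definition blinfun_invertible :: "('a::real_normed_vector \<Rightarrow>\<^sub>L 'a) \<Rightarrow> bool" where
  "blinfun_invertible R \<longleftrightarrow> (\<exists>S. R o\<^sub>L S = id_blinfun \<and> S o\<^sub>L R = id_blinfun)"

definition blinfun_inverse :: "('a::real_normed_vector \<Rightarrow>\<^sub>L 'a) \<Rightarrow> ('a \<Rightarrow>\<^sub>L 'a)" where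
  "blinfun_inverse R = (THE S. R o\<^sub>L S = id_blinfun \<and> S o\<^sub>L R = id_blinfun)"

primrec blinfun_power :: "('a::real_normed_vector \<Rightarrow>\<^sub>L 'a) \<Rightarrow> nat \<Rightarrow> ('a \<Rightarrow>\<^sub>L 'a)" where
  "blinfun_power R 0 = id_blinfun"
| "blinfun_power R (Suc n) = R o\<^sub>L blinfun_power R n"

definition power_series_at_0 :: "(real \<Rightarrow> real) \<Rightarrow> (nat \<Rightarrow> real) \<Rightarrow> bool" where
  "power_series_at_0 f a \<longleftrightarrow> (\<exists>r>0. \<forall>x. \<bar>x\<bar> < r \<longrightarrow> (\<lambda>n. a n * x ^ n) sums f x)"

definition op_fun :: "(real \<Rightarrow> real) \<Rightarrow> ('a::real_normed_vector \<Rightarrow>\<^sub>L 'a) \<Rightarrow> ('a \<Rightarrow>\<^sub>L 'a)" where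
  "op_fun f R = (\<Sum>n. (THE a. power_series_at_0 f a) n *\<^sub>R blinfun_power R n)"

text \<open>The library's Bochner integral requires a second countable value space, which the space
  of bounded operators is not. The following is its definition without that restriction.\<close>

definition has_op_integral :: "'t measure \<Rightarrow> ('t \<Rightarrow> 'b::banach) \<Rightarrow> 'b \<Rightarrow> bool" where
  "has_op_integral M f x \<longleftrightarrow> f \<in> borel_measurable M \<and>
     (\<exists>s. (\<forall>i. Bochner_Integration.simple_bochner_integrable M (s i)) \<and>
          (\<lambda>i. \<integral>\<^sup>+t. ennreal (norm (f t - s i t)) \<partial>M) \<longlonglongrightarrow> 0 \<and>
          (\<lambda>i. Bochner_Integration.simple_bochner_integral M (s i)) \<longlonglongrightarrow> x)"

definition op_integral :: "'t measure \<Rightarrow> ('t \<Rightarrow> 'b::banach) \<Rightarrow> 'b" where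
  "op_integral M f = (THE x. has_op_integral M f x)"


section \<open>The free Meixner process\<close>

context
  fixes \<sigma> :: "'t::topological_space measure" and lam \<eta> :: "'t \<Rightarrow> real"
    and J :: "nat \<Rightarrow> ((nat \<Rightarrow> 't) \<Rightarrow> real) \<Rightarrow> 'f::{real_inner, banach}"
begin

definition creation_op :: "('t \<Rightarrow> real) \<Rightarrow> ('f \<Rightarrow>\<^sub>L 'f)" where
  "creation_op f = (THE U. \<forall>n. \<forall>F\<in>L2 (fock_measure \<sigma> \<eta> n).
     blinfun_apply U (J n F) = J (Suc n) (\<lambda>\<omega>. f (\<omega> 0) * F (\<lambda>i. \<omega> (Suc i))))"

definition neutral_op :: "('t \<Rightarrow> real) \<Rightarrow> ('f \<Rightarrow>\<^sub>L 'f)" where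
  "neutral_op f = (THE U. \<forall>n. \<forall>F\<in>L2 (fock_measure \<sigma> \<eta> n).
     blinfun_apply U (J n F) = (if n = 0 then 0 else J n (\<lambda>\<omega>. lam (\<omega> 0) * f (\<omega> 0) * F \<omega>)))"

definition annihilation_op :: "('t \<Rightarrow> real) \<Rightarrow> ('f \<Rightarrow>\<^sub>L 'f)" where
  "annihilation_op f = (THE U.
     (\<forall>F\<in>L2 (fock_measure \<sigma> \<eta> 0). blinfun_apply U (J 0 F) = 0) \<and>
     (\<forall>F\<in>L2 (fock_measure \<sigma> \<eta> 1).
        blinfun_apply U (J 1 F) = J 0 (\<lambda>\<omega>. LINT t|\<sigma>. f t * F (case_nat t \<omega>))) \<and>
     (\<forall>n\<ge>2. \<forall>F\<in>L2 (fock_measure \<sigma> \<eta> n).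
        blinfun_apply U (J n F) = J (n - 1) (\<lambda>\<omega>. (LINT t|\<sigma>. f t * F (case_nat t \<omega>))
                                    + \<eta> (\<omega> 0) * f (\<omega> 0) * F (case_nat (\<omega> 0) \<omega>))))"

definition meixner_op :: "('t \<Rightarrow> real) \<Rightarrow> ('f \<Rightarrow>\<^sub>L 'f)" where
  "meixner_op f = creation_op f + neutral_op f + annihilation_op f"

end


section \<open>Operator-valued test functions\<close>

definition simple_rep ::
  "nat \<Rightarrow> (nat \<Rightarrow> 't::topological_space set) \<Rightarrow> (nat \<Rightarrow> 'g::real_normed_vector \<Rightarrow>\<^sub>L 'g) \<Rightarrow>
   ('t \<Rightarrow> 'g \<Rightarrow>\<^sub>L 'g) \<Rightarrow> bool" where
  "simple_rep n D V Z \<longleftrightarrow> (\<forall>i<n. D i \<in> rel_compact_borel) \<and>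
     Z = (\<lambda>t. \<Sum>i<n. indicat_real (D i) t *\<^sub>R V i)"

definition simple_mapping :: "('t::topological_space \<Rightarrow> 'g::real_normed_vector \<Rightarrow>\<^sub>L 'g) \<Rightarrow> bool" where
  "simple_mapping Z \<longleftrightarrow> (\<exists>n D V. simple_rep n D V Z)"

definition simple_approx ::
  "'t::topological_space set \<Rightarrow> (nat \<Rightarrow> 't \<Rightarrow> 'g::real_normed_vector \<Rightarrow>\<^sub>L 'g) \<Rightarrow>
   ('t \<Rightarrow> 'g \<Rightarrow>\<^sub>L 'g) \<Rightarrow> bool" where
  "simple_approx A S Z \<longleftrightarrow> (\<forall>n. simple_mapping (S n) \<and> (\<forall>t. t \<notin> A \<longrightarrow> S n t = 0)) \<and>
     uniform_limit UNIV S Z sequentially"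

definition op_test_functions :: "('t::topological_space \<Rightarrow> 'g::real_normed_vector \<Rightarrow>\<^sub>L 'g) set" where
  "op_test_functions = {Z. \<exists>A\<in>rel_compact_borel. \<exists>S. simple_approx A S Z}"

definition op_supp :: "('t \<Rightarrow> 'g::real_normed_vector \<Rightarrow>\<^sub>L 'g) \<Rightarrow> 't set" where
  "op_supp Z = {t. Z t \<noteq> 0}"

definition op_sup_norm :: "('t \<Rightarrow> 'g::real_normed_vector \<Rightarrow>\<^sub>L 'g) \<Rightarrow> real" where
  "op_sup_norm Z = (SUP t. norm (Z t))"


section \<open>The pairing, the polynomials and the generating function\<close>

context
  fixes \<sigma> :: "'t::topological_space measure" and lam \<eta> :: "'t \<Rightarrow> real"
    and J :: "nat \<Rightarrow> ((nat \<Rightarrow> 't) \<Rightarrow> real) \<Rightarrow> 'f::{real_inner, banach}"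
    and ten :: "'g::{real_inner, banach} \<Rightarrow> 'f \<Rightarrow> 'h::{real_inner, banach}"
begin

definition simple_pairing :: "('t \<Rightarrow> 'g \<Rightarrow>\<^sub>L 'g) \<Rightarrow> ('h \<Rightarrow>\<^sub>L 'h)" where
  "simple_pairing Z = (THE U. \<exists>n D V. simple_rep n D V Z \<and>
     U = (\<Sum>i<n. op_tensor ten (V i) (meixner_op \<sigma> lam \<eta> J (indicat_real (D i)))))"

definition pairing :: "('t \<Rightarrow> 'g \<Rightarrow>\<^sub>L 'g) \<Rightarrow> ('h \<Rightarrow>\<^sub>L 'h)" where
  "pairing Z = (THE U. \<exists>A\<in>rel_compact_borel. \<exists>S. simple_approx A S Z \<and>
     (\<lambda>n. simple_pairing (S n)) \<longlonglongrightarrow> U)"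

text \<open>\<open>meixner_poly [Z\<^sub>1, \<dots>, Z\<^sub>n]\<close> is the polynomial of degree \<open>n\<close> paired with the formal product of
  \<open>Z\<^sub>1, \<dots>, Z\<^sub>n\<close>. The cases \<open>n = 2\<close> and \<open>n \<ge> 3\<close> differ by the term with coefficient \<open>[n - 2]\<^sub>0\<close>.\<close>

fun meixner_poly :: "('t \<Rightarrow> 'g \<Rightarrow>\<^sub>L 'g) list \<Rightarrow> ('h \<Rightarrow>\<^sub>L 'h)" where
  "meixner_poly [] = id_blinfun"
| "meixner_poly [Z1] = pairing Z1"
| "meixner_poly [Z1, Z2] =
     (pairing Z1 o\<^sub>L meixner_poly [Z2])
     - meixner_poly [\<lambda>t. lam t *\<^sub>R (Z1 t o\<^sub>L Z2 t)]
     - (left_op ten (op_integral \<sigma> (\<lambda>t. Z1 t o\<^sub>L Z2 t)) o\<^sub>L meixner_poly [])"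
| "meixner_poly (Z1 # Z2 # Z3 # Zs) =
     (pairing Z1 o\<^sub>L meixner_poly (Z2 # Z3 # Zs))
     - meixner_poly ((\<lambda>t. lam t *\<^sub>R (Z1 t o\<^sub>L Z2 t)) # Z3 # Zs)
     - (left_op ten (op_integral \<sigma> (\<lambda>t. Z1 t o\<^sub>L Z2 t)) o\<^sub>L meixner_poly (Z3 # Zs))
     - meixner_poly ((\<lambda>t. \<eta> t *\<^sub>R (Z1 t o\<^sub>L Z2 t o\<^sub>L Z3 t)) # Zs)"

definition gen_fun :: "('t \<Rightarrow> 'g \<Rightarrow>\<^sub>L 'g) \<Rightarrow> ('h \<Rightarrow>\<^sub>L 'h)" where
  "gen_fun Z = id_blinfun + (\<Sum>n. meixner_poly (replicate (Suc n) Z))"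

definition gen_fun_converges :: "('t \<Rightarrow> 'g \<Rightarrow>\<^sub>L 'g) \<Rightarrow> bool" where
  "gen_fun_converges Z \<longleftrightarrow> summable (\<lambda>n. meixner_poly (replicate (Suc n) Z))"

end


section \<open>The functions \<open>\<Psi>\<close> and \<open>C\<close>\<close>

definition Psi_fun :: "real \<Rightarrow> real \<Rightarrow> real \<Rightarrow> real" where
  "Psi_fun l e z = z / (1 + l * z + e * z\<^sup>2)"

text \<open>\<open>C\<^sub>\<lambda>\<^sub>,\<^sub>\<eta>\<close> is given only through its composition with \<open>\<Psi>\<^sub>\<lambda>\<^sub>,\<^sub>\<eta>\<close>, which is a local
  analytic diffeomorphism at 0. The composition determines the germ at 0 of an analytic \<open>C\<^sub>\<lambda>\<^sub>,\<^sub>\<eta>\<close>, and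
  \<^const>\<open>op_fun\<close> depends on the germ only.\<close>

definition C_fun :: "real \<Rightarrow> real \<Rightarrow> real \<Rightarrow> real" where
  "C_fun l e = (SOME f. (\<exists>a. power_series_at_0 f a) \<and>
     (\<forall>\<^sub>F z in nhds 0. f (Psi_fun l e z) = z\<^sup>2 / (1 + l * z + e * z\<^sup>2)))"

end

theory Submission
  imports Defs "HOL-Complex_Analysis.Cauchy_Integral_Formula"
begin

text \<open>For test functions \<open>Y\<close>, \<open>Z\<close> let \<open>H(Y)\<close> be the sum over \<open>n \<ge> 0\<close> of the polynomials in
  \<open>Y \<circledast> Z\<^sup>\<circledast>\<^sup>n\<close>, so that \<open>G = 1 + H(Z)\<close>. Summing the recursion of the polynomials gives
  \<open>H(Y (1 + \<lambda> Z + \<eta> Z\<^sup>2)) = (\<langle>\<omega>, Y\<rangle> - \<integral> Y Z d\<sigma>) G\<close>. With \<open>Y = \<Psi>(Z)\<close> the left side is \<open>G - 1\<close>,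
  hence \<open>(1 - \<langle>\<omega>, \<Psi>(Z)\<rangle> + \<integral> Z \<Psi>(Z) d\<sigma>) G = 1\<close>, and for small \<open>Z\<close> the first factor is invertible by a
  Neumann series.

  The analytic input is the bound \<open>\<parallel>\<langle>\<omega>, Z\<rangle>\<parallel> \<le> K\<^sub>A \<parallel>Z\<parallel>\<^sub>\<infinity>\<close> for \<open>Z\<close> supported in \<open>A\<close>. Let \<open>M(Z)\<close> be
  multiplication by \<open>Z\<close> of the first coordinate, and 0 on the vacuum. Then
  \<open>\<langle>\<omega>, Z\<rangle> = M(Z) X\<^sup>+(\<chi>\<^sub>A) + (X\<^sup>0(\<chi>\<^sub>A) + X\<^sup>-(\<chi>\<^sub>A)) M(Z)\<close>. If the sets of a simple \<open>Z\<close> are disjoint,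
  its summands in \<open>M(Z)\<close> have orthogonal ranges, so \<open>\<parallel>M(Z)\<parallel> \<le> \<parallel>Z\<parallel>\<^sub>\<infinity>\<close>.\<close>

section \<open>Extending operators from dense subspaces\<close>

text \<open>The recursion acts only on the first argument of a polynomial and leaves the others
  equal to Z. Freeing that argument to an arbitrary test function Y makes every term linear in Y,
  although Z itself enters non-linearly. Operators on the first tensor factor need not commute, but
  \<Psi>(Z) is a power series in Z and commutes with Z, on which the computation rests.

  Estimating a simple pairing summand by summand gives a constant that grows with the number of
  sets. The factorization avoids this: X^+ produces a first coordinate, so multiplication by Z can
  follow it, whereas X^0 and X^- read the first coordinate, so multiplication can precede them. The
  remaining factors depend on A alone.

  Summing the recursion only shows that G is a right inverse; the Neumann series makes it the
  inverse.

  The operators, pairings and integrals are definite descriptions. Each needs existence, by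
  extension from a dense set or by a limit, and uniqueness before it can be computed with.\<close>

lemma subspace_closure:
  fixes S :: "'a::real_normed_vector set"
  assumes "subspace S"
  shows "subspace (closure S)"
proof (rule subspaceI)
  show "0 \<in> closure S" using subspace_0[OF assms] closure_subset by auto
  fix x y assume "x \<in> closure S" "y \<in> closure S"
  then obtain f g where "\<forall>n. f n \<in> S" "f \<longlonglongrightarrow> x" "\<forall>n. g n \<in> S" "g \<longlonglongrightarrow> y"
    unfolding closure_sequential by blast
  then have "\<forall>n. (\<lambda>n. f n + g n) n \<in> S" "(\<lambda>n. f n + g n) \<longlonglongrightarrow> x + y"
    using subspace_add[OF assms] by (auto intro: tendsto_add)
  then show "x + y \<in> closure S" unfolding closure_sequential by fast
next
  fix x c assume "x \<in> closure S"
  then obtain f where "\<forall>n. f n \<in> S" "f \<longlonglongrightarrow> x" unfolding closure_sequential by blast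
  then have "\<forall>n. (\<lambda>n. c *\<^sub>R f n) n \<in> S" "(\<lambda>n. c *\<^sub>R f n) \<longlonglongrightarrow> c *\<^sub>R x"
    using subspace_scale[OF assms] by (auto intro: tendsto_intros)
  then show "c *\<^sub>R x \<in> closure S" unfolding closure_sequential by fast
qed

lemma closed_subspace_dense_induct:
  fixes S :: "'a::real_normed_vector set"
  assumes "closure (span S) = UNIV" "subspace {x. P x}" "closed {x. P x}" "\<And>x. x \<in> S \<Longrightarrow> P x"
  shows "P x"
proof -
  have "closure (span S) \<subseteq> {x. P x}"
    using assms by (intro closure_minimal span_minimal) auto
  then show ?thesis using assms(1) by auto
qed

lemma blinfun_eq_on_dense:
  fixes f g :: "'a::real_normed_vector \<Rightarrow>\<^sub>L 'b::real_normed_vector"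
  assumes "closure (span S) = UNIV" "\<And>x. x \<in> S \<Longrightarrow> f x = g x"
  shows "f = g"
proof (rule blinfun_eqI)
  fix x show "f x = g x"
  proof (rule closed_subspace_dense_induct[OF assms(1), where P="\<lambda>x. f x = g x"])
    show "subspace {x. f x = g x}"
      by (auto intro!: subspaceI simp: blinfun.bilinear_simps)
    show "closed {x. f x = g x}"
      by (intro closed_Collect_eq continuous_intros)
  qed (rule assms(2))
qed

text \<open>With one argument fixed the condition is linear and closed in the other, so the two
  arguments are freed one after the other. This reduces orthogonality of ranges to
  generators.\<close>

lemma orthogonal_on_dense:
  fixes f :: "'a::real_normed_vector \<Rightarrow>\<^sub>L 'c::real_inner" and g :: "'b::real_normed_vector \<Rightarrow>\<^sub>L 'c"
  assumes S: "closure (span S) = UNIV" and T: "closure (span T) = UNIV"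
    and orth: "\<And>x y. x \<in> S \<Longrightarrow> y \<in> T \<Longrightarrow> f x \<bullet> g y = 0"
  shows "f x \<bullet> g y = 0"
proof -
  have 1: "f x \<bullet> g y = 0" if "x \<in> S" for x y
  proof (rule closed_subspace_dense_induct[OF T, where P="\<lambda>y. f x \<bullet> g y = 0"])
    show "subspace {y. f x \<bullet> g y = 0}"
      by (auto intro!: subspaceI simp: blinfun.bilinear_simps inner_simps)
    show "closed {y. f x \<bullet> g y = 0}" by (intro closed_Collect_eq continuous_intros)
  qed (rule orth[OF that])
  show ?thesis
  proof (rule closed_subspace_dense_induct[OF S, where P="\<lambda>x. f x \<bullet> g y = 0"])
    show "subspace {x. f x \<bullet> g y = 0}"
      by (auto intro!: subspaceI simp: blinfun.bilinear_simps inner_simps)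
    show "closed {x. f x \<bullet> g y = 0}" by (intro closed_Collect_eq continuous_intros)
  qed (rule 1)
qed

text \<open>The graph of the extension is the closure of the span of the prescribed pairs.\<close>

lemma blinfun_extension:
  fixes S :: "('a::real_normed_vector \<times> 'b::banach) set"
  assumes dense: "closure (span (fst ` S)) = UNIV" and K: "0 \<le> K"
    and bd: "\<And>p. p \<in> span S \<Longrightarrow> norm (snd p) \<le> K * norm (fst p)"
  obtains U :: "'a \<Rightarrow>\<^sub>L 'b" where "norm U \<le> K" "\<And>x y. (x, y) \<in> S \<Longrightarrow> U x = y"
proof -
  define R where "R = closure (span S)"
  have subR: "subspace R" unfolding R_def by (intro subspace_closure subspace_span)
  have bR: "norm (snd p) \<le> K * norm (fst p)" if "p \<in> R" for p
  proof -
    have "R \<subseteq> {p. norm (snd p) \<le> K * norm (fst p)}"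
      unfolding R_def using bd
      by (intro closure_minimal closed_Collect_le continuous_intros) auto
    then show ?thesis using that by auto
  qed
  have "\<exists>y. (x, y) \<in> R" for x
  proof -
    have "span (fst ` S) = fst ` span S"
      by (rule span_linear_image) (simp add: linear_fst)
    then have "x \<in> closure (fst ` span S)" using dense by auto
    then obtain f where f: "\<forall>n. f n \<in> fst ` span S" "f \<longlonglongrightarrow> x"
      unfolding closure_sequential by blast
    then have "\<forall>n. \<exists>p. p \<in> span S \<and> fst p = f n" by fastforce
    then obtain p where p: "\<And>n. p n \<in> span S" "\<And>n. fst (p n) = f n" by metis
    have d: "norm (snd (p m) - snd (p n)) \<le> K * norm (f m - f n)" for m n
      using bd[OF span_diff[OF p(1) p(1)], of m n] p(2) by simp
    have "Cauchy (\<lambda>n. snd (p n))"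
    proof (rule CauchyI)
      fix e :: real assume "0 < e"
      have "Cauchy f" using f(2) by (rule LIMSEQ_imp_Cauchy)
      \<comment> \<open>The denominator \<open>K + 1\<close> stays positive when
        \<open>K = 0\<close>.\<close>
      then obtain M where M: "\<forall>m\<ge>M. \<forall>n\<ge>M. norm (f m - f n) < e / (K + 1)"
        using CauchyD[of f "e / (K + 1)"] \<open>0 < e\<close> K by auto
      have "norm (snd (p m) - snd (p n)) < e" if "m \<ge> M" "n \<ge> M" for m n
      proof -
        have "norm (snd (p m) - snd (p n)) \<le> K * norm (f m - f n)" by (rule d)
        also have "\<dots> \<le> (K + 1) * norm (f m - f n)" by (simp add: mult_right_mono)
        also have "\<dots> < e" using M that K by (auto simp: field_simps)
        finally show ?thesis .
      qed
      then show "\<exists>M. \<forall>m\<ge>M. \<forall>n\<ge>M. norm (snd (p m) - snd (p n)) < e" by blast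
    qed
    then obtain y where "(\<lambda>n. snd (p n)) \<longlonglongrightarrow> y" using Cauchy_convergent convergent_def by blast
    then have "(\<lambda>n. (fst (p n), snd (p n))) \<longlonglongrightarrow> (x, y)"
      using f(2) p(2) by (auto intro: tendsto_Pair)
    then have "(x, y) \<in> R" unfolding R_def closure_sequential using p(1) by auto
    then show ?thesis ..
  qed
  then obtain u where u: "\<And>x. (x, u x) \<in> R" by metis
  \<comment> \<open>Two points of \<open>R\<close> over the same \<open>x\<close> differ by
    \<open>(0, y - u x)\<close>, which the bound forces to be 0: the closed graph is
    single-valued.\<close>
  have uniq: "y = u x" if "(x, y) \<in> R" for x y
    using bR[OF subspace_diff[OF subR that u[of x]]] by simp
  have "linear u"
    by (rule linearI; rule uniq[symmetric])
       (use subspace_add[OF subR u u] subspace_scale[OF subR u] in auto)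
  moreover have nu: "norm (u x) \<le> norm x * K" for x
    using bR[OF u[of x]] by (simp add: mult.commute)
  ultimately have bl: "bounded_linear u"
    by (intro bounded_linear.intro bounded_linear_axioms.intro exI[of _ K]) auto
  show ?thesis
  proof
    show "norm (Blinfun u) \<le> K"
      using nu by (intro norm_blinfun_bound K) (auto simp: bounded_linear_Blinfun_apply[OF bl] mult.commute)
    show "Blinfun u x = y" if "(x, y) \<in> S" for x y
      using uniq[of x y] that closure_subset[of "span S"] span_superset[of S]
      unfolding bounded_linear_Blinfun_apply[OF bl] R_def by auto
  qed
qed

section \<open>Operator calculus for \<open>\<Psi>\<close> and \<open>C\<close>\<close>

text \<open>As rewrite rules these expand compositions into sums and bracket them to the left, so
  that equal polynomials in operators reach a common form. Rule (9) alone is the rebracketing,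
  (10,11) are the unit laws.\<close>

lemma blinfun_compose_simps:
  "(a + b) o\<^sub>L c = (a o\<^sub>L c) + (b o\<^sub>L c)" "a o\<^sub>L (b' + c') = (a o\<^sub>L b') + (a o\<^sub>L c')"
  "(a - b) o\<^sub>L c = (a o\<^sub>L c) - (b o\<^sub>L c)" "a o\<^sub>L (b' - c') = (a o\<^sub>L b') - (a o\<^sub>L c')"
  "(r *\<^sub>R a) o\<^sub>L c = r *\<^sub>R (a o\<^sub>L c)" "a o\<^sub>L (r *\<^sub>R c') = r *\<^sub>R (a o\<^sub>L c')"
  "(- a) o\<^sub>L c = - (a o\<^sub>L c)" "a o\<^sub>L (- c') = - (a o\<^sub>L c')"
  "a o\<^sub>L (c' o\<^sub>L d) = (a o\<^sub>L c') o\<^sub>L d"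
  "id_blinfun o\<^sub>L a = a" "a o\<^sub>L id_blinfun = a"
  by (auto intro!: blinfun_eqI simp: blinfun.bilinear_simps)

lemma blinfun_power_add: "blinfun_power R (m + n) = blinfun_power R m o\<^sub>L blinfun_power R n"
  by (induction m) (auto simp: blinfun_compose_simps)

lemma norm_blinfun_power_le: "norm (blinfun_power R n) \<le> norm R ^ n"
proof (induction n)
  case (Suc n)
  have "norm (R o\<^sub>L blinfun_power R n) \<le> norm R * norm (blinfun_power R n)" by (rule norm_blinfun_compose)
  also have "\<dots> \<le> norm R * norm R ^ n" using Suc by (simp add: mult_left_mono)
  finally show ?case by simp
qed (simp add: norm_blinfun_id_le)

lemma blinfun_inverse_eqI:
  assumes "R o\<^sub>L S = id_blinfun" "S o\<^sub>L R = id_blinfun"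
  shows "blinfun_invertible R" "blinfun_inverse R = S"
proof -
  show "blinfun_invertible R" unfolding blinfun_invertible_def using assms by blast
  show "blinfun_inverse R = S" unfolding blinfun_inverse_def
  proof (rule the_equality)
    fix S' assume S': "R o\<^sub>L S' = id_blinfun \<and> S' o\<^sub>L R = id_blinfun"
    have "S' = S' o\<^sub>L (R o\<^sub>L S)" by (simp add: assms blinfun_compose_simps(10,11))
    also have "\<dots> = S" by (simp add: blinfun_compose_simps(9) S' blinfun_compose_simps(10,11))
    finally show "S' = S" .
  qed (simp add: assms)
qed

text \<open>A power series with a non-zero coefficient of positive index that vanishes at 0 has an
  isolated zero there, but the difference of the two series vanishes near 0. This gives sense to the
  description of the coefficients in \<open>op_fun\<close>, and reduces it to the germ of the
  function.\<close>

lemma power_series_at_0_unique: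
  assumes f: "power_series_at_0 f a" and g: "power_series_at_0 g b"
    and ev: "\<forall>\<^sub>F x in nhds 0. f x = g x"
  shows "a = b"
proof (rule ccontr)
  assume "a \<noteq> b"
  then obtain m where m: "a m \<noteq> b m" by auto
  obtain r where r: "r > 0" "\<And>x. \<bar>x\<bar> < r \<Longrightarrow> (\<lambda>n. a n * x ^ n) sums f x"
    using f unfolding power_series_at_0_def by blast
  obtain s where s: "s > 0" "\<And>x. \<bar>x\<bar> < s \<Longrightarrow> (\<lambda>n. b n * x ^ n) sums g x"
    using g unfolding power_series_at_0_def by blast
  obtain d where d: "d > 0" "\<And>x. \<bar>x\<bar> < d \<Longrightarrow> f x = g x"
    using ev unfolding eventually_nhds_metric by (auto simp: dist_real_def)
  define q where "q = min r (min s d)"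
  have q: "q > 0" using r s d by (simp add: q_def)
  have sm: "(\<lambda>n. (a n - b n) * (x - 0) ^ n) sums (f x - g x)" if "norm (x - 0) < q" for x
    using sums_diff[OF r(2) s(2), of x] that by (simp add: q_def algebra_simps)
  have z: "f x - g x = 0" if "\<bar>x\<bar> < q" for x using d that by (simp add: q_def)
  have "f 0 - g 0 = 0" using z[of 0] q by simp
  \<comment> \<open>The constant coefficients are \<open>f 0\<close> and \<open>g 0\<close>, which
    agree; so the differing index is positive, as \<open>powser_0_nonzero\<close> demands.\<close>
  moreover have "m > 0"
    using m r(2)[of 0] s(2)[of 0] r(1) s(1) z[of 0] q by (cases m) auto
  ultimately obtain t where t: "t > 0" "\<And>z. z \<in> cball 0 t - {0} \<Longrightarrow> f z - g z \<noteq> 0"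
    using powser_0_nonzero[OF q sm, of m] m by (metis eq_iff_diff_eq_0)
  define x where "x = min t (q/2)"
  have "x > 0" "x \<le> t" "x < q" using t q by (auto simp: x_def)
  then show False using t(2)[of x] z[of x] by auto
qed

lemma op_fun_eq:
  assumes "power_series_at_0 f a"
  shows "op_fun f R = (\<Sum>n. a n *\<^sub>R blinfun_power R n)"
proof -
  have "(THE a. power_series_at_0 f a) = a"
    using assms power_series_at_0_unique[OF _ assms] by (blast intro: the_equality always_eventually)
  then show ?thesis by (simp add: op_fun_def)
qed

text \<open>The Taylor coefficients of 1 / (1 + l z + e z^2), read off from the identity that the
  series times its denominator is 1.\<close>

fun recip_coeff :: "real \<Rightarrow> real \<Rightarrow> nat \<Rightarrow> real" where
  "recip_coeff l e 0 = 1"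
| "recip_coeff l e (Suc 0) = - l"
| "recip_coeff l e (Suc (Suc n)) = - l * recip_coeff l e (Suc n) - e * recip_coeff l e n"

text \<open>With B = 1 + |l| + |e| one has |l| + |e| \<le> B and B^n \<le> B^(n+1), so the two-step
  recursion costs one factor B. The series then converges where B times the norm of the argument is
  below 1.\<close>

lemma recip_coeff_bound: "\<bar>recip_coeff l e n\<bar> \<le> (1 + \<bar>l\<bar> + \<bar>e\<bar>) ^ n"
proof (induction l e n rule: recip_coeff.induct)
  case (3 l e n)
  let ?B = "1 + \<bar>l\<bar> + \<bar>e\<bar>"
  have B: "0 \<le> ?B ^ n" "?B ^ n \<le> ?B ^ Suc n" by (simp_all add: algebra_simps)
  have "\<bar>recip_coeff l e (Suc (Suc n))\<bar> \<le> \<bar>l\<bar> * \<bar>recip_coeff l e (Suc n)\<bar> + \<bar>e\<bar> * \<bar>recip_coeff l e n\<bar>"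
    by (simp add: abs_mult[symmetric])
  also have "\<dots> \<le> \<bar>l\<bar> * ?B ^ Suc n + \<bar>e\<bar> * ?B ^ Suc n"
    using 3(1) order_trans[OF 3(2) B(2)] by (intro add_mono mult_left_mono) auto
  also have "\<dots> \<le> ?B * ?B ^ Suc n" using B by (simp add: algebra_simps)
  finally show ?case by simp
qed auto

section \<open>Scalar power series evaluated at powers in a Banach space\<close>

lemma summable_geometric_bound:
  fixes v :: "nat \<Rightarrow> 'b::banach"
  assumes "\<And>n. \<bar>c n\<bar> \<le> B ^ n" "\<And>n. norm (v n) \<le> r ^ n" "B * r < 1" "0 \<le> B" "0 \<le> r"
  shows "summable (\<lambda>n. norm (c n *\<^sub>R v n))" "norm (\<Sum>n. c n *\<^sub>R v n) \<le> 1 / (1 - B * r)"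
proof -
  have le: "norm (c n *\<^sub>R v n) \<le> (B * r) ^ n" for n
    using mult_mono[OF assms(1)[of n] assms(2)[of n]] assms(4) by (simp add: power_mult_distrib)
  have Br: "0 \<le> B * r" using assms by simp
  show s: "summable (\<lambda>n. norm (c n *\<^sub>R v n))"
    using le Br assms(3) by (intro summable_comparison_test'[OF summable_geometric[of "B * r"]]) auto
  have "norm (\<Sum>n. c n *\<^sub>R v n) \<le> (\<Sum>n. norm (c n *\<^sub>R v n))" by (rule summable_norm[OF s])
  also have "\<dots> \<le> (\<Sum>n. (B * r) ^ n)"
    using le Br assms(3) by (intro suminf_le s summable_geometric) auto
  also have "\<dots> = 1 / (1 - B * r)" using suminf_geometric[of "B * r"] Br assms(3) by simp
  finally show "norm (\<Sum>n. c n *\<^sub>R v n) \<le> 1 / (1 - B * r)" .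
qed

lemma sums_shift_case:
  fixes a :: "nat \<Rightarrow> 'a::real_normed_vector"
  assumes "a sums s"
  shows "(\<lambda>n. case n of 0 \<Rightarrow> 0 | Suc m \<Rightarrow> a m) sums s"
proof -
  have "(\<lambda>n. (\<lambda>n. case n of 0 \<Rightarrow> 0 | Suc m \<Rightarrow> a m) (Suc n)) sums s" using assms by simp
  from sums_Suc[OF this] show ?thesis by simp
qed

text \<open>Applying 1 + l T + e T^2 to the series cancels every coefficient of positive index by
  the recursion. The shift \<open>T\<close> stands for multiplication by a real number in one use
  and for left composition with an operator in the other.\<close>

lemma recip_series:
  fixes v :: "nat \<Rightarrow> 'b::banach"
  assumes s: "summable (\<lambda>n. recip_coeff l e n *\<^sub>R v n)"
    and T: "bounded_linear T" and v: "\<And>n. v (Suc n) = T (v n)"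
  defines "S \<equiv> \<Sum>n. recip_coeff l e n *\<^sub>R v n"
  shows "S + l *\<^sub>R T S + e *\<^sub>R T (T S) = v 0"
proof -
  interpret T: bounded_linear T by fact
  define a where "a n = recip_coeff l e n *\<^sub>R v n" for n
  have a: "a sums S" using s unfolding S_def a_def by (simp add: summable_sums)
  let ?b = "\<lambda>n. case n of 0 \<Rightarrow> 0 | Suc m \<Rightarrow> l *\<^sub>R T (a m)"
  let ?c = "\<lambda>n. case n of 0 \<Rightarrow> 0 | Suc m \<Rightarrow> (case m of 0 \<Rightarrow> 0 | Suc k \<Rightarrow> e *\<^sub>R T (T (a k)))"
  have 1: "(\<lambda>n. a n + ?b n + ?c n) sums (S + l *\<^sub>R T S + e *\<^sub>R T (T S))"
    by (intro sums_add sums_shift_case sums_scaleR_right T.sums a)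
  have "a n + ?b n + ?c n = (if n = 0 then v 0 else 0)" for n
  proof (cases n)
    case (Suc m)
    then show ?thesis by (cases m) (simp_all add: a_def v T.scaleR scaleR_diff_left)
  qed (simp add: a_def)
  with 1 have "(\<lambda>n. if n = 0 then v 0 else 0) sums (S + l *\<^sub>R T S + e *\<^sub>R T (T S))" by simp
  moreover have "(\<lambda>n. if n = 0 then v 0 else 0) sums v 0" using sums_single[of 0 "\<lambda>_. v 0"] by simp
  ultimately show ?thesis by (metis sums_unique2)
qed

text \<open>Partial products are sums over squares, Cauchy partial sums are sums over triangles.
  Their difference is dominated by the same difference for the norms, which tends to 0 by the real
  Cauchy product. An abstract \<open>prod\<close> covers both real multiplication and
  composition.\<close>

lemma bilinear_Cauchy_product:
  fixes prod :: "'a::banach \<Rightarrow> 'a \<Rightarrow> 'a"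
  assumes "bounded_bilinear prod" and le: "\<And>x y. norm (prod x y) \<le> norm x * norm y"
    and a: "summable (\<lambda>k. norm (a k))"
  shows "(\<lambda>k. \<Sum>i\<le>k. prod (a i) (a (k - i))) sums prod (\<Sum>k. a k) (\<Sum>k. a k)"
proof -
  interpret bounded_bilinear prod by fact
  let ?S = "\<lambda>n::nat. {..<n} \<times> {..<n}" and ?T = "\<lambda>n::nat. {(i, j). i + j < n}"
  have fin: "finite (?S n)" and sub: "?T n \<subseteq> ?S n" for n by auto
  let ?f = "\<lambda>(i, j). prod (a i) (a j)" and ?g = "\<lambda>(i, j). norm (a i) * norm (a j)"
  have 1: "(\<lambda>n. sum ?f (?S n)) \<longlonglongrightarrow> prod (\<Sum>k. a k) (\<Sum>k. a k)"
  proof -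
    have "(\<lambda>n. prod (\<Sum>k<n. a k) (\<Sum>k<n. a k)) \<longlonglongrightarrow> prod (\<Sum>k. a k) (\<Sum>k. a k)"
      by (intro tendsto summable_LIMSEQ summable_norm_cancel[OF a])
    moreover have "prod (\<Sum>k<n. a k) (\<Sum>k<n. a k) = sum ?f (?S n)" for n
      by (subst sum_left, subst sum_right, simp add: sum.cartesian_product)
    ultimately show ?thesis by simp
  qed
  have "(\<lambda>n. sum ?g (?S n)) \<longlonglongrightarrow> (\<Sum>k. norm (a k)) * (\<Sum>k. norm (a k))"
  proof -
    have "(\<lambda>n. (\<Sum>k<n. norm (a k)) * (\<Sum>k<n. norm (a k))) \<longlonglongrightarrow> (\<Sum>k. norm (a k)) * (\<Sum>k. norm (a k))"
      by (intro tendsto_mult summable_LIMSEQ a)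
    then show ?thesis by (simp add: sum_product sum.cartesian_product)
  qed
  moreover have "(\<lambda>n. sum ?g (?T n)) \<longlonglongrightarrow> (\<Sum>k. norm (a k)) * (\<Sum>k. norm (a k))"
    using Cauchy_product_sums[of "\<lambda>k. norm (a k)" "\<lambda>k. norm (a k)"] a
    by (simp add: sums_def sum.triangle_reindex)
  ultimately have g0: "(\<lambda>n. sum ?g (?S n) - sum ?g (?T n)) \<longlonglongrightarrow> 0"
    using tendsto_diff by fastforce
  have "(\<lambda>n. sum ?f (?S n) - sum ?f (?T n)) \<longlonglongrightarrow> 0"
  proof (rule Lim_null_comparison[OF _ g0], rule always_eventually, rule allI)
    fix n
    have "norm (sum ?f (?S n - ?T n)) \<le> sum ?g (?S n - ?T n)"
      using le by (intro sum_norm_le) auto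
    then show "norm (sum ?f (?S n) - sum ?f (?T n)) \<le> sum ?g (?S n) - sum ?g (?T n)"
      by (simp only: sum_diff[OF fin sub])
  qed
  from Lim_transform2[OF 1 this] show ?thesis
    by (simp only: sums_def sum.triangle_reindex)
qed

text \<open>The coefficients of the inverse function of \<open>\<Psi>\<close>, which solves \<open>y = w (1 + \<lambda> y + \<eta> y\<^sup>2)\<close>.\<close>

fun inv_coeff :: "real \<Rightarrow> real \<Rightarrow> nat \<Rightarrow> real" where
  "inv_coeff l e 0 = 0"
| "inv_coeff l e (Suc n) = (if n = 0 then 1 else 0) + l * inv_coeff l e n
     + e * (\<Sum>i\<le>n. inv_coeff l e i * inv_coeff l e (n - i))"

declare inv_coeff.simps(2)[simp del]

lemma sum_triangle_le_square:
  fixes a :: "nat \<Rightarrow> real"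
  assumes "\<And>n. 0 \<le> a n"
  shows "(\<Sum>n<N. \<Sum>i\<le>n. a i * a (n - i)) \<le> (\<Sum>n<N. a n)\<^sup>2"
proof -
  have "(\<Sum>n<N. \<Sum>i\<le>n. a i * a (n - i)) = (\<Sum>(i, j)\<in>{(i, j). i + j < N}. a i * a j)"
    by (simp add: sum.triangle_reindex)
  also have "\<dots> \<le> (\<Sum>(i, j)\<in>{..<N} \<times> {..<N}. a i * a j)"
    using assms by (intro sum_mono2) auto
  also have "\<dots> = (\<Sum>n<N. a n)\<^sup>2"
    by (simp add: power2_eq_square sum_product sum.cartesian_product)
  finally show ?thesis .
qed

text \<open>With \<open>r = 1 / (1 + \<bar>\<lambda>\<bar> + \<bar>\<eta>\<bar>)\<close>, the partial sums \<open>s\<close> of \<open>\<bar>a\<^sub>n\<bar> r\<^sup>n\<close> stay below 1, because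
  the next partial sum is at most \<open>r (1 + \<bar>\<lambda>\<bar> s + \<bar>\<eta>\<bar> s\<^sup>2)\<close>.\<close>

lemma inv_coeff_bound: "\<bar>inv_coeff l e n\<bar> \<le> (1 + \<bar>l\<bar> + \<bar>e\<bar>) ^ n"
proof -
  define r where "r = 1 / (1 + \<bar>l\<bar> + \<bar>e\<bar>)"
  have r: "r > 0" "r * (1 + \<bar>l\<bar> + \<bar>e\<bar>) = 1" unfolding r_def by (auto simp: add_pos_nonneg)
  define a where "a n = \<bar>inv_coeff l e n\<bar> * r ^ n" for n
  have a: "0 \<le> a n" for n using r by (simp add: a_def)
  have step: "a (Suc n) \<le> r * ((if n = 0 then 1 else 0) + \<bar>l\<bar> * a n + \<bar>e\<bar> * (\<Sum>i\<le>n. a i * a (n - i)))" for n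
  proof -
    have "\<bar>inv_coeff l e (Suc n)\<bar> \<le> (if n = 0 then 1 else 0) + \<bar>l\<bar> * \<bar>inv_coeff l e n\<bar>
       + \<bar>e\<bar> * (\<Sum>i\<le>n. \<bar>inv_coeff l e i\<bar> * \<bar>inv_coeff l e (n - i)\<bar>)"
    proof -
      have "\<bar>inv_coeff l e (Suc n)\<bar> \<le> \<bar>if n = 0 then 1 else 0\<bar> + \<bar>l * inv_coeff l e n\<bar>
         + \<bar>e * (\<Sum>i\<le>n. inv_coeff l e i * inv_coeff l e (n - i))\<bar>"
        unfolding inv_coeff.simps by linarith
      also have "\<dots> \<le> (if n = 0 then 1 else 0) + \<bar>l\<bar> * \<bar>inv_coeff l e n\<bar>
         + \<bar>e\<bar> * (\<Sum>i\<le>n. \<bar>inv_coeff l e i\<bar> * \<bar>inv_coeff l e (n - i)\<bar>)"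
        unfolding abs_mult by (intro add_mono mult_left_mono order_trans[OF sum_abs]) (auto simp: abs_mult)
      finally show ?thesis .
    qed
    then have "a (Suc n) \<le> ((if n = 0 then 1 else 0) + \<bar>l\<bar> * \<bar>inv_coeff l e n\<bar>
       + \<bar>e\<bar> * (\<Sum>i\<le>n. \<bar>inv_coeff l e i\<bar> * \<bar>inv_coeff l e (n - i)\<bar>)) * r ^ Suc n"
      unfolding a_def using r by (intro mult_right_mono) auto
    also have "\<dots> = r * ((if n = 0 then 1 else 0) + \<bar>l\<bar> * a n + \<bar>e\<bar> * (\<Sum>i\<le>n. a i * a (n - i)))"
    proof -
      have "(\<Sum>i\<le>n. \<bar>inv_coeff l e i\<bar> * \<bar>inv_coeff l e (n - i)\<bar>) * r ^ n = (\<Sum>i\<le>n. a i * a (n - i))"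
        unfolding sum_distrib_right a_def
        by (intro sum.cong refl) (simp add: power_add[symmetric] mult_ac)
      then show ?thesis by (simp add: a_def algebra_simps)
    qed
    finally show ?thesis .
  qed
  have S: "(\<Sum>n<N. a n) \<le> 1" for N
  proof (induction N)
    case (Suc N)
    let ?s = "\<Sum>n<N. a n"
    have s0: "0 \<le> ?s" by (intro sum_nonneg a)
    have "(\<Sum>n<Suc N. a n) = (\<Sum>n<N. a (Suc n))"
      by (simp only: sum.lessThan_Suc_shift) (simp add: a_def)
    also have "\<dots> \<le> (\<Sum>n<N. r * ((if n = 0 then 1 else 0) + \<bar>l\<bar> * a n + \<bar>e\<bar> * (\<Sum>i\<le>n. a i * a (n - i))))"
      by (intro sum_mono step)
    also have "\<dots> = r * ((\<Sum>n<N. if n = 0 then 1 else 0) + \<bar>l\<bar> * ?s + \<bar>e\<bar> * (\<Sum>n<N. \<Sum>i\<le>n. a i * a (n - i)))"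
      by (simp only: sum_distrib_left[symmetric] sum.distrib)
    also have "\<dots> \<le> r * (1 + \<bar>l\<bar> * 1 + \<bar>e\<bar> * 1)"
    proof -
      have "(\<Sum>n<N. if n = 0 then 1 else 0 :: real) \<le> 1" by (simp add: sum.delta)
      moreover have "(\<Sum>n<N. \<Sum>i\<le>n. a i * a (n - i)) \<le> 1"
        using order_trans[OF sum_triangle_le_square[where a=a, OF a], of N] power_le_one[OF s0 Suc, of 2] by blast
      ultimately show ?thesis using r Suc by (intro mult_left_mono add_mono) auto
    qed
    finally show ?case using r by simp
  qed simp
  have "a n \<le> 1" using S[of "Suc n"] sum_nonneg[of "{..<n}" a] a by simp
  then have "\<bar>inv_coeff l e n\<bar> \<le> 1 / r ^ n" using r by (simp add: a_def field_simps)
  also have "\<dots> = (1 + \<bar>l\<bar> + \<bar>e\<bar>) ^ n" unfolding r_def by (simp add: power_divide)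
  finally show ?thesis .
qed

text \<open>The series of the inverse function and \<open>R\<close> are both the fixed point of a contraction.\<close>

lemma inv_series:
  fixes prod :: "'a::banach \<Rightarrow> 'a \<Rightarrow> 'a"
  assumes bil: "bounded_bilinear prod" and le: "\<And>x y. norm (prod x y) \<le> norm x * norm y"
    and p: "\<And>n. p (Suc n) = prod w (p n)" "\<And>i j. prod (p i) (p j) = p (i + j)"
    and np: "\<And>n. norm (p n) \<le> norm w ^ n"
    and w: "2 * (1 + \<bar>l\<bar> + \<bar>e\<bar>) * norm w < 1"
  defines "y \<equiv> \<Sum>n. inv_coeff l e n *\<^sub>R p n"
  shows "summable (\<lambda>n. norm (inv_coeff l e n *\<^sub>R p n))" "norm y \<le> 2 * (1 + \<bar>l\<bar> + \<bar>e\<bar>) * norm w"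
    "y = prod w (p 0 + l *\<^sub>R y + e *\<^sub>R prod y y)"
    "\<And>R. R = prod w (p 0 + l *\<^sub>R R + e *\<^sub>R prod R R) \<Longrightarrow> norm R \<le> 1 \<Longrightarrow> y = R"
proof -
  interpret bounded_bilinear prod by fact
  let ?B = "1 + \<bar>l\<bar> + \<bar>e\<bar>"
  define a where "a n = inv_coeff l e n *\<^sub>R p n" for n
  have y_def: "y = (\<Sum>n. a n)" unfolding assms(7) a_def ..
  have "2 * (?B * norm w) < 1" using w by (simp only: mult.assoc)
  then have w1: "?B * norm w < 1/2" by linarith
  have sm: "summable (\<lambda>n. norm (a n))"
    unfolding a_def using w1 by (intro summable_geometric_bound(1)[OF inv_coeff_bound np]) auto
  then show "summable (\<lambda>n. norm (inv_coeff l e n *\<^sub>R p n))" unfolding a_def .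
  have a: "a sums y" unfolding y_def using summable_norm_cancel[OF sm] by (rule summable_sums)
  \<comment> \<open>The term of index 0 is 0, so each term keeps a factor \<open>norm w\<close>
    while the rest decays with ratio at most 1/2. This gives a bound on \<open>y\<close> that is
    linear in \<open>norm w\<close>.\<close>
  have na: "norm (a (Suc n)) \<le> (?B * norm w) * (1/2) ^ n" for n
  proof -
    have "norm (a (Suc n)) \<le> ?B ^ Suc n * norm w ^ Suc n"
      unfolding a_def using mult_mono[OF inv_coeff_bound[of l e "Suc n"] np[of "Suc n"]] by simp
    also have "\<dots> = (?B * norm w) * (?B * norm w) ^ n" by (simp add: power_mult_distrib)
    also have "\<dots> \<le> (?B * norm w) * (1/2) ^ n"
      using w1 by (intro mult_left_mono power_mono) auto
    finally show ?thesis .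
  qed
  show ny: "norm y \<le> 2 * ?B * norm w"
  proof -
    have "(\<lambda>n. a (Suc n)) sums y" using a by (subst sums_Suc_iff) (simp add: a_def)
    then have "y = (\<Sum>n. a (Suc n))" by (rule sums_unique)
    also have "norm \<dots> \<le> (\<Sum>n. norm (a (Suc n)))"
      using sm by (intro summable_norm) (subst summable_Suc_iff)
    also have "\<dots> \<le> (\<Sum>n. (?B * norm w) * (1/2) ^ n)"
      using sm by (intro suminf_le na summable_mult summable_geometric summable_Suc_iff[THEN iffD2]) auto
    also have "\<dots> = (?B * norm w) * 2"
      by (subst suminf_mult) (simp_all add: suminf_geometric)
    finally show ?thesis by (simp only: mult_ac)
  qed
  show y: "y = prod w (p 0 + l *\<^sub>R y + e *\<^sub>R prod y y)"
  proof -
    have "(\<lambda>k. \<Sum>i\<le>k. prod (a i) (a (k - i))) sums prod y y"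
      unfolding y_def by (rule bilinear_Cauchy_product[OF bil le sm])
    moreover have "(\<lambda>n. if n = 0 then p 0 else 0) sums p 0" using sums_single[of 0 "\<lambda>_. p 0"] by simp
    ultimately have "(\<lambda>n. prod w ((if n = 0 then p 0 else 0) + l *\<^sub>R a n
        + e *\<^sub>R (\<Sum>i\<le>n. prod (a i) (a (n - i))))) sums prod w (p 0 + l *\<^sub>R y + e *\<^sub>R prod y y)"
      by (intro bounded_linear.sums[OF bounded_linear_right] sums_add sums_scaleR_right a)
    moreover have "prod w ((if n = 0 then p 0 else 0) + l *\<^sub>R a n
        + e *\<^sub>R (\<Sum>i\<le>n. prod (a i) (a (n - i)))) = a (Suc n)" for n
    proof -
      have "(\<Sum>i\<le>n. prod (a i) (a (n - i))) = (\<Sum>i\<le>n. inv_coeff l e i * inv_coeff l e (n - i)) *\<^sub>R p n"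
        unfolding scaleR_sum_left a_def by (intro sum.cong refl) (simp add: scaleR_left scaleR_right p(2) mult.commute)
      then show ?thesis
        by (simp add: a_def inv_coeff.simps p(1) add_right scaleR_right scaleR_left_distrib zero_right)
    qed
    ultimately have "(\<lambda>n. a (Suc n)) sums prod w (p 0 + l *\<^sub>R y + e *\<^sub>R prod y y)" by simp
    moreover have "(\<lambda>n. a (Suc n)) sums y" using a by (subst sums_Suc_iff) (simp add: a_def)
    ultimately show ?thesis by (rule sums_unique2[symmetric])
  qed
  fix R assume R: "R = prod w (p 0 + l *\<^sub>R R + e *\<^sub>R prod R R)" "norm R \<le> 1"
  have "norm y \<le> 1" using ny w by linarith
  have "y - R = prod w (p 0 + l *\<^sub>R y + e *\<^sub>R prod y y) - prod w (p 0 + l *\<^sub>R R + e *\<^sub>R prod R R)"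
    by (rule arg_cong2[where f="(-)", OF y R(1)])
  \<comment> \<open>The split y y - R R = y (y - R) + (y - R) R keeps the order of the factors,
    since \<open>prod\<close> is not assumed commutative.\<close>
  also have "\<dots> = prod w (l *\<^sub>R (y - R) + e *\<^sub>R (prod y (y - R) + prod (y - R) R))"
    by (simp add: diff_left diff_right add_right scaleR_right algebra_simps)
  also have "norm \<dots> \<le> norm w * (\<bar>l\<bar> * norm (y - R) + \<bar>e\<bar> * (norm (y - R) + norm (y - R)))"
  proof -
    have "norm (prod y (y - R)) \<le> norm (y - R)" "norm (prod (y - R) R) \<le> norm (y - R)"
      using order_trans[OF le mult_right_mono[OF \<open>norm y \<le> 1\<close>]] order_trans[OF le mult_left_mono[OF R(2)]]
      by auto
    then show ?thesis
      by (intro order_trans[OF le] mult_left_mono norm_triangle_le add_mono) (auto intro!: mult_left_mono norm_triangle_le)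
  qed
  also have "\<dots> \<le> (2 * ?B * norm w) * norm (y - R)"
    by (simp add: algebra_simps mult_nonneg_nonneg)
  finally have "norm (y - R) \<le> (2 * ?B * norm w) * norm (y - R)" .
  then have "norm (y - R) = 0"
    using w by (metis linorder_not_less mult_less_cancel_right2 norm_ge_zero order_less_le)
  then show "y = R" by simp
qed

abbreviation (input) shift_coeff :: "(nat \<Rightarrow> real) \<Rightarrow> nat \<Rightarrow> real" where
  "shift_coeff a \<equiv> (\<lambda>n. case n of 0 \<Rightarrow> 0 | Suc m \<Rightarrow> a m)"

lemma power_series_at_0_shift:
  assumes "power_series_at_0 f a"
  shows "power_series_at_0 (\<lambda>z. z * f z) (shift_coeff a)"
proof -
  obtain r where r: "r > 0" "\<And>x. \<bar>x\<bar> < r \<Longrightarrow> (\<lambda>n. a n * x ^ n) sums f x"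
    using assms unfolding power_series_at_0_def by blast
  have "(\<lambda>n. shift_coeff a n * x ^ n) sums (x * f x)" if "\<bar>x\<bar> < r" for x
  proof -
    have "(\<lambda>n. case n of 0 \<Rightarrow> 0 | Suc m \<Rightarrow> x * (a m * x ^ m)) sums (x * f x)"
      by (intro sums_shift_case sums_mult r(2) that)
    moreover have "(case n of 0 \<Rightarrow> 0 | Suc m \<Rightarrow> x * (a m * x ^ m)) = shift_coeff a n * x ^ n" for n
      by (cases n) auto
    ultimately show ?thesis by simp
  qed
  then show ?thesis unfolding power_series_at_0_def using r(1) by blast
qed

lemma op_series_shift:
  fixes R :: "'a::banach \<Rightarrow>\<^sub>L 'a"
  assumes "(\<lambda>n. a n *\<^sub>R blinfun_power R n) sums S"
  shows "(\<lambda>n. shift_coeff a n *\<^sub>R blinfun_power R n) sums (R o\<^sub>L S)"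
proof -
  have "(\<lambda>n. case n of 0 \<Rightarrow> 0 | Suc m \<Rightarrow> R o\<^sub>L (a m *\<^sub>R blinfun_power R m)) sums (R o\<^sub>L S)"
    by (intro sums_shift_case bounded_linear.sums[OF _ assms]
        bounded_bilinear.bounded_linear_right[OF bounded_bilinear_blinfun_compose])
  moreover have "(case n of 0 \<Rightarrow> 0 | Suc m \<Rightarrow> R o\<^sub>L (a m *\<^sub>R blinfun_power R m))
      = shift_coeff a n *\<^sub>R blinfun_power R n" for n
    by (cases n) (auto simp: blinfun_compose_simps)
  ultimately show ?thesis by simp
qed

lemma power_series_recip:
  "power_series_at_0 (\<lambda>z. 1 / (1 + l * z + e * z\<^sup>2)) (recip_coeff l e)"
proof -
  let ?B = "1 + \<bar>l\<bar> + \<bar>e\<bar>"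
  have B: "0 < ?B" by simp
  have "(\<lambda>n. recip_coeff l e n * x ^ n) sums (1 / (1 + l * x + e * x\<^sup>2))" if "\<bar>x\<bar> < 1 / ?B" for x
  proof -
    have "?B * \<bar>x\<bar> < 1" using that B by (simp add: field_simps)
    then have s: "summable (\<lambda>n. recip_coeff l e n *\<^sub>R x ^ n)"
      using summable_geometric_bound(1)[OF recip_coeff_bound[of l e], of "\<lambda>n. x ^ n" "\<bar>x\<bar>"]
      by (intro summable_norm_cancel[of "\<lambda>n. recip_coeff l e n *\<^sub>R x ^ n"]) (auto simp: power_abs)
    have "(\<Sum>n. recip_coeff l e n *\<^sub>R x ^ n) * (1 + l * x + e * x\<^sup>2) = 1"
      using recip_series[OF s bounded_linear_mult_right[of x]] by (simp add: algebra_simps power2_eq_square)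
    then have "(\<Sum>n. recip_coeff l e n *\<^sub>R x ^ n) = 1 / (1 + l * x + e * x\<^sup>2)"
      by (metis mult_zero_right nonzero_eq_divide_eq zero_neq_one)
    then show ?thesis using summable_sums[OF s] by simp
  qed
  then show ?thesis unfolding power_series_at_0_def using B by (intro exI[of _ "1 / ?B"]) auto
qed

text \<open>From |z| \<le> 1/8 follows |e z^2| \<le> |e| |z|, so both correction terms together have
  modulus at most 1/8 and the denominator stays away from 0.\<close>

lemma quadratic_denominator_bound:
  fixes z :: real
  assumes "8 * (1 + \<bar>l\<bar> + \<bar>e\<bar>) * \<bar>z\<bar> \<le> 1"
  shows "\<bar>z\<bar> \<le> 1 / 8" "1 / 2 < 1 + l * z + e * z\<^sup>2"
proof -
  have 1: "8 * \<bar>z\<bar> + 8 * (\<bar>l\<bar> * \<bar>z\<bar>) + 8 * (\<bar>e\<bar> * \<bar>z\<bar>) \<le> 1" using assms by (simp add: algebra_simps)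
  have 2: "0 \<le> \<bar>l\<bar> * \<bar>z\<bar>" "0 \<le> \<bar>e\<bar> * \<bar>z\<bar>" by auto
  show z: "\<bar>z\<bar> \<le> 1 / 8" using 1 2 by linarith
  have "\<bar>e * z\<^sup>2\<bar> \<le> \<bar>e\<bar> * \<bar>z\<bar>"
    using z mult_left_mono[of "\<bar>z\<bar> * \<bar>z\<bar>" "\<bar>z\<bar>" "\<bar>e\<bar>"] mult_left_le[of "\<bar>z\<bar>" "\<bar>z\<bar>"]
    by (simp add: abs_mult power2_eq_square)
  moreover have "\<bar>l * z\<bar> \<le> \<bar>l\<bar> * \<bar>z\<bar>" by (simp add: abs_mult)
  ultimately have "- (\<bar>e\<bar> * \<bar>z\<bar>) \<le> e * z\<^sup>2" "- (\<bar>l\<bar> * \<bar>z\<bar>) \<le> l * z" by linarith+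
  then show "1 / 2 < 1 + l * z + e * z\<^sup>2" using 1 2 abs_ge_zero[of z] by linarith
qed

text \<open>Let y be the local inverse of \<Psi>. The function w y(w) meets the specification of
  \<open>C_fun\<close>, so the choice operator returns some function that meets it. Any such
  function agrees with w y(w) near 0: every small w is \<Psi>(z) for z = y(w), and the specification
  then prescribes the value z \<Psi>(z) = w y(w). Uniqueness of coefficients finishes the
  argument.\<close>

lemma power_series_C_fun: "power_series_at_0 (C_fun l e) (shift_coeff (inv_coeff l e))"
proof -
  let ?B = "1 + \<bar>l\<bar> + \<bar>e\<bar>"
  have B: "1 \<le> ?B" by simp
  define y where "y w = (\<Sum>n. inv_coeff l e n *\<^sub>R w ^ n)" for w :: real
  have bil: "bounded_bilinear ((*) :: real \<Rightarrow> real \<Rightarrow> real)" by (rule bounded_bilinear_mult)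
  have y: "summable (\<lambda>n. \<bar>inv_coeff l e n * w ^ n\<bar>)" "\<bar>y w\<bar> \<le> 2 * ?B * \<bar>w\<bar>"
      "y w = w * (1 + l * y w + e * (y w * y w))"
      "\<And>z. z = w * (1 + l * z + e * (z * z)) \<Longrightarrow> \<bar>z\<bar> \<le> 1 \<Longrightarrow> y w = z"
    if "2 * ?B * \<bar>w\<bar> < 1" for w
  proof -
    have w: "2 * ?B * norm w < 1" using that by simp
    note inv = inv_series[OF bil norm_mult_ineq power_Suc power_add[symmetric] norm_power_ineq w, folded y_def]
    show "summable (\<lambda>n. \<bar>inv_coeff l e n * w ^ n\<bar>)" using inv(1) by simp
    show "\<bar>y w\<bar> \<le> 2 * ?B * \<bar>w\<bar>" using inv(2) by simp
    show "y w = w * (1 + l * y w + e * (y w * y w))" using inv(3) by simp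
    show "y w = z" if "z = w * (1 + l * z + e * (z * z))" "\<bar>z\<bar> \<le> 1" for z
      using inv(4)[of z] that by simp
  qed
  have "power_series_at_0 y (inv_coeff l e)"
    unfolding power_series_at_0_def
  proof (intro exI[of _ "1 / (2 * ?B)"] conjI allI impI)
    fix x assume "\<bar>x\<bar> < 1 / (2 * ?B)"
    then have "2 * ?B * \<bar>x\<bar> < 1" using B by (simp add: field_simps)
    from summable_rabs_cancel[OF y(1)[OF this]]
    show "(\<lambda>n. inv_coeff l e n * x ^ n) sums y x" by (simp add: y_def summable_sums)
  qed (use B in simp)
  from power_series_at_0_shift[OF this]
  have ps: "power_series_at_0 (\<lambda>w. w * y w) (shift_coeff (inv_coeff l e))" .
  have ev0: "\<forall>\<^sub>F z in nhds 0. 8 * ?B * \<bar>z\<bar> < 1"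
    unfolding eventually_nhds_metric using B
    by (intro exI[of _ "1 / (8 * ?B)"]) (auto simp: field_simps)
  have "\<forall>\<^sub>F z in nhds 0. Psi_fun l e z * y (Psi_fun l e z) = z\<^sup>2 / (1 + l * z + e * z\<^sup>2)"
    using ev0
  proof eventually_elim
    case (elim z)
    note d = quadratic_denominator_bound[OF less_imp_le[OF elim]]
    have "\<bar>Psi_fun l e z\<bar> \<le> 2 * \<bar>z\<bar>"
    proof -
      define D where "D = 1 + l * z + e * z\<^sup>2"
      have "\<bar>z\<bar> / D \<le> \<bar>z\<bar> / (1 / 2)" using d(2) unfolding D_def[symmetric] by (intro divide_left_mono) auto
      then show ?thesis using d(2) unfolding Psi_fun_def D_def[symmetric] by simp
    qed
    then have "2 * ?B * \<bar>Psi_fun l e z\<bar> \<le> 2 * ?B * (2 * \<bar>z\<bar>)" using B by (intro mult_left_mono) auto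
    then have "2 * ?B * \<bar>Psi_fun l e z\<bar> < 1" using elim by linarith
    moreover have "z = Psi_fun l e z * (1 + l * z + e * (z * z))"
      using d(2) unfolding Psi_fun_def power2_eq_square[symmetric] by (simp only: times_divide_eq_left) simp
    ultimately have "y (Psi_fun l e z) = z" using d(1) by (intro y(4)) auto
    then show ?case by (simp add: Psi_fun_def power2_eq_square)
  qed
  with ps have "\<exists>f. (\<exists>a. power_series_at_0 f a) \<and> (\<forall>\<^sub>F z in nhds 0. f (Psi_fun l e z) = z\<^sup>2 / (1 + l * z + e * z\<^sup>2))"
    by blast
  from someI_ex[OF this] obtain a where a: "power_series_at_0 (C_fun l e) a"
    and C: "\<forall>\<^sub>F z in nhds 0. C_fun l e (Psi_fun l e z) = z\<^sup>2 / (1 + l * z + e * z\<^sup>2)"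
    unfolding C_fun_def by blast
  from eventually_conj[OF C ev0] obtain d where d: "d > 0" "\<And>z. \<bar>z\<bar> < d \<Longrightarrow>
      C_fun l e (Psi_fun l e z) = z\<^sup>2 / (1 + l * z + e * z\<^sup>2) \<and> 8 * ?B * \<bar>z\<bar> < 1"
    unfolding eventually_nhds_metric by (auto simp: dist_real_def)
  have "\<forall>\<^sub>F w in nhds 0. C_fun l e w = w * y w"
    unfolding eventually_nhds_metric
  \<comment> \<open>By |y(w)| \<le> 2 B |w| this radius puts z = y(w) where the specification of
    \<open>C_fun\<close> holds; the minimum with 1 keeps w in the domain of the inverse
    series.\<close>
  proof (intro exI[of _ "min d 1 / (2 * ?B)"] conjI allI impI)
    fix w :: real assume "dist w 0 < min d 1 / (2 * ?B)"
    then have w: "2 * ?B * \<bar>w\<bar> < min d 1" using B by (simp add: field_simps dist_real_def)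
    define z where "z = y w"
    have z: "\<bar>z\<bar> < d" "z = w * (1 + l * z + e * (z * z))" using y(2,3)[of w] w unfolding z_def by auto
    note dz = d(2)[OF z(1)]
    have den: "1 + l * z + e * z\<^sup>2 > 1/2" using dz by (intro quadratic_denominator_bound(2)) linarith
    then have "Psi_fun l e z = w"
      using z(2) unfolding Psi_fun_def power2_eq_square[symmetric] by (metis divide_eq_eq less_numeral_extra(3) order_less_trans zero_less_divide_1_iff zero_less_numeral)
    moreover have "z\<^sup>2 / (1 + l * z + e * z\<^sup>2) = Psi_fun l e z * z"
      by (simp add: Psi_fun_def power2_eq_square)
    ultimately show "C_fun l e w = w * y w" using dz unfolding z_def by metis
  qed (use d(1) B in auto)
  from power_series_at_0_unique[OF a ps this] show ?thesis using a by simp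
qed

text \<open>\<open>N\<close> is the inverse of 1 + l R + e R^2, given by the reciprocal series in
  \<open>R\<close>. It converts every operator function in the theorem into a word in
  \<open>R\<close> and \<open>N\<close>, so that only algebra remains. The factor 8 yields norm
  \<open>N\<close> at most 2, hence norm at most 2 norm \<open>R\<close> for
  \<open>R o\<^sub>L N\<close>, which is small enough for the inverse series.\<close>

lemma op_calculus:
  fixes R :: "'a::banach \<Rightarrow>\<^sub>L 'a"
  assumes small: "8 * (1 + \<bar>l\<bar> + \<bar>e\<bar>) * norm R \<le> 1"
  obtains N where
    "N + l *\<^sub>R (R o\<^sub>L N) + e *\<^sub>R (R o\<^sub>L R o\<^sub>L N) = id_blinfun" "R o\<^sub>L N = N o\<^sub>L R" "norm N \<le> 2"
    "op_fun (Psi_fun l e) R = R o\<^sub>L N"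
    "op_fun (\<lambda>z. z / (1 + l * z + e * z\<^sup>2)) R = R o\<^sub>L N"
    "op_fun (\<lambda>z. z\<^sup>2 / (1 + l * z + e * z\<^sup>2)) R = R o\<^sub>L R o\<^sub>L N"
    "op_fun (C_fun l e) (R o\<^sub>L N) = R o\<^sub>L R o\<^sub>L N"
proof
  let ?B = "1 + \<bar>l\<bar> + \<bar>e\<bar>" and ?c = "recip_coeff l e"
  have B: "1 \<le> ?B" by simp
  have "8 * (?B * norm R) \<le> 1" using small by (simp only: mult.assoc)
  then have R8: "?B * norm R \<le> 1 / 8" by linarith
  have R1: "norm R \<le> 1 / 8" using R8 mult_right_mono[OF B, of "norm R"] by simp
  have BR: "?B * norm R < 1" using R8 by linarith
  note gb = summable_geometric_bound[OF recip_coeff_bound[of l e] norm_blinfun_power_le[of R] BR _ norm_ge_zero]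
  define N where "N = (\<Sum>n. ?c n *\<^sub>R blinfun_power R n)"
  have s: "summable (\<lambda>n. ?c n *\<^sub>R blinfun_power R n)" using gb(1) B by (auto intro: summable_norm_cancel)
  have Nsum: "(\<lambda>n. ?c n *\<^sub>R blinfun_power R n) sums N" unfolding N_def using s by (rule summable_sums)
  have bl: "bounded_linear (\<lambda>S. R o\<^sub>L S)" "bounded_linear (\<lambda>S. S o\<^sub>L R)"
    by (rule bounded_bilinear.bounded_linear_right[OF bounded_bilinear_blinfun_compose],
        rule bounded_bilinear.bounded_linear_left[OF bounded_bilinear_blinfun_compose])
  show rec: "N + l *\<^sub>R (R o\<^sub>L N) + e *\<^sub>R (R o\<^sub>L R o\<^sub>L N) = id_blinfun"
    using recip_series[OF s bl(1)] unfolding N_def[symmetric] by (simp add: blinfun_compose_simps(9))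
  show comm: "R o\<^sub>L N = N o\<^sub>L R"
  proof -
    have "R o\<^sub>L blinfun_power R n = blinfun_power R n o\<^sub>L R" for n
    proof (induction n)
      case (Suc n)
      then show ?case by (metis blinfun_power.simps(2) blinfun_compose_simps(9))
    qed (simp add: blinfun_compose_simps(10,11))
    then have "(\<lambda>n. ?c n *\<^sub>R blinfun_power R n o\<^sub>L R) sums (R o\<^sub>L N)"
      using bounded_linear.sums[OF bl(1) Nsum] by (simp add: blinfun_compose_simps)
    with bounded_linear.sums[OF bl(2) Nsum] show ?thesis by (rule sums_unique2[symmetric])
  qed
  show N2: "norm N \<le> 2"
  proof -
    have "norm N \<le> 1 / (1 - ?B * norm R)" unfolding N_def using gb(2) B by simp
    also have "\<dots> \<le> 2" using R8 by (simp add: field_simps)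
    finally show ?thesis .
  qed
  note ps1 = power_series_at_0_shift[OF power_series_recip[of l e]]
  note ps2 = power_series_at_0_shift[OF ps1]
  have f1: "(\<lambda>z. z * (1 / (1 + l * z + e * z\<^sup>2))) = (\<lambda>z. z / (1 + l * z + e * z\<^sup>2))"
    "(\<lambda>z. z * (z * (1 / (1 + l * z + e * z\<^sup>2)))) = (\<lambda>z. z\<^sup>2 / (1 + l * z + e * z\<^sup>2))"
    by (auto simp: power2_eq_square)
  have PsiQ: "Psi_fun l e = (\<lambda>z. z / (1 + l * z + e * z\<^sup>2))" by (auto simp: Psi_fun_def)
  show Q1: "op_fun (\<lambda>z. z / (1 + l * z + e * z\<^sup>2)) R = R o\<^sub>L N"
    using op_fun_eq[OF ps1, of R] sums_unique[OF op_series_shift[OF Nsum]] by (simp add: f1)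
  then show "op_fun (Psi_fun l e) R = R o\<^sub>L N" by (simp add: PsiQ)
  show "op_fun (\<lambda>z. z\<^sup>2 / (1 + l * z + e * z\<^sup>2)) R = R o\<^sub>L R o\<^sub>L N"
    using op_fun_eq[OF ps2, of R, unfolded f1] sums_unique[OF op_series_shift[OF op_series_shift[OF Nsum]]]
    by (simp add: blinfun_compose_simps(9))
  show "op_fun (C_fun l e) (R o\<^sub>L N) = R o\<^sub>L R o\<^sub>L N"
  proof -
    define w where "w = R o\<^sub>L N"
    have "norm w \<le> norm R * 2"
      unfolding w_def using order_trans[OF norm_blinfun_compose mult_left_mono[OF N2]] by simp
    then have "?B * norm w \<le> ?B * (norm R * 2)" using B by (intro mult_left_mono) auto
    then have "2 * (?B * norm w) < 1" using R8 by linarith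
    then have nw: "2 * ?B * norm w < 1" by (simp only: mult.assoc)
    \<comment> \<open>\<open>R\<close> itself solves the fixed-point equation of the inverse
      function at \<open>w\<close>, because \<open>N\<close> cancels the bracket. By uniqueness the
      inverse series at \<open>w\<close> sums to \<open>R\<close>.\<close>
    have R: "R = w o\<^sub>L (blinfun_power w 0 + l *\<^sub>R R + e *\<^sub>R (R o\<^sub>L R))"
    proof -
      have "w o\<^sub>L (blinfun_power w 0 + l *\<^sub>R R + e *\<^sub>R (R o\<^sub>L R))
         = R o\<^sub>L (N + l *\<^sub>R (N o\<^sub>L R) + e *\<^sub>R (N o\<^sub>L R o\<^sub>L R))"
        by (simp add: w_def blinfun_compose_simps)
      also have "N o\<^sub>L R o\<^sub>L R = R o\<^sub>L R o\<^sub>L N"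
        by (metis comm blinfun_compose_simps(9))
      also have "R o\<^sub>L (N + l *\<^sub>R (N o\<^sub>L R) + e *\<^sub>R (R o\<^sub>L R o\<^sub>L N)) = R"
        unfolding comm[symmetric] rec by (simp add: blinfun_compose_simps)
      finally show ?thesis by simp
    qed
    have R1': "norm R \<le> 1" using R1 by linarith
    note inv = inv_series[OF bounded_bilinear_blinfun_compose norm_blinfun_compose _ _ norm_blinfun_power_le nw]
    have "summable (\<lambda>n. norm (inv_coeff l e n *\<^sub>R blinfun_power w n))"
      by (rule inv(1)) (simp_all add: blinfun_power_add)
    moreover have "(\<Sum>n. inv_coeff l e n *\<^sub>R blinfun_power w n) = R"
      by (rule inv(4)[OF _ _ R R1']) (simp_all add: blinfun_power_add)
    ultimately have "(\<lambda>n. inv_coeff l e n *\<^sub>R blinfun_power w n) sums R"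
      using summable_norm_cancel summable_sums by metis
    from sums_unique[OF op_series_shift[OF this]]
    have "op_fun (C_fun l e) w = w o\<^sub>L R"
      using op_fun_eq[OF power_series_C_fun, of l e w] by simp
    also have "\<dots> = R o\<^sub>L R o\<^sub>L N" unfolding w_def by (metis comm blinfun_compose_simps(9))
    finally show ?thesis unfolding w_def .
  qed
qed

text \<open>The case l = 1, e = 0 of the operator calculus; the number 16 is 8 times 1 + |l| +
  |e|.\<close>

lemma blinfun_Neumann:
  fixes R :: "'a::banach \<Rightarrow>\<^sub>L 'a"
  assumes "16 * norm R \<le> 1"
  obtains S where "(id_blinfun + R) o\<^sub>L S = id_blinfun" "S o\<^sub>L (id_blinfun + R) = id_blinfun"
proof -
  have "8 * (1 + \<bar>1\<bar> + \<bar>0\<bar>) * norm R \<le> 1" using assms by simp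
  then obtain N where "N + 1 *\<^sub>R (R o\<^sub>L N) + 0 *\<^sub>R (R o\<^sub>L R o\<^sub>L N) = id_blinfun" "R o\<^sub>L N = N o\<^sub>L R"
    by (rule op_calculus)
  then have "(id_blinfun + R) o\<^sub>L N = id_blinfun" "N o\<^sub>L (id_blinfun + R) = id_blinfun"
    by (simp_all add: blinfun_compose_simps)
  then show ?thesis by (rule that)
qed

section \<open>Tensor products of operators\<close>

text \<open>Gram-Schmidt without linear independence: a vector already in the span of
  \<open>B\<close> leaves \<open>B\<close> unchanged, any other contributes its normalized
  residual.\<close>

lemma orthonormal_spanning:
  fixes S :: "'a::real_inner set"
  assumes "finite S"
  shows "\<exists>B. finite B \<and> S \<subseteq> span B \<and> (\<forall>b\<in>B. \<forall>c\<in>B. b \<bullet> c = (if b = c then 1 else 0))"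
  using assms
proof (induction S)
  case empty
  then show ?case by (intro exI[of _ "{}"]) auto
next
  case (insert x S)
  then obtain B where B: "finite B" "S \<subseteq> span B" "\<And>b c. b \<in> B \<Longrightarrow> c \<in> B \<Longrightarrow> b \<bullet> c = (if b = c then 1 else 0)"
    by blast
  define s where "s = (\<Sum>b\<in>B. (x \<bullet> b) *\<^sub>R b)"
  define y where "y = x - s"
  have sB: "s \<in> span B" unfolding s_def by (intro span_sum span_scale span_base)
  have yb: "y \<bullet> b = 0" if "b \<in> B" for b
  proof -
    have "s \<bullet> b = (\<Sum>c\<in>B. if c = b then x \<bullet> b else 0)"
      unfolding s_def inner_sum_left using that by (intro sum.cong refl) (auto simp: B(3))
    then show ?thesis using that B(1) by (simp add: y_def inner_diff_left)
  qed
  show ?case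
  proof (cases "y = 0")
    case True
    then show ?thesis using B sB by (intro exI[of _ B]) (auto simp: y_def)
  next
    case False
    define e where "e = inverse (norm y) *\<^sub>R y"
    have ee: "e \<bullet> e = 1" using False by (simp add: e_def dot_square_norm power2_eq_square field_simps)
    have eb: "e \<bullet> b = 0" "b \<bullet> e = 0" if "b \<in> B" for b
      using yb[OF that] by (simp_all add: e_def inner_commute)
    have "norm y *\<^sub>R e \<in> span (insert e B)" by (intro span_scale span_base) simp
    then have "y \<in> span (insert e B)" using False by (simp add: e_def)
    moreover have "s \<in> span (insert e B)" "S \<subseteq> span (insert e B)"
      using sB B(2) span_mono[of B "insert e B"] by auto
    moreover have "x = s + y" by (simp add: y_def)
    ultimately have "insert x S \<subseteq> span (insert e B)" by (simp add: span_add)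
    moreover have "\<forall>b\<in>insert e B. \<forall>c\<in>insert e B. b \<bullet> c = (if b = c then 1 else 0)"
      using B(3) ee eb by (auto split: if_splits) (metis zero_neq_one)+
    ultimately show ?thesis using B(1) by (intro exI[of _ "insert e B"]) auto
  qed
qed

lemma orthonormal_expansion:
  fixes B :: "'a::real_inner set"
  assumes "finite B" "\<And>b c. b \<in> B \<Longrightarrow> c \<in> B \<Longrightarrow> b \<bullet> c = (if b = c then 1 else 0)" "v \<in> span B"
  shows "v = (\<Sum>b\<in>B. (v \<bullet> b) *\<^sub>R b)"
  using assms(3)
proof (induction rule: span_induct)
  case base
  show ?case
    by (auto intro!: subspaceI simp: inner_simps scaleR_add_left sum.distrib scaleR_sum_right[symmetric]
        simp flip: scaleR_scaleR)
next
  case (step x)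
  have "(\<Sum>b\<in>B. (x \<bullet> b) *\<^sub>R b) = (\<Sum>b\<in>B. if b = x then x else 0)"
    using step by (intro sum.cong refl) (auto simp: assms(2))
  then show ?case using step assms(1) by simp
qed

lemma hilbert_tensorD:
  assumes "hilbert_tensor ten"
  shows "bilinear ten" "ten a b \<bullet> ten c d = (a \<bullet> c) * (b \<bullet> d)" "closure (span {ten a b | a b. True}) = UNIV"
  using assms unfolding hilbert_tensor_def by auto

text \<open>Lets operators on the right factor inherit the estimate for operators on the left
  factor.\<close>

lemma hilbert_tensor_flip:
  assumes "hilbert_tensor ten"
  shows "hilbert_tensor (\<lambda>b a. ten a b)"
proof -
  have "{ten a b | b a. True} = {ten a b | a b. True}" by auto
  then show ?thesis using assms unfolding hilbert_tensor_def bilinear_def by (auto simp: mult.commute)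
qed

lemma norm_tensor_orthonormal:
  assumes ten: "hilbert_tensor ten" and B: "finite B" "\<And>b c. b \<in> B \<Longrightarrow> c \<in> B \<Longrightarrow> b \<bullet> c = (if b = c then 1 else 0)"
  shows "(norm (\<Sum>e\<in>B. ten (f e) e))\<^sup>2 = (\<Sum>e\<in>B. (norm (f e))\<^sup>2)"
proof -
  have "(norm (\<Sum>e\<in>B. ten (f e) e))\<^sup>2 = (\<Sum>e\<in>B. \<Sum>d\<in>B. (f e \<bullet> f d) * (e \<bullet> d))"
    by (simp add: power2_norm_eq_inner inner_sum_left inner_sum_right hilbert_tensorD(2)[OF ten])
       (subst sum.swap, simp add: inner_commute)
  also have "\<dots> = (\<Sum>e\<in>B. \<Sum>d\<in>B. if d = e then (norm (f e))\<^sup>2 else 0)"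
    using B(2) by (intro sum.cong refl) (auto simp: power2_norm_eq_inner)
  also have "\<dots> = (\<Sum>e\<in>B. (norm (f e))\<^sup>2)" using B(1) by simp
  finally show ?thesis .
qed

text \<open>Rewriting the right factors in an orthonormal basis makes the summands orthogonal, and
  then \<open>R\<close> can be estimated summand by summand.\<close>

lemma norm_tensor_left_le:
  fixes R :: "'g::{real_inner, banach} \<Rightarrow>\<^sub>L 'g"
  assumes ten: "hilbert_tensor ten" and K: "finite K"
  shows "norm (\<Sum>k\<in>K. ten (R (a k)) (b k)) \<le> norm R * norm (\<Sum>k\<in>K. ten (a k) (b k))"
proof -
  obtain B where B: "finite B" "b ` K \<subseteq> span B" "\<And>b c. b \<in> B \<Longrightarrow> c \<in> B \<Longrightarrow> b \<bullet> c = (if b = c then 1 else 0)"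
    using orthonormal_spanning[of "b ` K"] K by blast
  note bi = hilbert_tensorD(1)[OF ten]
  interpret l: linear "\<lambda>x. ten x y" for y using bi by (simp add: bilinear_def)
  interpret r: linear "ten x" for x using bi by (simp add: bilinear_def)
  define f where "f e = (\<Sum>k\<in>K. (b k \<bullet> e) *\<^sub>R a k)" for e
  have expand: "(\<Sum>k\<in>K. ten (T (a k)) (b k)) = (\<Sum>e\<in>B. ten (T (f e)) e)" if "linear T" for T
  proof -
    interpret T: linear T by fact
    have "(\<Sum>k\<in>K. ten (T (a k)) (b k)) = (\<Sum>k\<in>K. \<Sum>e\<in>B. (b k \<bullet> e) *\<^sub>R ten (T (a k)) e)"
    proof (intro sum.cong refl)
      fix k assume "k \<in> K"
      then have "b k = (\<Sum>e\<in>B. (b k \<bullet> e) *\<^sub>R e)"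
        using B by (intro orthonormal_expansion) auto
      then have "ten (T (a k)) (b k) = ten (T (a k)) (\<Sum>e\<in>B. (b k \<bullet> e) *\<^sub>R e)" by simp
      then show "ten (T (a k)) (b k) = (\<Sum>e\<in>B. (b k \<bullet> e) *\<^sub>R ten (T (a k)) e)"
        by (simp only: r.sum r.scale)
    qed
    also have "\<dots> = (\<Sum>e\<in>B. \<Sum>k\<in>K. (b k \<bullet> e) *\<^sub>R ten (T (a k)) e)" by (rule sum.swap)
    also have "\<dots> = (\<Sum>e\<in>B. ten (T (f e)) e)"
      by (simp add: f_def l.sum l.scale T.sum T.scale)
    finally show ?thesis .
  qed
  have "(norm (\<Sum>k\<in>K. ten (R (a k)) (b k)))\<^sup>2 = (\<Sum>e\<in>B. (norm (R (f e)))\<^sup>2)"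
    using expand[of R] norm_tensor_orthonormal[OF ten B(1,3), of "\<lambda>e. R (f e)"]
    by (simp add: bounded_linear.linear blinfun.bounded_linear_right)
  also have "\<dots> \<le> (\<Sum>e\<in>B. (norm R * norm (f e))\<^sup>2)"
    by (intro sum_mono power_mono norm_blinfun norm_ge_zero)
  also have "\<dots> = (norm R)\<^sup>2 * (\<Sum>e\<in>B. (norm (f e))\<^sup>2)" by (simp add: power_mult_distrib sum_distrib_left)
  also have "\<dots> = (norm R * norm (\<Sum>k\<in>K. ten (a k) (b k)))\<^sup>2"
    using expand[OF linear_id] norm_tensor_orthonormal[OF ten B(1,3), of f] by (simp add: power_mult_distrib)
  finally show ?thesis by (rule power2_le_imp_le) simp
qed

text \<open>The bound for arbitrary finite sums of pure tensors also contains the well-definedness: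
  a sum equal to 0 is mapped to 0. Scalars are absorbed into the left factors, so elements of the
  span have the form that \<open>norm_tensor_left_le\<close> treats.\<close>

lemma tensor_left_exists:
  fixes R :: "'g::{real_inner, banach} \<Rightarrow>\<^sub>L 'g" and ten :: "'g \<Rightarrow> 'f::{real_inner, banach} \<Rightarrow> 'h::{real_inner, banach}"
  assumes ten: "hilbert_tensor ten"
  obtains U :: "'h \<Rightarrow>\<^sub>L 'h" where "norm U \<le> norm R" "\<And>a b. U (ten a b) = ten (R a) b"
proof -
  define S where "S = {(ten a b, ten (R a) b) | a b. True}"
  have fS: "fst ` S = {ten a b | a b. True}" by (auto simp: S_def image_iff, blast+)
  note bi = hilbert_tensorD(1)[OF ten]
  interpret l: linear "\<lambda>x. ten x y" for y using bi by (simp add: bilinear_def)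
  obtain U :: "'h \<Rightarrow>\<^sub>L 'h" where "norm U \<le> norm R" "\<And>x y. (x, y) \<in> S \<Longrightarrow> U x = y"
  proof (rule blinfun_extension[of S "norm R"])
    show "closure (span (fst ` S)) = UNIV" unfolding fS by (rule hilbert_tensorD(3)[OF ten])
    fix p assume "p \<in> span S"
    then obtain t c where t: "finite t" "t \<subseteq> S" and p: "p = (\<Sum>q\<in>t. c q *\<^sub>R q)"
      unfolding span_explicit by blast
    have "\<forall>q\<in>t. \<exists>a b. q = (ten a b, ten (R a) b)" using t(2) by (auto simp: S_def)
    then obtain a b where ab: "\<And>q. q \<in> t \<Longrightarrow> q = (ten (a q) (b q), ten (R (a q)) (b q))" by metis
    have "fst p = (\<Sum>q\<in>t. ten (c q *\<^sub>R a q) (b q))"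
      unfolding p fst_sum fst_scaleR l.scale by (intro sum.cong refl) (simp add: ab[THEN arg_cong[where f=fst], simplified])
    moreover have "snd p = (\<Sum>q\<in>t. ten (R (c q *\<^sub>R a q)) (b q))"
      unfolding p snd_sum snd_scaleR l.scale blinfun.scaleR_right
      by (intro sum.cong refl) (simp add: ab[THEN arg_cong[where f=snd], simplified])
    ultimately show "norm (snd p) \<le> norm R * norm (fst p)"
      using norm_tensor_left_le[OF ten t(1), of R "\<lambda>q. c q *\<^sub>R a q" b] by simp
  qed (use that in auto)
  then show ?thesis using that[of U] by (auto simp: S_def)
qed

text \<open>Writing R \<otimes> S as the composition of R \<otimes> 1 and 1 \<otimes> S makes the
  one-sided estimate suffice, and the norms multiply.\<close>

lemma tensor_exists:
  fixes R :: "'g::{real_inner, banach} \<Rightarrow>\<^sub>L 'g" and ten :: "'g \<Rightarrow> 'f::{real_inner, banach} \<Rightarrow> 'h::{real_inner, banach}"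
    and S :: "'f \<Rightarrow>\<^sub>L 'f"
  assumes ten: "hilbert_tensor ten"
  obtains U :: "'h \<Rightarrow>\<^sub>L 'h" where "norm U \<le> norm R * norm S" "\<And>a b. U (ten a b) = ten (R a) (S b)"
proof -
  obtain U :: "'h \<Rightarrow>\<^sub>L 'h" where U: "norm U \<le> norm R" "\<And>a b. U (ten a b) = ten (R a) b"
    by (rule tensor_left_exists[OF ten, of R], rule that)
  obtain V :: "'h \<Rightarrow>\<^sub>L 'h" where V: "norm V \<le> norm S" "\<And>a b. V (ten a b) = ten a (S b)"
    by (rule tensor_left_exists[OF hilbert_tensor_flip[OF ten], of S], rule that)
  have "norm (U o\<^sub>L V) \<le> norm R * norm S"
    using order_trans[OF norm_blinfun_compose mult_mono[OF U(1) V(1)]] by simp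
  then show ?thesis by (rule that) (simp add: U V)
qed

locale tensor_space =
  fixes ten :: "'g::{real_inner, banach} \<Rightarrow> 'f::{real_inner, banach} \<Rightarrow> 'h::{real_inner, banach}"
  assumes ten: "hilbert_tensor ten"
begin

lemma op_eq_on_tensors:
  fixes U V :: "'h \<Rightarrow>\<^sub>L 'b::real_normed_vector"
  assumes "\<And>a b. U (ten a b) = V (ten a b)"
  shows "U = V"
  using assms by (intro blinfun_eq_on_dense[OF hilbert_tensorD(3)[OF ten]]) auto

sublocale l: linear "\<lambda>x. ten x y" for y using hilbert_tensorD(1)[OF ten] by (simp add: bilinear_def)
sublocale r: linear "ten x" for x using hilbert_tensorD(1)[OF ten] by (simp add: bilinear_def)

lemma op_tensor:
  shows op_tensor_apply: "op_tensor ten R S (ten a b) = ten (R a) (S b)"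
    and norm_op_tensor_le: "norm (op_tensor ten R S) \<le> norm R * norm S"
proof -
  obtain U :: "'h \<Rightarrow>\<^sub>L 'h" where U: "norm U \<le> norm R * norm S" "\<And>a b. U (ten a b) = ten (R a) (S b)"
    by (rule tensor_exists[OF ten, of R S], rule that)
  have "op_tensor ten R S = U"
    unfolding op_tensor_def using U(2) by (intro the_equality op_eq_on_tensors) auto
  with U show "op_tensor ten R S (ten a b) = ten (R a) (S b)" "norm (op_tensor ten R S) \<le> norm R * norm S"
    by auto
qed

lemma op_tensor_compose: "op_tensor ten (R o\<^sub>L R') (S o\<^sub>L S') = op_tensor ten R S o\<^sub>L op_tensor ten R' S'"
  by (rule op_eq_on_tensors) (simp add: op_tensor_apply)

lemma op_tensor_id: "op_tensor ten id_blinfun id_blinfun = id_blinfun"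
  by (rule op_eq_on_tensors) (simp add: op_tensor_apply)

lemma op_tensor_linear:
  "op_tensor ten (R + R') S = op_tensor ten R S + op_tensor ten R' S"
  "op_tensor ten R (S + S') = op_tensor ten R S + op_tensor ten R S'"
  "op_tensor ten (c *\<^sub>R R) S = c *\<^sub>R op_tensor ten R S"
  "op_tensor ten R (c *\<^sub>R S) = c *\<^sub>R op_tensor ten R S"
  by (rule op_eq_on_tensors; simp add: op_tensor_apply blinfun.bilinear_simps l.add r.add l.scale r.scale)+

lemma op_tensor_zero: "op_tensor ten 0 S = 0" "op_tensor ten R 0 = 0"
  by (rule op_eq_on_tensors; simp add: op_tensor_apply blinfun.bilinear_simps)+

lemma op_tensor_sum:
  "op_tensor ten (\<Sum>i\<in>I. f i) S = (\<Sum>i\<in>I. op_tensor ten (f i) S)"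
  "op_tensor ten R (\<Sum>i\<in>I. g i) = (\<Sum>i\<in>I. op_tensor ten R (g i))"
  by (induction I rule: infinite_finite_induct; simp add: op_tensor_zero op_tensor_linear)+

lemma norm_left_op_le: "norm (left_op ten R) \<le> norm R"
  using norm_op_tensor_le[of R id_blinfun]
    mult_left_le[OF norm_blinfun_id_le[where 'a='f] norm_ge_zero[of R]] by linarith

end

section \<open>Operators on the extended Fock space\<close>

text \<open>The recursion of the measures is stated for non-negative integrals, so membership in
  \<open>L2\<close> is checked in this form.\<close>

lemma L2_iff: "F \<in> L2 M \<longleftrightarrow> F \<in> borel_measurable M \<and> (\<integral>\<^sup>+x. ennreal ((F x)\<^sup>2) \<partial>M) < \<infinity>"
  unfolding L2_def by (auto simp: integrable_iff_bounded)

lemma L2_lincomb: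
  assumes F: "F \<in> L2 M" and G: "G \<in> L2 M"
  shows "(\<lambda>x. a * F x + b * G x) \<in> L2 M"
proof -
  have [measurable]: "F \<in> borel_measurable M" "G \<in> borel_measurable M"
    and i: "integrable M (\<lambda>x. (F x)\<^sup>2)" "integrable M (\<lambda>x. (G x)\<^sup>2)"
    using F G by (auto simp: L2_def)
  have "integrable M (\<lambda>x. 2 * a\<^sup>2 * (F x)\<^sup>2 + 2 * b\<^sup>2 * (G x)\<^sup>2)" using i by simp
  then have "integrable M (\<lambda>x. (a * F x + b * G x)\<^sup>2)"
  proof (rule Bochner_Integration.integrable_bound)
    show "AE x in M. norm ((a * F x + b * G x)\<^sup>2) \<le> norm (2 * a\<^sup>2 * (F x)\<^sup>2 + 2 * b\<^sup>2 * (G x)\<^sup>2)"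
    proof (rule AE_I2)
      fix x
      have "0 \<le> (a * F x - b * G x)\<^sup>2" by simp
      then have "(a * F x + b * G x)\<^sup>2 \<le> 2 * a\<^sup>2 * (F x)\<^sup>2 + 2 * b\<^sup>2 * (G x)\<^sup>2"
        by (simp add: power2_sum power2_diff power_mult_distrib)
      then show "norm ((a * F x + b * G x)\<^sup>2) \<le> norm (2 * a\<^sup>2 * (F x)\<^sup>2 + 2 * b\<^sup>2 * (G x)\<^sup>2)" by simp
    qed
  qed simp
  then show ?thesis by (simp add: L2_def)
qed

lemma L2_zero: "(\<lambda>x. 0) \<in> L2 M"
  by (simp add: L2_def)

lemma L2_sum:
  assumes "\<And>i. i \<in> I \<Longrightarrow> F i \<in> L2 M"
  shows "(\<lambda>x. \<Sum>i\<in>I. F i x) \<in> L2 M"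
  using assms
proof (induction I rule: infinite_finite_induct)
  case (insert i I)
  then show ?case using L2_lincomb[of "F i" M "\<lambda>x. \<Sum>i\<in>I. F i x" 1 1] by simp
qed (simp_all add: L2_zero)

lemma integrable_mult_L2:
  fixes f F :: "'a \<Rightarrow> real"
  assumes [measurable]: "f \<in> borel_measurable M" "F \<in> borel_measurable M"
    and sq: "integrable M (\<lambda>x. (f x)\<^sup>2)" "integrable M (\<lambda>x. (F x)\<^sup>2)"
  shows "integrable M (\<lambda>x. f x * F x)"
proof (rule Bochner_Integration.integrable_bound[OF Bochner_Integration.integrable_add[OF sq]])
  show "AE x in M. norm (f x * F x) \<le> norm ((f x)\<^sup>2 + (F x)\<^sup>2)"
  proof (rule AE_I2)
    fix x
    have "0 \<le> (\<bar>f x\<bar> - \<bar>F x\<bar>)\<^sup>2" by simp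
    then have "2 * (\<bar>f x\<bar> * \<bar>F x\<bar>) \<le> (f x)\<^sup>2 + (F x)\<^sup>2" by (simp add: power2_diff)
    moreover have "0 \<le> \<bar>f x\<bar> * \<bar>F x\<bar>" by simp
    ultimately have "\<bar>f x\<bar> * \<bar>F x\<bar> \<le> (f x)\<^sup>2 + (F x)\<^sup>2" by linarith
    then show "norm (f x * F x) \<le> norm ((f x)\<^sup>2 + (F x)\<^sup>2)" by (simp add: abs_mult)
  qed
qed simp

text \<open>Integrate \<open>(F - x f / s)\<^sup>2 \<ge> 0\<close>, where \<open>x\<close> is the integral of \<open>f F\<close>.\<close>

lemma integral_Cauchy_Schwarz:
  fixes f F :: "'a \<Rightarrow> real"
  assumes [measurable]: "f \<in> borel_measurable M" "F \<in> borel_measurable M"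
    and s: "0 < s" and f: "(\<integral>\<^sup>+x. ennreal ((f x)\<^sup>2) \<partial>M) \<le> ennreal s"
  shows "ennreal ((LINT x|M. f x * F x)\<^sup>2) \<le> ennreal s * (\<integral>\<^sup>+x. ennreal ((F x)\<^sup>2) \<partial>M)"
proof (cases "(\<integral>\<^sup>+x. ennreal ((F x)\<^sup>2) \<partial>M) = \<infinity>")
  case True
  then show ?thesis using s by (simp add: ennreal_mult_top)
next
  case False
  have iF: "integrable M (\<lambda>x. (F x)\<^sup>2)"
    using False by (intro integrableI_bounded) (auto simp: top.not_eq_extremum)
  have if2: "integrable M (\<lambda>x. (f x)\<^sup>2)"
    using f by (intro integrableI_bounded) (auto intro: le_less_trans)
  have ifF: "integrable M (\<lambda>x. f x * F x)" by (rule integrable_mult_L2[OF assms(1,2) if2 iF])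
  define X where "X = (LINT x|M. f x * F x)"
  define Y where "Y = (LINT x|M. (F x)\<^sup>2)"
  define c where "c = X / s"
  have ifs: "(LINT x|M. (f x)\<^sup>2) \<le> s"
    using f s nn_integral_eq_integral[OF if2] by simp
  have "0 \<le> (LINT x|M. (F x - c * f x)\<^sup>2)" by simp
  also have "\<dots> = (LINT x|M. (F x)\<^sup>2 - 2 * c * (f x * F x) + c\<^sup>2 * (f x)\<^sup>2)"
    by (intro Bochner_Integration.integral_cong refl) (simp add: power2_diff power_mult_distrib)
  also have "\<dots> = Y - 2 * c * X + c\<^sup>2 * (LINT x|M. (f x)\<^sup>2)"
    using iF if2 ifF by (simp add: Y_def X_def)
  also have "\<dots> \<le> Y - 2 * c * X + c\<^sup>2 * s" using ifs by (intro add_left_mono mult_left_mono) auto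
  also have "\<dots> = Y - X\<^sup>2 / s" using s by (simp add: c_def power2_eq_square field_simps)
  finally have "X\<^sup>2 \<le> s * Y" using s by (simp add: field_simps)
  then have "ennreal (X\<^sup>2) \<le> ennreal (s * Y)" by (rule ennreal_leI)
  then have "ennreal (X\<^sup>2) \<le> ennreal s * ennreal Y" using s by (simp add: ennreal_mult')
  then show ?thesis using nn_integral_eq_integral[OF iF] by (simp add: X_def Y_def)
qed

section \<open>Measurability of adding, dropping and repeating a first coordinate\<close>

lemma measurable_tail_tuples:
  "(\<lambda>\<omega> i. \<omega> (Suc i)) \<in> measurable (tuples (Suc n)) (tuples n :: (nat \<Rightarrow> 't::topological_space) measure)"
  unfolding tuples_def
proof (rule measurable_PiM_single')
  fix i assume "i \<in> {..<n}"
  then show "(\<lambda>\<omega>. \<omega> (Suc i)) \<in> borel_measurable (PiM {..<Suc n} (\<lambda>_. borel :: 't measure))"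
    by (intro measurable_component_singleton) auto
next
  show "(\<lambda>\<omega> i. \<omega> (Suc i)) \<in> space (PiM {..<Suc n} (\<lambda>_. borel :: 't measure)) \<rightarrow> ({..<n} \<rightarrow>\<^sub>E space borel)"
    by (auto simp: space_PiM PiE_iff extensional_def)
qed

lemma measurable_head_tuples: "(\<lambda>\<omega>. \<omega> 0) \<in> measurable (tuples (Suc n)) (borel :: 't::topological_space measure)"
  unfolding tuples_def by (rule measurable_component_singleton) simp

locale fock_space =
  fixes \<sigma> :: "'t::second_countable_topology measure" and lam \<eta> :: "'t \<Rightarrow> real"
    and J :: "nat \<Rightarrow> ((nat \<Rightarrow> 't) \<Rightarrow> real) \<Rightarrow> 'f::{real_inner, banach}"
  assumes sigma_finite: "sigma_finite_measure \<sigma>" and sets_\<sigma>: "sets \<sigma> = sets borel"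
    and lam: "lam \<in> borel_measurable borel"
    and eta: "\<eta> \<in> borel_measurable borel" and eta_nonneg: "\<And>t. 0 \<le> \<eta> t"
    and fock: "extended_fock_space \<sigma> \<eta> J"
begin

abbreviation M :: "nat \<Rightarrow> (nat \<Rightarrow> 't) measure" where "M \<equiv> fock_measure \<sigma> \<eta>"

text \<open>Setting the weight to 0 for \<open>n = 0\<close> lets one formula cover all cases of the recursion of the
  measures \<open>\<gamma>\<^sub>n\<close> and of \<open>X\<^sup>-\<close>.\<close>

definition diag_weight :: "nat \<Rightarrow> 't \<Rightarrow> real" where
  "diag_weight n t = (if n = 0 then 0 else \<eta> t)"

lemma measurable_M: "measurable (M n) N = measurable (tuples n) N"
  by (rule measurable_cong_sets[OF sets_fock_measure refl])

lemma measurable_\<sigma>: "measurable \<sigma> N = measurable borel N"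
  by (rule measurable_cong_sets[OF sets_\<sigma> refl])

lemma measurable_head: "(\<lambda>\<omega>. \<omega> 0) \<in> measurable (M (Suc n)) (borel :: 't measure)"
  unfolding measurable_M by (rule measurable_head_tuples)

lemma measurable_tail: "F \<in> measurable (M n) N \<Longrightarrow> (\<lambda>\<omega>. F (\<lambda>i. \<omega> (Suc i))) \<in> measurable (M (Suc n)) N"
  unfolding measurable_M by (rule measurable_compose[OF measurable_tail_tuples])

lemma measurable_cons_pair:
  assumes "F \<in> measurable (tuples (Suc n)) N"
  shows "(\<lambda>(\<omega>, s). F (case_nat s \<omega>)) \<in> measurable (M n \<Otimes>\<^sub>M \<sigma>) N"
proof -
  have "(\<lambda>p. case_nat (snd p) (fst p)) \<in> measurable (M n \<Otimes>\<^sub>M \<sigma>) (tuples (Suc n))"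
    by (intro measurable_cons_tuples)
       (auto simp: measurable_cong_sets[OF refl sets_\<sigma>[symmetric]] measurable_cong_sets[OF refl sets_fock_measure[symmetric, of _ \<sigma> \<eta>]])
  from measurable_compose[OF this assms] show ?thesis by (simp add: case_prod_beta')
qed

lemma measurable_cons:
  assumes "F \<in> measurable (tuples (Suc n)) N" "\<omega> \<in> space (M n)"
  shows "(\<lambda>s. F (case_nat s \<omega>)) \<in> measurable \<sigma> N"
  using measurable_compose[OF measurable_Pair1'[OF assms(2)] measurable_cons_pair[OF assms(1)]] by simp

lemma measurable_diag:
  assumes "F \<in> measurable (tuples (Suc (Suc n))) N"
  shows "(\<lambda>\<omega>. F (case_nat (\<omega> 0) \<omega>)) \<in> measurable (M (Suc n)) N"
  unfolding measurable_M
  by (rule measurable_compose[OF measurable_cons_tuples[OF measurable_head_tuples] assms]) simp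

lemma measurable_diag_weight:
  assumes "F \<in> borel_measurable (tuples (Suc n))" "f \<in> borel_measurable borel"
  shows "(\<lambda>\<omega>. diag_weight n (\<omega> 0) * f (\<omega> 0) * F (case_nat (\<omega> 0) \<omega>)) \<in> borel_measurable (M n)"
proof (cases n)
  case (Suc m)
  show ?thesis using measurable_diag[of F m] assms measurable_compose[OF measurable_head[of m] eta]
      measurable_compose[OF measurable_head[of m] assms(2)]
    unfolding Suc diag_weight_def by simp
qed (simp add: diag_weight_def)

lemma nn_integral_M_Suc:
  assumes h: "h \<in> borel_measurable (tuples (Suc n))"
  shows "(\<integral>\<^sup>+\<omega>. h \<omega> \<partial>M (Suc n)) =
    (\<integral>\<^sup>+\<omega>. ((\<integral>\<^sup>+s. h (case_nat s \<omega>) \<partial>\<sigma>) + ennreal (diag_weight n (\<omega> 0)) * h (case_nat (\<omega> 0) \<omega>)) \<partial>M n)"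
proof (cases n)
  case (Suc m)
  then show ?thesis
    using nn_integral_fock_measure[OF sigma_finite sets_\<sigma> eta] h by (simp add: diag_weight_def)
next
  case 0
  have "(\<lambda>t. case_nat t (\<lambda>_. undefined)) \<in> measurable \<sigma> (tuples 1)"
    using measurable_cons[of "\<lambda>x. x" 0 "tuples 1" "\<lambda>_. undefined"] by (simp add: fock_measure.simps)
  then have "(\<integral>\<^sup>+\<omega>. h \<omega> \<partial>M (Suc 0)) = (\<integral>\<^sup>+s. h (case_nat s (\<lambda>_. undefined)) \<partial>\<sigma>)"
    unfolding fock_measure.simps using h 0 by (intro nn_integral_distr) auto
  then show ?thesis
    unfolding 0 fock_measure.simps(1) by (simp add: nn_integral_count_space_finite diag_weight_def)
qed

lemma J_lincomb:
  assumes "F \<in> L2 (M n)" "G \<in> L2 (M n)"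
  shows "J n (\<lambda>\<omega>. a * F \<omega> + b * G \<omega>) = a *\<^sub>R J n F + b *\<^sub>R J n G"
  using fock assms unfolding extended_fock_space_def by blast

lemma J_inner: "F \<in> L2 (M n) \<Longrightarrow> G \<in> L2 (M n) \<Longrightarrow> J n F \<bullet> J n G = (LINT \<omega>|M n. F \<omega> * G \<omega>)"
  using fock unfolding extended_fock_space_def by blast

lemma J_orth: "F \<in> L2 (M m) \<Longrightarrow> G \<in> L2 (M n) \<Longrightarrow> m \<noteq> n \<Longrightarrow> J m F \<bullet> J n G = 0"
  using fock unfolding extended_fock_space_def by blast

lemma J_dense: "closure (span (\<Union>n. J n ` L2 (M n))) = UNIV"
  using fock unfolding extended_fock_space_def by blast

lemma J_zero: "J n (\<lambda>_. 0) = 0"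
  using J_lincomb[OF L2_zero L2_zero, of n 0 0] by simp

lemma J_sum:
  assumes "\<And>i. i \<in> I \<Longrightarrow> F i \<in> L2 (M n)"
  shows "J n (\<lambda>\<omega>. \<Sum>i\<in>I. F i \<omega>) = (\<Sum>i\<in>I. J n (F i))"
  using assms
proof (induction I rule: infinite_finite_induct)
  case (insert i I)
  then show ?case using J_lincomb[of "F i" n "\<lambda>x. \<Sum>i\<in>I. F i x" 1 1] L2_sum[of I F "M n"] by simp
qed (simp_all add: J_zero)

lemma norm_J:
  assumes "F \<in> L2 (M n)"
  shows "ennreal ((norm (J n F))\<^sup>2) = (\<integral>\<^sup>+\<omega>. ennreal ((F \<omega>)\<^sup>2) \<partial>M n)"
proof -
  have "(norm (J n F))\<^sup>2 = (LINT \<omega>|M n. (F \<omega>)\<^sup>2)"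
    using J_inner[OF assms assms] by (simp add: dot_square_norm power2_eq_square)
  then show ?thesis using assms by (subst nn_integral_eq_integral) (auto simp: L2_def)
qed

text \<open>\<open>J\<close> acts on functions, not on classes. Linearity of X^- in its argument
  holds only where the integrals over the first coordinate converge, that is almost everywhere, so
  this passage to classes is needed there.\<close>

lemma J_cong_AE:
  assumes "F \<in> L2 (M n)" "G \<in> L2 (M n)" "AE \<omega> in M n. F \<omega> = G \<omega>"
  shows "J n F = J n G"
proof -
  have "ennreal ((norm (J n (\<lambda>\<omega>. 1 * F \<omega> + (-1) * G \<omega>)))\<^sup>2)
      = (\<integral>\<^sup>+\<omega>. ennreal ((1 * F \<omega> + (-1) * G \<omega>)\<^sup>2) \<partial>M n)"
    by (intro norm_J L2_lincomb assms)
  also have "\<dots> = (\<integral>\<^sup>+\<omega>. 0 \<partial>M n)"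
    using assms(3) by (intro nn_integral_cong_AE) (auto elim!: eventually_mono)
  finally have "J n (\<lambda>\<omega>. 1 * F \<omega> + (-1) * G \<omega>) = 0" by simp
  then show ?thesis using J_lincomb[OF assms(1,2), of 1 "-1"] by simp
qed

text \<open>One inequality between non-negative integrals serves twice: finiteness puts
  \<open>G\<close> into \<open>L2\<close>, and its square root is the norm estimate.\<close>

lemma L2_J_bound:
  assumes F: "F \<in> L2 (M n)" and G: "G \<in> borel_measurable (M m)"
    and K: "0 \<le> K" and le: "(\<integral>\<^sup>+\<omega>. ennreal ((G \<omega>)\<^sup>2) \<partial>M m) \<le> ennreal K * (\<integral>\<^sup>+\<omega>. ennreal ((F \<omega>)\<^sup>2) \<partial>M n)"
  shows "G \<in> L2 (M m)" "norm (J m G) \<le> sqrt K * norm (J n F)"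
proof -
  have "ennreal K * (\<integral>\<^sup>+\<omega>. ennreal ((F \<omega>)\<^sup>2) \<partial>M n) < \<infinity>"
    using F by (simp add: L2_iff ennreal_mult_less_top)
  then show G2: "G \<in> L2 (M m)" using le G by (simp add: L2_iff)
  have "ennreal ((norm (J m G))\<^sup>2) \<le> ennreal (K * (norm (J n F))\<^sup>2)"
    unfolding norm_J[OF G2] ennreal_mult'[OF K] norm_J[OF F] by (rule le)
  then have "(norm (J m G))\<^sup>2 \<le> K * (norm (J n F))\<^sup>2" using K by simp
  also have "\<dots> = (sqrt K * norm (J n F))\<^sup>2" using K by (simp add: power_mult_distrib)
  finally show "norm (J m G) \<le> sqrt K * norm (J n F)" by (rule power2_le_imp_le) (use K in auto)
qed

lemma fock_op_eqI:
  fixes U V :: "'f \<Rightarrow>\<^sub>L 'b::real_normed_vector"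
  assumes "\<And>n F. F \<in> L2 (M n) \<Longrightarrow> U (J n F) = V (J n F)"
  shows "U = V"
  using assms by (intro blinfun_eq_on_dense[OF J_dense]) auto

text \<open>If different degrees are mapped to orthogonal vectors, Pythagoras on both sides turns a
  bound on each degree into the same bound on finite sums. The constant \<open>K\<close> must
  therefore not depend on the degree.\<close>

lemma fock_op_exists:
  assumes lin: "\<And>n F G a b. F \<in> L2 (M n) \<Longrightarrow> G \<in> L2 (M n) \<Longrightarrow>
      \<Phi> n (\<lambda>\<omega>. a * F \<omega> + b * G \<omega>) = a *\<^sub>R \<Phi> n F + b *\<^sub>R (\<Phi> n G :: 'f)"
    and orth: "\<And>m n F G. F \<in> L2 (M m) \<Longrightarrow> G \<in> L2 (M n) \<Longrightarrow> m \<noteq> n \<Longrightarrow> \<Phi> m F \<bullet> \<Phi> n G = 0"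
    and bd: "\<And>n F. F \<in> L2 (M n) \<Longrightarrow> norm (\<Phi> n F) \<le> K * norm (J n F)" and K: "0 \<le> K"
  obtains U :: "'f \<Rightarrow>\<^sub>L 'f" where "norm U \<le> K" "\<And>n F. F \<in> L2 (M n) \<Longrightarrow> U (J n F) = \<Phi> n F"
proof -
  define S where "S = {(J n F, \<Phi> n F) | n F. F \<in> L2 (M n)}"
  define Q where "Q N F = ((\<Sum>n<N. J n (F n)), (\<Sum>n<N. \<Phi> n (F n)))" for N :: nat and F
  have \<Phi>0: "\<Phi> n (\<lambda>_. 0) = 0" for n using lin[OF L2_zero L2_zero, of n 0 0] by simp
  \<comment> \<open>Padding with zero functions gives two finite sums a common length, so that they
    can be added degree by degree.\<close>
  have pad: "\<exists>F'. (\<forall>n. F' n \<in> L2 (M n)) \<and> Q N F = Q N' F'" if "N \<le> N'" "\<forall>n. F n \<in> L2 (M n)" for N N' F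
  proof (intro exI conjI allI)
    let ?F = "\<lambda>n. if n < N then F n else (\<lambda>_. 0)"
    show "?F n \<in> L2 (M n)" for n using that by (simp add: L2_zero)
    show "Q N F = Q N' ?F"
    proof -
      have "J n (?F n) = (if n < N then J n (F n) else 0)" "\<Phi> n (?F n) = (if n < N then \<Phi> n (F n) else 0)" for n
        by (simp_all add: J_zero \<Phi>0)
      then show ?thesis
        unfolding Q_def using that(1) by (auto intro!: sum.mono_neutral_cong_left split: if_splits)
    qed
  qed
  define T where "T = {Q N F | N F. \<forall>n. F n \<in> L2 (M n)}"
  have subT: "subspace T"
  proof (rule subspaceI)
    show "0 \<in> T" unfolding T_def
      by (auto simp: Q_def zero_prod_def intro!: exI[of _ 0] exI[of _ "\<lambda>_ _. 0"] L2_zero)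
    fix x y assume "x \<in> T" "y \<in> T"
    then obtain N1 F1 N2 F2 where 1: "\<forall>n. F1 n \<in> L2 (M n)" "x = Q N1 F1" "\<forall>n. F2 n \<in> L2 (M n)" "y = Q N2 F2"
      unfolding T_def by blast
    let ?N = "max N1 N2"
    obtain G1 G2 where G: "\<forall>n. G1 n \<in> L2 (M n)" "x = Q ?N G1" "\<forall>n. G2 n \<in> L2 (M n)" "y = Q ?N G2"
      using pad[of N1 ?N F1] pad[of N2 ?N F2] 1 by auto
    have "x + y = Q ?N (\<lambda>n \<omega>. 1 * G1 n \<omega> + 1 * G2 n \<omega>)"
      using G(1,3) unfolding G(2,4) Q_def
      by (simp add: lin[where a=1 and b=1, simplified] J_lincomb[where a=1 and b=1, simplified] sum.distrib)
    moreover have "\<forall>n. (\<lambda>\<omega>. 1 * G1 n \<omega> + 1 * G2 n \<omega>) \<in> L2 (M n)" using G by (blast intro: L2_lincomb)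
    ultimately show "x + y \<in> T" unfolding T_def by blast
  next
    fix c x assume "x \<in> T"
    then obtain N F where 1: "\<forall>n. F n \<in> L2 (M n)" "x = Q N F" unfolding T_def by blast
    have "c *\<^sub>R x = Q N (\<lambda>n \<omega>. c * F n \<omega> + 0 * F n \<omega>)"
    proof -
      have "J n (\<lambda>\<omega>. c * F n \<omega> + 0 * F n \<omega>) = c *\<^sub>R J n (F n)"
        "\<Phi> n (\<lambda>\<omega>. c * F n \<omega> + 0 * F n \<omega>) = c *\<^sub>R \<Phi> n (F n)" for n
        using 1(1) lin[of "F n" n "F n" c 0] J_lincomb[of "F n" n "F n" c 0] by auto
      then show ?thesis unfolding 1(2) Q_def by (simp only: scaleR_Pair scaleR_sum_right)
    qed
    moreover have "\<forall>n. (\<lambda>\<omega>. c * F n \<omega> + 0 * F n \<omega>) \<in> L2 (M n)" using 1 by (blast intro: L2_lincomb)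
    ultimately show "c *\<^sub>R x \<in> T" unfolding T_def by blast
  qed
  have "S \<subseteq> T"
  proof
    fix p assume "p \<in> S"
    then obtain n F where F: "F \<in> L2 (M n)" "p = (J n F, \<Phi> n F)" unfolding S_def by blast
    let ?F = "\<lambda>k. if k = n then F else (\<lambda>_. 0)"
    have "J k (?F k) = (if k = n then J n F else 0)" "\<Phi> k (?F k) = (if k = n then \<Phi> n F else 0)" for k
      by (auto simp: J_zero \<Phi>0)
    then have "p = Q (Suc n) ?F" unfolding Q_def F(2) by simp
    moreover have "\<forall>k. ?F k \<in> L2 (M k)" using F(1) by (simp add: L2_zero)
    ultimately show "p \<in> T" unfolding T_def by blast
  qed
  then have ST: "span S \<subseteq> T" using subT by (rule span_minimal)
  have bT: "norm (snd p) \<le> K * norm (fst p)" if pT: "p \<in> T" for p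
  proof -
    obtain N F where F: "\<And>n. F n \<in> L2 (M n)" and p: "p = Q N F" using pT unfolding T_def by blast
    have "(norm (snd p))\<^sup>2 = (\<Sum>n<N. (norm (\<Phi> n (F n)))\<^sup>2)"
      unfolding p Q_def snd_conv
      by (intro norm_sum_Pythagorean) (auto simp: pairwise_def orthogonal_def intro!: orth F)
    also have "\<dots> \<le> (\<Sum>n<N. (K * norm (J n (F n)))\<^sup>2)" by (intro sum_mono power_mono bd F) auto
    also have "\<dots> = K\<^sup>2 * (\<Sum>n<N. (norm (J n (F n)))\<^sup>2)" by (simp add: power_mult_distrib sum_distrib_left)
    also have "(\<Sum>n<N. (norm (J n (F n)))\<^sup>2) = (norm (fst p))\<^sup>2"
      unfolding p Q_def fst_conv
      by (intro norm_sum_Pythagorean[symmetric]) (auto simp: pairwise_def orthogonal_def intro!: J_orth F)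
    finally have "(norm (snd p))\<^sup>2 \<le> (K * norm (fst p))\<^sup>2" by (simp add: power_mult_distrib)
    then show ?thesis by (rule power2_le_imp_le) (use K in auto)
  qed
  have "fst ` S = (\<Union>n. J n ` L2 (M n))" by (force simp: S_def)
  with J_dense have "closure (span (fst ` S)) = UNIV" by simp
  from blinfun_extension[OF this K] bT ST obtain U :: "'f \<Rightarrow>\<^sub>L 'f"
    where "norm U \<le> K" "\<And>x y. (x, y) \<in> S \<Longrightarrow> U x = y" by blast
  then show ?thesis using that[of U] unfolding S_def by blast
qed

text \<open>The measure on n + 1 coordinates has an integral part and a diagonal part weighted by
  \<eta>. One number \<open>s\<close> controls f against both: its square integral and the supremum
  of \<eta> f^2. Strict positivity allows division by \<open>s\<close> in Cauchy-Schwarz.\<close>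

definition weight :: "real \<Rightarrow> ('t \<Rightarrow> real) \<Rightarrow> bool" where
  "weight s f \<longleftrightarrow> 0 < s \<and> f \<in> borel_measurable borel \<and> (\<integral>\<^sup>+t. ennreal ((f t)\<^sup>2) \<partial>\<sigma>) \<le> ennreal s \<and>
     (\<forall>t. \<eta> t * (f t)\<^sup>2 \<le> s)"

text \<open>The integral part and the diagonal part of the larger measure each contribute at most
  \<open>s\<close> times the norm square of \<open>F\<close>, which explains \<open>2 * s\<close>.
  The bound does not depend on the degree.\<close>

lemma creation_bound:
  assumes w: "weight s f" and F: "F \<in> L2 (M n)"
  shows "(\<lambda>\<omega>. f (\<omega> 0) * F (\<lambda>i. \<omega> (Suc i))) \<in> L2 (M (Suc n))"
    "norm (J (Suc n) (\<lambda>\<omega>. f (\<omega> 0) * F (\<lambda>i. \<omega> (Suc i)))) \<le> sqrt (2 * s) * norm (J n F)"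
proof -
  let ?G = "\<lambda>\<omega>. f (\<omega> 0) * F (\<lambda>i. \<omega> (Suc i))"
  have s: "0 < s" and f: "f \<in> borel_measurable borel" and fs: "(\<integral>\<^sup>+t. ennreal ((f t)\<^sup>2) \<partial>\<sigma>) \<le> ennreal s"
    and es: "\<eta> t * (f t)\<^sup>2 \<le> s" for t using w unfolding weight_def by auto
  have f\<sigma>: "f \<in> borel_measurable \<sigma>" using f by (simp add: measurable_\<sigma>)
  have Fm: "F \<in> borel_measurable (M n)" using F by (simp add: L2_iff)
  have G: "?G \<in> borel_measurable (M (Suc n))"
    using measurable_compose[OF measurable_head f] measurable_tail[OF Fm] by (rule borel_measurable_times)
  have "(\<lambda>\<omega>. ennreal ((?G \<omega>)\<^sup>2)) \<in> borel_measurable (M (Suc n))" using G by measurable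
  then have Gt: "(\<lambda>\<omega>. ennreal ((?G \<omega>)\<^sup>2)) \<in> borel_measurable (tuples (Suc n))" unfolding measurable_M .
  have "(\<integral>\<^sup>+\<omega>. ennreal ((?G \<omega>)\<^sup>2) \<partial>M (Suc n)) = (\<integral>\<^sup>+\<omega>. ((\<integral>\<^sup>+t. ennreal ((f t * F \<omega>)\<^sup>2) \<partial>\<sigma>)
      + ennreal (diag_weight n (\<omega> 0)) * ennreal ((f (\<omega> 0) * F \<omega>)\<^sup>2)) \<partial>M n)"
    by (subst nn_integral_M_Suc[OF Gt]) simp
  also have "\<dots> \<le> (\<integral>\<^sup>+\<omega>. ennreal (2 * s) * ennreal ((F \<omega>)\<^sup>2) \<partial>M n)"
  proof (rule nn_integral_mono)
    fix \<omega> :: "nat \<Rightarrow> 't"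
    have "(\<integral>\<^sup>+t. ennreal ((f t * F \<omega>)\<^sup>2) \<partial>\<sigma>) = (\<integral>\<^sup>+t. ennreal ((f t)\<^sup>2) \<partial>\<sigma>) * ennreal ((F \<omega>)\<^sup>2)"
      using f\<sigma> by (subst nn_integral_multc[symmetric]) (auto simp: power_mult_distrib ennreal_mult)
    also have "\<dots> \<le> ennreal s * ennreal ((F \<omega>)\<^sup>2)" by (intro mult_right_mono fs) simp
    finally have 1: "(\<integral>\<^sup>+t. ennreal ((f t * F \<omega>)\<^sup>2) \<partial>\<sigma>) \<le> ennreal s * ennreal ((F \<omega>)\<^sup>2)" .
    have "diag_weight n (\<omega> 0) * (f (\<omega> 0))\<^sup>2 * (F \<omega>)\<^sup>2 \<le> s * (F \<omega>)\<^sup>2"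
      using es s by (intro mult_right_mono) (auto simp: diag_weight_def)
    then have 2: "ennreal (diag_weight n (\<omega> 0)) * ennreal ((f (\<omega> 0) * F \<omega>)\<^sup>2) \<le> ennreal s * ennreal ((F \<omega>)\<^sup>2)"
      using s eta_nonneg by (simp add: ennreal_mult[symmetric] diag_weight_def power_mult_distrib mult.assoc)
    have "ennreal (2 * s) = ennreal s + ennreal s" using s by (simp flip: ennreal_plus)
    with add_mono[OF 1 2]
    show "(\<integral>\<^sup>+t. ennreal ((f t * F \<omega>)\<^sup>2) \<partial>\<sigma>) + ennreal (diag_weight n (\<omega> 0)) * ennreal ((f (\<omega> 0) * F \<omega>)\<^sup>2)
        \<le> ennreal (2 * s) * ennreal ((F \<omega>)\<^sup>2)" by (simp add: distrib_right)
  qed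
  also have "\<dots> = ennreal (2 * s) * (\<integral>\<^sup>+\<omega>. ennreal ((F \<omega>)\<^sup>2) \<partial>M n)"
    using Fm by (intro nn_integral_cmult) auto
  finally have le: "(\<integral>\<^sup>+\<omega>. ennreal ((?G \<omega>)\<^sup>2) \<partial>M (Suc n)) \<le> \<dots>" .
  show "?G \<in> L2 (M (Suc n))" "norm (J (Suc n) ?G) \<le> sqrt (2 * s) * norm (J n F)"
    using L2_J_bound[OF F G _ le] s by auto
qed

lemma creation_op_apply:
  assumes w: "weight s f" and F: "F \<in> L2 (M n)"
  shows "creation_op \<sigma> \<eta> J f (J n F) = J (Suc n) (\<lambda>\<omega>. f (\<omega> 0) * F (\<lambda>i. \<omega> (Suc i)))"
proof -
  let ?\<Phi> = "\<lambda>n F. J (Suc n) (\<lambda>\<omega>. f (\<omega> 0) * F (\<lambda>i. \<omega> (Suc i)))"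
  obtain U where U: "\<And>n F. F \<in> L2 (M n) \<Longrightarrow> blinfun_apply U (J n F) = ?\<Phi> n F"
  proof (rule fock_op_exists[of ?\<Phi> "sqrt (2 * s)"])
    fix n F G and a b :: real assume FG: "F \<in> L2 (M n)" "G \<in> L2 (M n)"
    show "?\<Phi> n (\<lambda>\<omega>. a * F \<omega> + b * G \<omega>) = a *\<^sub>R ?\<Phi> n F + b *\<^sub>R ?\<Phi> n G"
      using J_lincomb[OF creation_bound(1)[OF w FG(1)] creation_bound(1)[OF w FG(2)], of a b]
      by (simp add: algebra_simps)
  qed (use w in \<open>auto intro!: J_orth creation_bound[OF w] simp: weight_def\<close>)
  have "creation_op \<sigma> \<eta> J f = U"
    unfolding creation_op_def using U by (intro the_equality fock_op_eqI) auto
  then show ?thesis using U F by simp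
qed

lemma neutral_bound:
  assumes g: "g \<in> borel_measurable borel" "\<And>t. \<bar>g t\<bar> \<le> c" and F: "F \<in> L2 (M (Suc n))"
  shows "(\<lambda>\<omega>. g (\<omega> 0) * F \<omega>) \<in> L2 (M (Suc n))"
    "norm (J (Suc n) (\<lambda>\<omega>. g (\<omega> 0) * F \<omega>)) \<le> c * norm (J (Suc n) F)"
proof -
  let ?G = "\<lambda>\<omega>. g (\<omega> 0) * F \<omega>"
  have c: "0 \<le> c" using g(2)[of undefined] by linarith
  have Fm: "F \<in> borel_measurable (M (Suc n))" using F by (simp add: L2_iff)
  have G: "?G \<in> borel_measurable (M (Suc n))"
    using measurable_compose[OF measurable_head g(1)] Fm by (rule borel_measurable_times)
  have "(\<integral>\<^sup>+\<omega>. ennreal ((?G \<omega>)\<^sup>2) \<partial>M (Suc n)) \<le> (\<integral>\<^sup>+\<omega>. ennreal (c\<^sup>2) * ennreal ((F \<omega>)\<^sup>2) \<partial>M (Suc n))"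
  proof (rule nn_integral_mono)
    fix \<omega> :: "nat \<Rightarrow> 't"
    have "(g (\<omega> 0))\<^sup>2 \<le> c\<^sup>2" using g(2)[of "\<omega> 0"] by (simp add: abs_le_square_iff[symmetric] c)
    then have "(g (\<omega> 0))\<^sup>2 * (F \<omega>)\<^sup>2 \<le> c\<^sup>2 * (F \<omega>)\<^sup>2" by (rule mult_right_mono) simp
    then show "ennreal ((?G \<omega>)\<^sup>2) \<le> ennreal (c\<^sup>2) * ennreal ((F \<omega>)\<^sup>2)"
      by (simp add: ennreal_mult[symmetric] power_mult_distrib)
  qed
  also have "\<dots> = ennreal (c\<^sup>2) * (\<integral>\<^sup>+\<omega>. ennreal ((F \<omega>)\<^sup>2) \<partial>M (Suc n))"
    using Fm by (intro nn_integral_cmult) auto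
  finally have le: "(\<integral>\<^sup>+\<omega>. ennreal ((?G \<omega>)\<^sup>2) \<partial>M (Suc n)) \<le> \<dots>" .
  show "?G \<in> L2 (M (Suc n))" "norm (J (Suc n) ?G) \<le> c * norm (J (Suc n) F)"
    using L2_J_bound[OF F G _ le] c by auto
qed

text \<open>The coefficient \<open>l\<close> is kept free: \<open>lam\<close> gives X^0, and the
  constant 1 gives the projections by which simple functions act on the first coordinate.\<close>

lemma neutral_op:
  assumes l: "l \<in> borel_measurable borel" and f: "f \<in> borel_measurable borel" and c: "\<And>t. \<bar>l t * f t\<bar> \<le> c"
  shows neutral_op_apply: "F \<in> L2 (M n) \<Longrightarrow>
      neutral_op \<sigma> l \<eta> J f (J n F) = (if n = 0 then 0 else J n (\<lambda>\<omega>. l (\<omega> 0) * f (\<omega> 0) * F \<omega>))"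
    and norm_neutral_op_le: "norm (neutral_op \<sigma> l \<eta> J f) \<le> c"
proof -
  let ?\<Phi> = "\<lambda>n F. if n = 0 then 0 else J n (\<lambda>\<omega>. l (\<omega> 0) * f (\<omega> 0) * F \<omega>)"
  have c0: "0 \<le> c" using c[of undefined] by linarith
  have g: "(\<lambda>t. l t * f t) \<in> borel_measurable borel" using l f by measurable
  note nb = neutral_bound[OF g c]
  obtain U where U: "norm U \<le> c" "\<And>n F. F \<in> L2 (M n) \<Longrightarrow> blinfun_apply U (J n F) = ?\<Phi> n F"
  proof (rule fock_op_exists[of ?\<Phi> c])
    fix n F G and a b :: real assume FG: "F \<in> L2 (M n)" "G \<in> L2 (M n)"
    show "?\<Phi> n (\<lambda>\<omega>. a * F \<omega> + b * G \<omega>) = a *\<^sub>R ?\<Phi> n F + b *\<^sub>R ?\<Phi> n G"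
    proof (cases n)
      case (Suc m)
      then show ?thesis using J_lincomb[OF nb(1) nb(1), of F m G a b] FG by (simp add: algebra_simps)
    qed simp
  next
    fix m n F G assume "F \<in> L2 (M m)" "G \<in> L2 (M n)" "m \<noteq> n"
    then show "?\<Phi> m F \<bullet> ?\<Phi> n G = 0"
      using nb(1)[of F "m - 1"] nb(1)[of G "n - 1"] by (auto intro!: J_orth)
  next
    fix n F assume "F \<in> L2 (M n)"
    then show "norm (?\<Phi> n F) \<le> c * norm (J n F)" using nb(2)[of F "n - 1"] c0 by (cases n) auto
  qed (use c0 in auto)
  have "neutral_op \<sigma> l \<eta> J f = U"
    unfolding neutral_op_def using U(2) by (intro the_equality fock_op_eqI) auto
  then show "F \<in> L2 (M n) \<Longrightarrow> neutral_op \<sigma> l \<eta> J f (J n F) = ?\<Phi> n F" "norm (neutral_op \<sigma> l \<eta> J f) \<le> c"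
    using U by auto
qed

text \<open>The index \<open>n\<close> is the degree of the result, so \<open>F\<close> has degree n
  + 1. For n = 0 the weight vanishes and only the integral is left, as for X^- on the first
  summand.\<close>

abbreviation annihilate :: "('t \<Rightarrow> real) \<Rightarrow> nat \<Rightarrow> ((nat \<Rightarrow> 't) \<Rightarrow> real) \<Rightarrow> (nat \<Rightarrow> 't) \<Rightarrow> real" where
  "annihilate f n F \<equiv> (\<lambda>\<omega>. (LINT t|\<sigma>. f t * F (case_nat t \<omega>)) + diag_weight n (\<omega> 0) * f (\<omega> 0) * F (case_nat (\<omega> 0) \<omega>))"

text \<open>\<open>A\<close> and \<open>B\<close> are the integral and the diagonal part of the norm
  square of \<open>F\<close>. Pointwise, Cauchy-Schwarz bounds the square of the integral by
  \<open>s\<close> times \<open>A\<close>, and the square of the diagonal term is at most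
  \<open>s\<close> times \<open>B\<close>; joining the two costs the factor 2.\<close>

lemma annihilation_bound:
  assumes w: "weight s f" and F: "F \<in> L2 (M (Suc n))"
  shows "annihilate f n F \<in> L2 (M n)" "norm (J n (annihilate f n F)) \<le> sqrt (2 * s) * norm (J (Suc n) F)"
    "AE \<omega> in M n. integrable \<sigma> (\<lambda>t. f t * F (case_nat t \<omega>))"
proof -
  interpret sigma_finite_measure \<sigma> by (rule sigma_finite)
  have s: "0 < s" and f: "f \<in> borel_measurable borel" and fs: "(\<integral>\<^sup>+t. ennreal ((f t)\<^sup>2) \<partial>\<sigma>) \<le> ennreal s"
    and es: "\<eta> t * (f t)\<^sup>2 \<le> s" for t using w unfolding weight_def by auto
  have f\<sigma>: "f \<in> borel_measurable \<sigma>" using f by (simp add: measurable_\<sigma>)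
  have Fm: "F \<in> borel_measurable (tuples (Suc n))" using F by (simp add: L2_iff measurable_M)
  have "(\<lambda>(\<omega>::nat \<Rightarrow> 't, t). f t * F (case_nat t \<omega>)) \<in> borel_measurable (M n \<Otimes>\<^sub>M \<sigma>)"
    using measurable_cons_pair[OF Fm] f\<sigma> by (simp add: case_prod_beta')
  then have G: "annihilate f n F \<in> borel_measurable (M n)"
    using measurable_diag_weight[OF Fm f]
    by (intro borel_measurable_add borel_measurable_lebesgue_integral) auto
  define A where "A \<omega> = (\<integral>\<^sup>+t. ennreal ((F (case_nat t \<omega>))\<^sup>2) \<partial>\<sigma>)" for \<omega> :: "nat \<Rightarrow> 't"
  define B where "B \<omega> = ennreal (diag_weight n (\<omega> 0)) * ennreal ((F (case_nat (\<omega> 0) \<omega>))\<^sup>2)" for \<omega> :: "nat \<Rightarrow> 't"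
  have F2t: "(\<lambda>\<omega>. ennreal ((F \<omega>)\<^sup>2)) \<in> borel_measurable (tuples (Suc n))" using Fm by measurable
  have AB: "(\<integral>\<^sup>+\<omega>. ennreal ((F \<omega>)\<^sup>2) \<partial>M (Suc n)) = (\<integral>\<^sup>+\<omega>. A \<omega> + B \<omega> \<partial>M n)"
    unfolding A_def B_def by (rule nn_integral_M_Suc[OF F2t])
  have Am: "A \<in> borel_measurable (M n)"
    using measurable_cons_pair[OF F2t] unfolding A_def by (intro borel_measurable_nn_integral) auto
  have Bm: "B \<in> borel_measurable (M n)"
    using measurable_compose[OF measurable_diag_weight[OF measurable_compose[OF Fm borel_measurable_power[OF measurable_id, of 2]], of "\<lambda>_. 1"] measurable_ennreal]
    unfolding B_def by (simp add: ennreal_mult'' )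
  have Fc: "(\<lambda>t. F (case_nat t \<omega>)) \<in> borel_measurable \<sigma>" if "\<omega> \<in> space (M n)" for \<omega> :: "nat \<Rightarrow> 't"
    by (rule measurable_cons[OF Fm that])
  have "(\<integral>\<^sup>+\<omega>. ennreal ((annihilate f n F \<omega>)\<^sup>2) \<partial>M n) \<le> (\<integral>\<^sup>+\<omega>. ennreal (2 * s) * (A \<omega> + B \<omega>) \<partial>M n)"
  proof (rule nn_integral_mono)
    fix \<omega> :: "nat \<Rightarrow> 't" assume \<omega>: "\<omega> \<in> space (M n)"
    define x where "x = (LINT t|\<sigma>. f t * F (case_nat t \<omega>))"
    define y where "y = diag_weight n (\<omega> 0) * f (\<omega> 0) * F (case_nat (\<omega> 0) \<omega>)"
    have x: "ennreal (x\<^sup>2) \<le> ennreal s * A \<omega>"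
      unfolding x_def A_def by (rule integral_Cauchy_Schwarz[OF f\<sigma> Fc[OF \<omega>] s fs])
    have d: "0 \<le> diag_weight n (\<omega> 0)" using eta_nonneg by (simp add: diag_weight_def)
    \<comment> \<open>The square contains the weight twice: one factor goes with f^2, where the
      bound \<open>s\<close> applies, the other with F^2, where it is the density of the diagonal
      part.\<close>
    have "y\<^sup>2 = (diag_weight n (\<omega> 0) * (f (\<omega> 0))\<^sup>2) * (diag_weight n (\<omega> 0) * (F (case_nat (\<omega> 0) \<omega>))\<^sup>2)"
      unfolding y_def by (simp add: power2_eq_square)
    also have "\<dots> \<le> s * (diag_weight n (\<omega> 0) * (F (case_nat (\<omega> 0) \<omega>))\<^sup>2)"
      using es s d by (intro mult_right_mono) (auto simp: diag_weight_def)
    finally have y: "ennreal (y\<^sup>2) \<le> ennreal s * B \<omega>"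
      unfolding B_def using s d by (simp add: ennreal_mult[symmetric])
    have "0 \<le> (x - y)\<^sup>2" by simp
    then have "(x + y)\<^sup>2 \<le> 2 * x\<^sup>2 + 2 * y\<^sup>2" by (simp add: power2_sum power2_diff)
    then have "ennreal ((x + y)\<^sup>2) \<le> 2 * ennreal (x\<^sup>2) + 2 * ennreal (y\<^sup>2)"
      by (simp add: ennreal_mult''[symmetric] flip: ennreal_plus ennreal_numeral)
    also have "\<dots> \<le> 2 * (ennreal s * A \<omega>) + 2 * (ennreal s * B \<omega>)"
      by (intro add_mono mult_left_mono x y) auto
    also have "\<dots> = ennreal (2 * s) * (A \<omega> + B \<omega>)"
      using s by (simp add: ennreal_mult distrib_left mult.assoc)
    finally show "ennreal ((annihilate f n F \<omega>)\<^sup>2) \<le> ennreal (2 * s) * (A \<omega> + B \<omega>)"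
      unfolding x_def y_def .
  qed
  also have "\<dots> = ennreal (2 * s) * (\<integral>\<^sup>+\<omega>. ennreal ((F \<omega>)\<^sup>2) \<partial>M (Suc n))"
    unfolding AB using Am Bm by (intro nn_integral_cmult) auto
  finally have le: "(\<integral>\<^sup>+\<omega>. ennreal ((annihilate f n F \<omega>)\<^sup>2) \<partial>M n) \<le> \<dots>" .
  show "annihilate f n F \<in> L2 (M n)" "norm (J n (annihilate f n F)) \<le> sqrt (2 * s) * norm (J (Suc n) F)"
    using L2_J_bound[OF F G _ le] s by auto
  have "(\<integral>\<^sup>+\<omega>. A \<omega> \<partial>M n) \<le> (\<integral>\<^sup>+\<omega>. A \<omega> + B \<omega> \<partial>M n)" by (intro nn_integral_mono) simp
  also have "\<dots> < \<infinity>" using F unfolding AB[symmetric] by (simp add: L2_iff)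
  finally have "AE \<omega> in M n. A \<omega> \<noteq> \<infinity>" using Am by (intro nn_integral_PInf_AE) auto
  then show "AE \<omega> in M n. integrable \<sigma> (\<lambda>t. f t * F (case_nat t \<omega>))"
  proof (rule AE_mp, intro AE_I2 impI)
    fix \<omega> :: "nat \<Rightarrow> 't" assume \<omega>: "\<omega> \<in> space (M n)" and "A \<omega> \<noteq> \<infinity>"
    then have iF: "integrable \<sigma> (\<lambda>t. (F (case_nat t \<omega>))\<^sup>2)"
      using Fc[OF \<omega>] unfolding A_def by (intro integrableI_bounded) (auto simp: top.not_eq_extremum)
    have if2: "integrable \<sigma> (\<lambda>t. (f t)\<^sup>2)"
      using f\<sigma> fs by (intro integrableI_bounded) (auto intro: le_less_trans)
    show "integrable \<sigma> (\<lambda>t. f t * F (case_nat t \<omega>))"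
      by (rule integrable_mult_L2[OF f\<sigma> Fc[OF \<omega>] if2 iF])
  qed
qed

lemma annihilation_op_apply:
  assumes w: "weight s f" and F: "F \<in> L2 (M n)"
  shows "annihilation_op \<sigma> \<eta> J f (J n F) = (if n = 0 then 0 else J (n - 1) (annihilate f (n - 1) F))"
proof -
  let ?\<Phi> = "\<lambda>n F. if n = 0 then 0 else J (n - 1) (annihilate f (n - 1) F)"
  note ab = annihilation_bound[OF w]
  have s: "0 < s" using w by (simp add: weight_def)
  obtain U where U: "\<And>n F. F \<in> L2 (M n) \<Longrightarrow> blinfun_apply U (J n F) = ?\<Phi> n F"
  proof (rule fock_op_exists[of ?\<Phi> "sqrt (2 * s)"])
    fix n F G and a b :: real assume FG: "F \<in> L2 (M n)" "G \<in> L2 (M n)"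
    show "?\<Phi> n (\<lambda>\<omega>. a * F \<omega> + b * G \<omega>) = a *\<^sub>R ?\<Phi> n F + b *\<^sub>R ?\<Phi> n G"
    proof (cases n)
      case (Suc m)
      have FG': "F \<in> L2 (M (Suc m))" "G \<in> L2 (M (Suc m))" using FG Suc by auto
      \<comment> \<open>The integral splits only where both summands are integrable; elsewhere the
        total integral has a default value, and equality holds only almost everywhere.\<close>
      have "J m (annihilate f m (\<lambda>\<omega>. a * F \<omega> + b * G \<omega>))
          = J m (\<lambda>\<omega>. a * annihilate f m F \<omega> + b * annihilate f m G \<omega>)"
      proof (rule J_cong_AE)
        show "annihilate f m (\<lambda>\<omega>. a * F \<omega> + b * G \<omega>) \<in> L2 (M m)"
          using FG' by (intro ab L2_lincomb)
        show "(\<lambda>\<omega>. a * annihilate f m F \<omega> + b * annihilate f m G \<omega>) \<in> L2 (M m)"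
          using FG' by (intro ab L2_lincomb)
        show "AE \<omega> in M m. annihilate f m (\<lambda>\<omega>. a * F \<omega> + b * G \<omega>) \<omega>
            = a * annihilate f m F \<omega> + b * annihilate f m G \<omega>"
          using ab(3)[OF FG'(1)] ab(3)[OF FG'(2)]
        proof eventually_elim
          case (elim \<omega>)
          have "(LINT t|\<sigma>. f t * (a * F (case_nat t \<omega>) + b * G (case_nat t \<omega>)))
             = (LINT t|\<sigma>. a * (f t * F (case_nat t \<omega>)) + b * (f t * G (case_nat t \<omega>)))"
            by (simp add: algebra_simps)
          also have "\<dots> = a * (LINT t|\<sigma>. f t * F (case_nat t \<omega>)) + b * (LINT t|\<sigma>. f t * G (case_nat t \<omega>))"
            using elim by simp
          finally show ?case by (simp add: algebra_simps)
        qed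
      qed
      also have "\<dots> = a *\<^sub>R J m (annihilate f m F) + b *\<^sub>R J m (annihilate f m G)"
        using FG' by (intro J_lincomb ab)
      finally show ?thesis using Suc by simp
    qed simp
  next
    fix m n F G assume "F \<in> L2 (M m)" "G \<in> L2 (M n)" "m \<noteq> n"
    then show "?\<Phi> m F \<bullet> ?\<Phi> n G = 0"
      using ab(1)[of F "m - 1"] ab(1)[of G "n - 1"] by (auto intro!: J_orth)
  next
    fix n F assume "F \<in> L2 (M n)"
    then show "norm (?\<Phi> n F) \<le> sqrt (2 * s) * norm (J n F)" using ab(2)[of F "n - 1"] s by (cases n) auto
  qed (use s in auto)
  have "annihilation_op \<sigma> \<eta> J f = U"
    unfolding annihilation_op_def
  proof (rule the_equality, intro conjI ballI allI impI)
    show "blinfun_apply U (J 0 F) = 0" if "F \<in> L2 (M 0)" for F using U[OF that] by simp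
    show "blinfun_apply U (J 1 F) = J 0 (\<lambda>\<omega>. LINT t|\<sigma>. f t * F (case_nat t \<omega>))" if "F \<in> L2 (M 1)" for F
      using U[OF that] by (simp add: diag_weight_def)
    show "blinfun_apply U (J n F) = J (n - 1) (\<lambda>\<omega>. (LINT t|\<sigma>. f t * F (case_nat t \<omega>)) + \<eta> (\<omega> 0) * f (\<omega> 0) * F (case_nat (\<omega> 0) \<omega>))"
      if "2 \<le> n" "F \<in> L2 (M n)" for n F using U[OF that(2)] that(1) by (simp add: diag_weight_def)
  next
    fix V assume V: "(\<forall>F\<in>L2 (M 0). blinfun_apply V (J 0 F) = 0) \<and>
       (\<forall>F\<in>L2 (M 1). blinfun_apply V (J 1 F) = J 0 (\<lambda>\<omega>. LINT t|\<sigma>. f t * F (case_nat t \<omega>))) \<and>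
       (\<forall>n\<ge>2. \<forall>F\<in>L2 (M n). blinfun_apply V (J n F) = J (n - 1) (\<lambda>\<omega>. (LINT t|\<sigma>. f t * F (case_nat t \<omega>))
                                    + \<eta> (\<omega> 0) * f (\<omega> 0) * F (case_nat (\<omega> 0) \<omega>)))"
    show "V = U"
    proof (rule fock_op_eqI)
      fix n F assume F: "F \<in> L2 (M n)"
      consider "n = 0" | "n = 1" | "2 \<le> n" by linarith
      then show "blinfun_apply V (J n F) = blinfun_apply U (J n F)"
        using V F U[OF F] by cases (auto simp: diag_weight_def)
    qed
  qed
  then show ?thesis using U F by simp
qed

end

section \<open>The pairing\<close>

lemma rel_compact_borel_subset:
  "D \<in> rel_compact_borel \<Longrightarrow> E \<in> sets borel \<Longrightarrow> E \<subseteq> D \<Longrightarrow> E \<in> rel_compact_borel"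
  unfolding rel_compact_borel_def
  using compact_Int_closed[of "closure D" "closure E"] closure_mono[of E D] by (auto simp: inf.absorb2)

lemma rel_compact_borel_Un:
  "D \<in> rel_compact_borel \<Longrightarrow> E \<in> rel_compact_borel \<Longrightarrow> D \<union> E \<in> rel_compact_borel"
  unfolding rel_compact_borel_def by (auto simp: closure_Un compact_Un)

lemma rel_compact_borel_UN:
  "finite I \<Longrightarrow> (\<And>i. i \<in> I \<Longrightarrow> D i \<in> rel_compact_borel) \<Longrightarrow> (\<Union>i\<in>I. D i) \<in> rel_compact_borel"
  by (induction I rule: finite_induct) (auto simp: rel_compact_borel_Un, simp add: rel_compact_borel_def)

lemma rel_compact_borelD: "D \<in> rel_compact_borel \<Longrightarrow> D \<in> sets borel"
  by (simp add: rel_compact_borel_def)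

text \<open>Index sets of arbitrary type let the difference of two simple mappings be indexed by a
  disjoint sum, and a simple mapping by its own values.\<close>

abbreviation rep_fun :: "'i set \<Rightarrow> ('i \<Rightarrow> 't::topological_space set) \<Rightarrow> ('i \<Rightarrow> 'g::real_normed_vector \<Rightarrow>\<^sub>L 'g) \<Rightarrow> 't \<Rightarrow> 'g \<Rightarrow>\<^sub>L 'g" where
  "rep_fun I D V \<equiv> (\<lambda>t. \<Sum>i\<in>I. indicat_real (D i) t *\<^sub>R V i)"

lemma simple_mapping_rep_fun:
  assumes "finite I" "\<And>i. i \<in> I \<Longrightarrow> D i \<in> rel_compact_borel"
  shows "simple_mapping (rep_fun I D V)"
proof -
  obtain f where f: "bij_betw f {..<card I} I" using ex_bij_betw_nat_finite[OF assms(1)] by (auto simp: atLeast0LessThan)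
  have "simple_rep (card I) (D \<circ> f) (V \<circ> f) (rep_fun I D V)"
    unfolding simple_rep_def using assms(2) f
    by (auto simp: sum.reindex_bij_betw[OF f, symmetric] bij_betw_def)
  then show ?thesis unfolding simple_mapping_def by blast
qed

lemma simple_mappingE:
  assumes "simple_mapping Z"
  obtains n D V where "\<And>i. i \<in> {..<n} \<Longrightarrow> D i \<in> rel_compact_borel" "Z = rep_fun {..<n::nat} D V"
  using assms unfolding simple_mapping_def simple_rep_def by blast

locale meixner = fock_space \<sigma> lam \<eta> J + tensor_space ten
  for \<sigma> :: "'t::second_countable_topology measure" and lam \<eta> :: "'t \<Rightarrow> real"
    and J :: "nat \<Rightarrow> ((nat \<Rightarrow> 't) \<Rightarrow> real) \<Rightarrow> 'f::{real_inner, banach}"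
    and ten :: "'g::{real_inner, banach} \<Rightarrow> 'f \<Rightarrow> 'h::{real_inner, banach}" +
  assumes finite_\<sigma>: "A \<in> rel_compact_borel \<Longrightarrow> emeasure \<sigma> A < \<infinity>"
    and bounded_coeffs: "A \<in> rel_compact_borel \<Longrightarrow> \<exists>c. \<forall>t\<in>A. \<bar>lam t\<bar> \<le> c \<and> \<eta> t \<le> c"
begin

section \<open>Indicator functions and projections for the first coordinate\<close>

lemma weight_indicator:
  assumes A: "A \<in> rel_compact_borel"
  shows "\<exists>s. weight s (indicat_real A)"
proof -
  obtain c where c: "\<And>t. t \<in> A \<Longrightarrow> \<eta> t \<le> c" using bounded_coeffs[OF A] by blast
  let ?s = "1 + \<bar>c\<bar> + measure \<sigma> A"
  have Ab: "A \<in> sets \<sigma>" using A by (simp add: sets_\<sigma> rel_compact_borelD)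
  have "(\<integral>\<^sup>+t. ennreal ((indicat_real A t)\<^sup>2) \<partial>\<sigma>) = (\<integral>\<^sup>+t. indicator A t \<partial>\<sigma>)"
    by (intro nn_integral_cong) (simp add: indicator_def)
  also have "\<dots> = ennreal (measure \<sigma> A)"
    using Ab finite_\<sigma>[OF A] by (simp add: emeasure_eq_ennreal_measure)
  also have "\<dots> \<le> ennreal ?s" by (intro ennreal_leI) auto
  finally have "(\<integral>\<^sup>+t. ennreal ((indicat_real A t)\<^sup>2) \<partial>\<sigma>) \<le> ennreal ?s" .
  moreover have "\<eta> t * (indicat_real A t)\<^sup>2 \<le> ?s" for t
  proof -
    have "c \<le> ?s" "0 \<le> ?s" using measure_nonneg[of \<sigma> A] by linarith+
    then show ?thesis using c[of t] by (auto simp: indicator_def)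
  qed
  moreover have "0 < ?s" using measure_nonneg[of \<sigma> A] by linarith
  ultimately show ?thesis
    unfolding weight_def using rel_compact_borelD[OF A] by (intro exI[of _ ?s]) auto
qed

text \<open>The neutral operator with coefficient 1 multiplies by the indicator of \<open>D\<close>
  in the first coordinate and kills the vacuum. As \<open>D\<close> varies this is a
  projection-valued set function whose value on the whole space projects onto the complement of the
  vacuum.\<close>

definition proj :: "'t set \<Rightarrow> ('f \<Rightarrow>\<^sub>L 'f)" where
  "proj D = neutral_op \<sigma> (\<lambda>_. 1) \<eta> J (indicat_real D)"

lemma proj:
  assumes "D \<in> sets borel"
  shows proj_apply: "F \<in> L2 (M n) \<Longrightarrow> proj D (J n F) = (if n = 0 then 0 else J n (\<lambda>\<omega>. indicat_real D (\<omega> 0) * F \<omega>))"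
    and norm_proj_le: "norm (proj D) \<le> 1"
    and proj_L2: "F \<in> L2 (M (Suc n)) \<Longrightarrow> (\<lambda>\<omega>. indicat_real D (\<omega> 0) * F \<omega>) \<in> L2 (M (Suc n))"
  using neutral_op[of "\<lambda>_. 1" "indicat_real D" 1] neutral_bound(1)[of "indicat_real D" 1] assms
  unfolding proj_def by (auto simp: indicator_def)

lemma proj_UN:
  assumes I: "finite I" "\<And>i. i \<in> I \<Longrightarrow> D i \<in> sets borel" "disjoint_family_on D I"
  shows "proj (\<Union>i\<in>I. D i) = (\<Sum>i\<in>I. proj (D i))"
proof (rule fock_op_eqI)
  fix n F assume F: "F \<in> L2 (M n)"
  have U: "(\<Union>i\<in>I. D i) \<in> sets borel" using I by auto
  show "proj (\<Union>i\<in>I. D i) (J n F) = (\<Sum>i\<in>I. proj (D i)) (J n F)"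
  proof (cases n)
    case 0
    then show ?thesis using F I U by (simp add: proj_apply blinfun.sum_left)
  next
    case (Suc m)
    have "(\<lambda>\<omega>. indicat_real (\<Union>i\<in>I. D i) (\<omega> 0) * F \<omega>) = (\<lambda>\<omega>. \<Sum>i\<in>I. indicat_real (D i) (\<omega> 0) * F \<omega>)"
      by (simp add: indicator_UN_disjoint[OF I(1,3)] sum_distrib_right)
    moreover have "J n (\<lambda>\<omega>. \<Sum>i\<in>I. indicat_real (D i) (\<omega> 0) * F \<omega>)
        = (\<Sum>i\<in>I. J n (\<lambda>\<omega>. indicat_real (D i) (\<omega> 0) * F \<omega>))"
      using F I proj_L2 Suc by (intro J_sum) auto
    moreover have "(\<Sum>i\<in>I. proj (D i)) (J n F) = (\<Sum>i\<in>I. J n (\<lambda>\<omega>. indicat_real (D i) (\<omega> 0) * F \<omega>))"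
      unfolding blinfun.sum_left using F I Suc by (intro sum.cong refl) (simp add: proj_apply)
    ultimately show ?thesis using F U Suc by (simp add: proj_apply)
  qed
qed

lemma proj_orthogonal:
  assumes D: "D \<in> sets borel" and E: "E \<in> sets borel" and DE: "D \<inter> E = {}"
  shows "proj D x \<bullet> proj E y = 0"
proof (rule orthogonal_on_dense[OF J_dense J_dense])
  fix x y assume "x \<in> (\<Union>n. J n ` L2 (M n))" "y \<in> (\<Union>n. J n ` L2 (M n))"
  then obtain m n F G where F: "F \<in> L2 (M m)" "x = J m F" and G: "G \<in> L2 (M n)" "y = J n G" by blast
  show "proj D x \<bullet> proj E y = 0"
  proof (cases "m = n \<and> n \<noteq> 0")
    case True
    then obtain k where k: "n = Suc k" "m = Suc k" by (cases n) auto
    have "proj D x \<bullet> proj E y = (LINT \<omega>|M n. (indicat_real D (\<omega> 0) * F \<omega>) * (indicat_real E (\<omega> 0) * G \<omega>))"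
      using F G proj_L2[OF D, of F k] proj_L2[OF E, of G k] unfolding k
      by (simp add: proj_apply[OF D] proj_apply[OF E] J_inner)
    also have "\<dots> = (LINT \<omega>|M n. 0)"
      using DE by (intro Bochner_Integration.integral_cong) (auto simp: indicator_def)
    finally show ?thesis by simp
  next
    case False
    then show ?thesis
      using F G proj_L2[OF D, of F "m - 1"] proj_L2[OF E, of G "n - 1"]
      by (auto simp: proj_apply[OF D] proj_apply[OF E] intro!: J_orth)
  qed
qed

text \<open>The created coordinate is the first one of the result, so restricting it to
  \<open>D\<close> can be done after creation with the larger set \<open>A\<close>.\<close>

lemma creation_op_proj:
  assumes "A \<in> rel_compact_borel" "D \<in> sets borel" "D \<subseteq> A"
  shows "creation_op \<sigma> \<eta> J (indicat_real D) = proj D o\<^sub>L creation_op \<sigma> \<eta> J (indicat_real A)"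
proof (rule fock_op_eqI)
  fix n F assume F: "F \<in> L2 (M n)"
  obtain s r where w: "weight s (indicat_real A)" "weight r (indicat_real D)"
    using weight_indicator[OF assms(1)] weight_indicator[OF rel_compact_borel_subset[OF assms]] by blast
  have "(\<lambda>\<omega>. indicat_real D (\<omega> 0) * F (\<lambda>i. \<omega> (Suc i)))
     = (\<lambda>\<omega>. indicat_real D (\<omega> 0) * (indicat_real A (\<omega> 0) * F (\<lambda>i. \<omega> (Suc i))))"
    using assms(3) by (intro ext) (auto simp: indicator_def)
  then show "creation_op \<sigma> \<eta> J (indicat_real D) (J n F) = (proj D o\<^sub>L creation_op \<sigma> \<eta> J (indicat_real A)) (J n F)"
    using creation_bound(1)[OF w(1) F]
    by (simp add: creation_op_apply[OF w(1) F] creation_op_apply[OF w(2) F] proj_apply[OF assms(2)])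
qed

lemma neutral_op_proj:
  assumes "A \<in> rel_compact_borel" "D \<in> sets borel" "D \<subseteq> A"
  shows "neutral_op \<sigma> lam \<eta> J (indicat_real D) = neutral_op \<sigma> lam \<eta> J (indicat_real A) o\<^sub>L proj D"
proof (rule fock_op_eqI)
  fix n F assume F: "F \<in> L2 (M n)"
  obtain c where "\<And>t. t \<in> A \<Longrightarrow> \<bar>lam t\<bar> \<le> c" using bounded_coeffs[OF assms(1)] by blast
  then have "\<bar>lam t * indicat_real E t\<bar> \<le> \<bar>c\<bar>" if "E \<subseteq> A" for E t
    using that by (auto simp: indicator_def) force
  then have ap: "F \<in> L2 (M n) \<Longrightarrow> neutral_op \<sigma> lam \<eta> J (indicat_real E) (J n F)
      = (if n = 0 then 0 else J n (\<lambda>\<omega>. lam (\<omega> 0) * indicat_real E (\<omega> 0) * F \<omega>))"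
    if "E \<in> sets borel" "E \<subseteq> A" for E F n
    using that lam by (intro neutral_op_apply) auto
  have "(\<lambda>\<omega>. lam (\<omega> 0) * indicat_real D (\<omega> 0) * F \<omega>)
     = (\<lambda>\<omega>. lam (\<omega> 0) * indicat_real A (\<omega> 0) * (indicat_real D (\<omega> 0) * F \<omega>))"
    using assms(3) by (intro ext) (auto simp: indicator_def)
  then show "neutral_op \<sigma> lam \<eta> J (indicat_real D) (J n F)
      = (neutral_op \<sigma> lam \<eta> J (indicat_real A) o\<^sub>L proj D) (J n F)"
    using F proj_L2[OF assms(2), of F "n - 1"] assms rel_compact_borelD[OF assms(1)]
    by (cases n) (simp_all add: ap proj_apply blinfun.bilinear_simps)
qed

text \<open>In the integral and in the diagonal term alike, f and \<open>F\<close> are evaluated at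
  the same first coordinate, so the indicator of \<open>D\<close> moves from f to \<open>F\<close>.
  For annihilation, the projection has to act before the coordinate is removed.\<close>

lemma annihilation_op_proj:
  assumes "A \<in> rel_compact_borel" "D \<in> sets borel" "D \<subseteq> A"
  shows "annihilation_op \<sigma> \<eta> J (indicat_real D) = annihilation_op \<sigma> \<eta> J (indicat_real A) o\<^sub>L proj D"
proof (rule fock_op_eqI)
  fix n F assume F: "F \<in> L2 (M n)"
  obtain s r where w: "weight s (indicat_real A)" "weight r (indicat_real D)"
    using weight_indicator[OF assms(1)] weight_indicator[OF rel_compact_borel_subset[OF assms]] by blast
  have "annihilate (indicat_real D) m F = annihilate (indicat_real A) m (\<lambda>\<omega>. indicat_real D (\<omega> 0) * F \<omega>)" for m
  proof -
    have *: "indicat_real A t * (indicat_real D t * x) = indicat_real D t * x" for t x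
      using assms(3) by (auto simp: indicator_def)
    show ?thesis by (simp add: * mult.assoc)
  qed
  then show "annihilation_op \<sigma> \<eta> J (indicat_real D) (J n F)
      = (annihilation_op \<sigma> \<eta> J (indicat_real A) o\<^sub>L proj D) (J n F)"
    using F proj_L2[OF assms(2), of F "n - 1"]
    by (cases n) (simp_all add: annihilation_op_apply[OF w(1)] annihilation_op_apply[OF w(2)]
        proj_apply[OF assms(2)] blinfun.bilinear_simps del: nat.case)
qed

text \<open>On \<open>G \<otimes> F\<close>, the sum of the \<open>V\<^sub>i \<otimes> proj D\<^sub>i\<close> is multiplication by the operator-valued
  function \<open>\<Sum> V\<^sub>i \<chi>\<^sub>D\<^sub>i\<close> of the first coordinate (and 0 on the vacuum).\<close>

definition mult_rep :: "'i set \<Rightarrow> ('i \<Rightarrow> 't set) \<Rightarrow> ('i \<Rightarrow> 'g \<Rightarrow>\<^sub>L 'g) \<Rightarrow> ('h \<Rightarrow>\<^sub>L 'h)" where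
  "mult_rep I D V = (\<Sum>i\<in>I. op_tensor ten (V i) (proj (D i)))"

text \<open>Overlapping sets are refined to the atoms of the algebra they generate. On a non-empty
  atom the function is constant, so its value has norm at most \<open>c\<close>; the atoms have
  orthogonal projections, and Pythagoras turns the bounds of the pieces into a bound by the maximum
  instead of the sum.\<close>

lemma norm_mult_rep_le:
  assumes I: "finite I" "\<And>i. i \<in> I \<Longrightarrow> D i \<in> sets borel"
    and c: "\<And>t. norm (rep_fun I D V t) \<le> c"
  shows "norm (mult_rep I D V) \<le> c"
proof -
  have c0: "0 \<le> c" using c[of undefined] norm_ge_zero order_trans by blast
  \<comment> \<open>\<open>E K\<close> is the atom of points lying in exactly those
    \<open>D i\<close> with index in \<open>K\<close>; many of these atoms may be empty.\<close>
  define E where "E K = {t. \<forall>i\<in>I. t \<in> D i \<longleftrightarrow> i \<in> K}" for K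
  have Eb: "E K \<in> sets borel" for K
  proof -
    have "E K = (\<Inter>i\<in>I. if i \<in> K then D i else - D i) \<inter> UNIV"
      by (auto simp: E_def split: if_splits)
    also have "\<dots> \<in> sets borel"
    proof (cases "I = {}")
      case False
      have "(\<Inter>i\<in>I. if i \<in> K then D i else - D i) \<in> sets borel"
        by (rule sets.finite_INT[OF I(1) False]) (use I(2) in simp)
      then show ?thesis by simp
    qed simp
    finally show ?thesis .
  qed
  have Edisj: "disjoint_family_on E (Pow I)"
    unfolding disjoint_family_on_def E_def by blast
  have fP: "finite (Pow I)" using I by simp
  have projD: "proj (D i) = (\<Sum>K\<in>{K\<in>Pow I. i \<in> K}. proj (E K))" if "i \<in> I" for i
  proof -
    have "D i = (\<Union>K\<in>{K\<in>Pow I. i \<in> K}. E K)"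
    proof (intro set_eqI iffI)
      fix t assume "t \<in> D i"
      then have "{j\<in>I. t \<in> D j} \<in> {K\<in>Pow I. i \<in> K}" "t \<in> E {j\<in>I. t \<in> D j}"
        using that by (auto simp: E_def)
      then show "t \<in> (\<Union>K\<in>{K\<in>Pow I. i \<in> K}. E K)" by blast
    qed (use that in \<open>auto simp: E_def\<close>)
    moreover have "disjoint_family_on E {K\<in>Pow I. i \<in> K}"
      using Edisj by (rule disjoint_family_on_mono[rotated]) auto
    ultimately show ?thesis using proj_UN[of "{K\<in>Pow I. i \<in> K}" E] Eb fP by simp
  qed
  define VK where "VK K = (\<Sum>i\<in>K. V i)" for K
  have "mult_rep I D V = (\<Sum>i\<in>I. \<Sum>K\<in>{K\<in>Pow I. i \<in> K}. op_tensor ten (V i) (proj (E K)))"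
    unfolding mult_rep_def by (intro sum.cong refl) (simp add: projD op_tensor_sum)
  also have "\<dots> = (\<Sum>K\<in>Pow I. \<Sum>i\<in>{i\<in>I. i \<in> K}. op_tensor ten (V i) (proj (E K)))"
    by (rule sum.swap_restrict[OF I(1) fP])
  also have "\<dots> = (\<Sum>K\<in>Pow I. op_tensor ten (VK K) (proj (E K)))"
    unfolding VK_def op_tensor_sum by (intro sum.cong refl) auto
  finally have mr: "mult_rep I D V = (\<Sum>K\<in>Pow I. op_tensor ten (VK K) (proj (E K)))" .
  have orth: "op_tensor ten R (proj (E K)) x \<bullet> op_tensor ten R' (proj (E K')) y = 0"
    if "K \<in> Pow I" "K' \<in> Pow I" "K \<noteq> K'" for R R' K K' x y
  proof (rule orthogonal_on_dense[OF hilbert_tensorD(3)[OF ten] hilbert_tensorD(3)[OF ten]])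
    have "E K \<inter> E K' = {}" using Edisj that unfolding disjoint_family_on_def by blast
    then show "op_tensor ten R (proj (E K)) x \<bullet> op_tensor ten R' (proj (E K')) y = 0"
      if "x \<in> {ten a b |a b. True}" "y \<in> {ten a b |a b. True}" for x y
      using that by (auto simp: op_tensor_apply hilbert_tensorD(2)[OF ten] proj_orthogonal[OF Eb Eb])
  qed
  have VKle: "norm (op_tensor ten (VK K) (proj (E K)) x) \<le> c * norm (op_tensor ten id_blinfun (proj (E K)) x)"
    if K: "K \<in> Pow I" for K x
  \<comment> \<open>On an empty atom the sum \<open>VK K\<close> is not a value of the function and
    need not be bounded by \<open>c\<close>, but its projection is 0.\<close>
  proof (cases "E K = {}")
    case True
    then have "proj (E K) = 0"
      using proj_UN[of "{} :: nat set" "\<lambda>_. {}"] by (simp add: disjoint_family_on_def)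
    then show ?thesis by (simp add: op_tensor_zero)
  next
    case False
    then obtain t where t: "t \<in> E K" by blast
    have "rep_fun I D V t = (\<Sum>i\<in>I. if i \<in> K then V i else 0)"
      using t by (intro sum.cong refl) (auto simp: E_def indicator_def)
    also have "\<dots> = VK K" using K I by (simp add: VK_def sum.inter_restrict[symmetric] inf.absorb2)
    finally have "norm (VK K) \<le> c" using c[of t] by simp
    have "op_tensor ten (VK K) (proj (E K)) = left_op ten (VK K) o\<^sub>L op_tensor ten id_blinfun (proj (E K))"
      by (simp add: op_tensor_compose[symmetric] blinfun_compose_simps)
    then have "norm (op_tensor ten (VK K) (proj (E K)) x)
        \<le> norm (left_op ten (VK K)) * norm (op_tensor ten id_blinfun (proj (E K)) x)"
      by (simp add: norm_blinfun)
    also have "\<dots> \<le> c * norm (op_tensor ten id_blinfun (proj (E K)) x)"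
      using norm_left_op_le[of "VK K"] \<open>norm (VK K) \<le> c\<close> by (intro mult_right_mono) auto
    finally show ?thesis .
  qed
  show ?thesis
  proof (rule norm_blinfun_bound[OF c0])
    fix x
    have U: "(\<Union>K\<in>Pow I. E K) = UNIV"
    proof -
      have "t \<in> E {j\<in>I. t \<in> D j}" "{j\<in>I. t \<in> D j} \<in> Pow I" for t by (auto simp: E_def)
      then show ?thesis by blast
    qed
    have "(norm (mult_rep I D V x))\<^sup>2 = (\<Sum>K\<in>Pow I. (norm (op_tensor ten (VK K) (proj (E K)) x))\<^sup>2)"
      unfolding mr blinfun.sum_left using fP
      by (intro norm_sum_Pythagorean) (auto simp: pairwise_def orthogonal_def intro!: orth)
    also have "\<dots> \<le> (\<Sum>K\<in>Pow I. (c * norm (op_tensor ten id_blinfun (proj (E K)) x))\<^sup>2)"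
      by (intro sum_mono power_mono VKle) auto
    also have "\<dots> = c\<^sup>2 * (\<Sum>K\<in>Pow I. (norm (op_tensor ten id_blinfun (proj (E K)) x))\<^sup>2)"
      by (simp add: power_mult_distrib sum_distrib_left)
    also have "(\<Sum>K\<in>Pow I. (norm (op_tensor ten id_blinfun (proj (E K)) x))\<^sup>2)
        = (norm (\<Sum>K\<in>Pow I. op_tensor ten id_blinfun (proj (E K)) x))\<^sup>2"
      using fP by (intro norm_sum_Pythagorean[symmetric]) (auto simp: pairwise_def orthogonal_def intro!: orth)
    \<comment> \<open>The atoms partition the whole space, so the pieces of \<open>x\<close> add up
      to its part off the vacuum, whose norm does not exceed that of \<open>x\<close>.\<close>
    also have "(\<Sum>K\<in>Pow I. op_tensor ten id_blinfun (proj (E K)) x) = op_tensor ten id_blinfun (proj UNIV) x"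
      using proj_UN[OF fP Eb Edisj] unfolding U by (simp add: op_tensor_sum blinfun.sum_left)
    also have "c\<^sup>2 * (norm \<dots>)\<^sup>2 \<le> c\<^sup>2 * (norm x)\<^sup>2"
    proof (intro mult_left_mono power_mono)
      have "norm (op_tensor ten id_blinfun (proj UNIV)) \<le> norm (id_blinfun :: 'g \<Rightarrow>\<^sub>L 'g) * norm (proj UNIV)"
        by (rule norm_op_tensor_le)
      also have "\<dots> \<le> 1 * 1" by (intro mult_mono norm_blinfun_id_le norm_proj_le) auto
      finally have "norm (op_tensor ten id_blinfun (proj UNIV)) * norm x \<le> 1 * norm x"
        by (intro mult_right_mono) auto
      then show "norm (op_tensor ten id_blinfun (proj UNIV) x) \<le> norm x"
        using norm_blinfun[of "op_tensor ten id_blinfun (proj UNIV)" x] by linarith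
    qed auto
    finally have "(norm (mult_rep I D V x))\<^sup>2 \<le> (c * norm x)\<^sup>2"
      by (simp add: power_mult_distrib)
    then show "norm (mult_rep I D V x) \<le> c * norm x" by (rule power2_le_imp_le) (simp add: c0)
  qed
qed

text \<open>Negating the second family and joining the index sets reduces a difference to a single
  representation. With \<open>c = 0\<close> it shows that \<open>mult_rep\<close> depends on the
  represented function only.\<close>

lemma norm_mult_rep_diff_le:
  assumes I: "finite I" "\<And>i. i \<in> I \<Longrightarrow> D i \<in> sets borel"
    and I': "finite I'" "\<And>i. i \<in> I' \<Longrightarrow> D' i \<in> sets borel"
    and c: "\<And>t. norm (rep_fun I D V t - rep_fun I' D' V' t) \<le> c"
  shows "norm (mult_rep I D V - mult_rep I' D' V') \<le> c"
proof -
  have neg: "op_tensor ten (- R) S = - op_tensor ten R S" for R S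
    using op_tensor_linear(3)[of "-1" R S] by simp
  have "rep_fun (I <+> I') (case_sum D D') (case_sum V (\<lambda>i. - V' i)) t = rep_fun I D V t - rep_fun I' D' V' t" for t
    by (subst sum.Plus[OF I(1) I'(1)]) (simp add: sum_negf)
  then have "norm (mult_rep (I <+> I') (case_sum D D') (case_sum V (\<lambda>i. - V' i))) \<le> c"
    using I I' c by (intro norm_mult_rep_le) (auto simp only: finite_Plus sum.case)
  then show ?thesis using I I' by (simp add: mult_rep_def sum.Plus neg sum_negf)
qed

section \<open>Factorization and norm bound of the simple pairing\<close>

definition creation_part :: "'t set \<Rightarrow> ('h \<Rightarrow>\<^sub>L 'h)" where
  "creation_part A = op_tensor ten id_blinfun (creation_op \<sigma> \<eta> J (indicat_real A))"

definition other_part :: "'t set \<Rightarrow> ('h \<Rightarrow>\<^sub>L 'h)" where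
  "other_part A = op_tensor ten id_blinfun
     (neutral_op \<sigma> lam \<eta> J (indicat_real A) + annihilation_op \<sigma> \<eta> J (indicat_real A))"

definition pairing_const :: "'t set \<Rightarrow> real" where
  "pairing_const A = norm (creation_part A) + norm (other_part A)"

definition pair_rep :: "'i set \<Rightarrow> ('i \<Rightarrow> 't set) \<Rightarrow> ('i \<Rightarrow> 'g \<Rightarrow>\<^sub>L 'g) \<Rightarrow> ('h \<Rightarrow>\<^sub>L 'h)" where
  "pair_rep I D V = (\<Sum>i\<in>I. op_tensor ten (V i) (meixner_op \<sigma> lam \<eta> J (indicat_real (D i))))"

lemma pair_rep_factor:
  assumes A: "A \<in> rel_compact_borel" and D: "\<And>i. i \<in> I \<Longrightarrow> D i \<in> sets borel" "\<And>i. i \<in> I \<Longrightarrow> D i \<subseteq> A"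
  shows "pair_rep I D V = (mult_rep I D V o\<^sub>L creation_part A) + (other_part A o\<^sub>L mult_rep I D V)"
proof -
  have "op_tensor ten (V i) (meixner_op \<sigma> lam \<eta> J (indicat_real (D i)))
     = (op_tensor ten (V i) (proj (D i)) o\<^sub>L creation_part A) + (other_part A o\<^sub>L op_tensor ten (V i) (proj (D i)))"
    if "i \<in> I" for i
  proof -
    define N where "N = neutral_op \<sigma> lam \<eta> J (indicat_real A) + annihilation_op \<sigma> \<eta> J (indicat_real A)"
    have "meixner_op \<sigma> lam \<eta> J (indicat_real (D i))
        = (proj (D i) o\<^sub>L creation_op \<sigma> \<eta> J (indicat_real A)) + (N o\<^sub>L proj (D i))"
      unfolding meixner_op_def N_def using A D[OF that]
      by (simp add: creation_op_proj[OF A] neutral_op_proj[OF A] annihilation_op_proj[OF A] blinfun_compose_simps add.assoc)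
    then show ?thesis
      unfolding creation_part_def other_part_def N_def[symmetric]
      by (simp add: op_tensor_linear(2) op_tensor_compose[symmetric] blinfun_compose_simps(10,11))
  qed
  then show ?thesis
    unfolding pair_rep_def mult_rep_def
    by (simp add: sum.distrib bounded_bilinear.sum_left[OF bounded_bilinear_blinfun_compose]
        bounded_bilinear.sum_right[OF bounded_bilinear_blinfun_compose])
qed

text \<open>The sets \<open>D i\<close> may leave \<open>A\<close> although the function vanishes
  there, because the summands can cancel. Over a larger set the pairing depends on the
  representation through \<open>mult_rep\<close> alone, which does not change when each set is cut
  down to \<open>A\<close>; after that the factorization over \<open>A\<close> applies.\<close>

lemma pair_rep_factor_vanishing:
  assumes A: "A \<in> rel_compact_borel"
    and I: "finite I" "\<And>i. i \<in> I \<Longrightarrow> D i \<in> rel_compact_borel" "\<And>t. t \<notin> A \<Longrightarrow> rep_fun I D V t = 0"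
  shows "pair_rep I D V = (mult_rep I D V o\<^sub>L creation_part A) + (other_part A o\<^sub>L mult_rep I D V)"
proof -
  note Ab = rel_compact_borelD[OF A]
  let ?B = "A \<union> (\<Union>i\<in>I. D i)" and ?D = "\<lambda>i. D i \<inter> A"
  have B: "?B \<in> rel_compact_borel" using A I by (intro rel_compact_borel_Un rel_compact_borel_UN) auto
  have Db: "D i \<in> sets borel" "?D i \<in> sets borel" if "i \<in> I" for i
    using rel_compact_borelD[OF I(2)[OF that]] Ab by auto
  have "rep_fun I ?D V t = rep_fun I D V t" for t
    using I(3)[of t] by (cases "t \<in> A") (simp_all add: indicator_def)
  then have "norm (mult_rep I D V - mult_rep I ?D V) \<le> 0"
    using I Db by (intro norm_mult_rep_diff_le) auto
  then have m: "mult_rep I D V = mult_rep I ?D V" by simp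
  have "pair_rep I D V = (mult_rep I D V o\<^sub>L creation_part ?B) + (other_part ?B o\<^sub>L mult_rep I D V)"
    using Db by (intro pair_rep_factor[OF B]) auto
  also have "\<dots> = pair_rep I ?D V"
    unfolding m using Db by (intro pair_rep_factor[OF B, symmetric]) auto
  also have "\<dots> = (mult_rep I D V o\<^sub>L creation_part A) + (other_part A o\<^sub>L mult_rep I D V)"
    unfolding m using Db by (intro pair_rep_factor[OF A]) auto
  finally show ?thesis .
qed

lemma norm_pair_rep_diff_le:
  assumes A: "A \<in> rel_compact_borel"
    and I: "finite I" "\<And>i. i \<in> I \<Longrightarrow> D i \<in> rel_compact_borel" "\<And>t. t \<notin> A \<Longrightarrow> rep_fun I D V t = 0"
    and I': "finite I'" "\<And>i. i \<in> I' \<Longrightarrow> D' i \<in> rel_compact_borel" "\<And>t. t \<notin> A \<Longrightarrow> rep_fun I' D' V' t = 0"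
    and c: "\<And>t. norm (rep_fun I D V t - rep_fun I' D' V' t) \<le> c"
  shows "norm (pair_rep I D V - pair_rep I' D' V') \<le> pairing_const A * c"
proof -
  let ?m = "mult_rep I D V - mult_rep I' D' V'"
  have m: "norm ?m \<le> c"
    using I I' c by (intro norm_mult_rep_diff_le) (auto intro: rel_compact_borelD)
  have e: "pair_rep I D V = (mult_rep I D V o\<^sub>L creation_part A) + (other_part A o\<^sub>L mult_rep I D V)"
    by (rule pair_rep_factor_vanishing[OF A I])
  have e': "pair_rep I' D' V' = (mult_rep I' D' V' o\<^sub>L creation_part A) + (other_part A o\<^sub>L mult_rep I' D' V')"
    by (rule pair_rep_factor_vanishing[OF A I'])
  have d: "pair_rep I D V - pair_rep I' D' V' = (?m o\<^sub>L creation_part A) + (other_part A o\<^sub>L ?m)"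
    unfolding e e' by (simp add: blinfun_compose_simps(3,4) add_diff_add)
  have "norm ((?m o\<^sub>L creation_part A) + (other_part A o\<^sub>L ?m)) \<le> norm ?m * norm (creation_part A) + norm (other_part A) * norm ?m"
    by (intro norm_triangle_le add_mono norm_blinfun_compose)
  also have "\<dots> \<le> c * norm (creation_part A) + norm (other_part A) * c"
    by (intro add_mono mult_right_mono mult_left_mono m) auto
  finally show ?thesis unfolding d by (simp add: pairing_const_def algebra_simps)
qed

text \<open>Two representations of one function have pairings that differ by at most a constant
  times 0, with the union of all sets involved in the place of \<open>A\<close>. Hence the
  description defining \<open>simple_pairing\<close> is unique.\<close>

lemma simple_pairing_eq:
  assumes I: "finite I" "\<And>i. i \<in> I \<Longrightarrow> D i \<in> rel_compact_borel"
  shows "simple_pairing \<sigma> lam \<eta> J ten (rep_fun I D V) = pair_rep I D V"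
proof -
  let ?Z = "rep_fun I D V"
  have uniq: "U = pair_rep I D V"
    if ex: "\<exists>n D' V'. simple_rep n D' V' ?Z \<and> U = (\<Sum>i<n. op_tensor ten (V' i) (meixner_op \<sigma> lam \<eta> J (indicat_real (D' i))))" for U
  proof -
    obtain n D' V' where sr: "simple_rep n D' V' ?Z" and U: "U = pair_rep {..<n} D' V'"
      using ex unfolding pair_rep_def by blast
    have D': "\<And>i. i < n \<Longrightarrow> D' i \<in> rel_compact_borel" "?Z = rep_fun {..<n} D' V'"
      using sr unfolding simple_rep_def by auto
    let ?A = "(\<Union>i\<in>I. D i) \<union> (\<Union>i<n. D' i)"
    have "?A \<in> rel_compact_borel" using I D' by (intro rel_compact_borel_Un rel_compact_borel_UN) auto
    moreover have "norm (rep_fun {..<n} D' V' t - ?Z t) \<le> 0" for t using D'(2) by (simp add: fun_eq_iff)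
    ultimately have "norm (pair_rep {..<n} D' V' - pair_rep I D V) \<le> pairing_const ?A * 0"
      using I D' by (intro norm_pair_rep_diff_le) (auto intro!: sum.neutral)
    then show ?thesis using U by simp
  qed
  obtain n D' V' where "simple_rep n D' V' ?Z"
    using simple_mapping_rep_fun[where D=D and V=V, OF I] unfolding simple_mapping_def by blast
  then obtain U where U: "\<exists>n D' V'. simple_rep n D' V' ?Z \<and> U = (\<Sum>i<n. op_tensor ten (V' i) (meixner_op \<sigma> lam \<eta> J (indicat_real (D' i))))"
    by blast
  show ?thesis
    unfolding simple_pairing_def
    by (rule the_equality, fact U[unfolded uniq[OF U]], erule uniq)
qed

end

section \<open>Simple mappings and their uniform limits\<close>

lemma simple_function_support:
  assumes "simple_function borel S"
  shows "{t. S t \<noteq> 0} \<in> sets borel"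
proof -
  have "S -` (- {0}) \<inter> space borel \<in> sets borel"
    by (rule measurable_sets[OF measurable_simple_function[OF assms]]) simp
  moreover have "S -` (- {0}) \<inter> space borel = {t. S t \<noteq> 0}" by auto
  ultimately show ?thesis by simp
qed

text \<open>The level sets of the non-zero values give a canonical representation. This form makes
  closure under pointwise operations a matter of simple functions and supports.\<close>

lemma simple_mapping_iff:
  "simple_mapping Z \<longleftrightarrow> simple_function borel Z \<and> {t. Z t \<noteq> 0} \<in> rel_compact_borel"
proof
  assume "simple_mapping Z"
  then obtain n D V where D: "\<And>i. i \<in> {..<n} \<Longrightarrow> D i \<in> rel_compact_borel"
    and Z: "Z = (\<lambda>t. \<Sum>i<n::nat. indicat_real (D i) t *\<^sub>R V i)"
    unfolding simple_mapping_def simple_rep_def by blast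
  have sf: "simple_function borel Z"
    unfolding Z
  proof (intro simple_function_sum)
    fix i assume "i \<in> {..<n}"
    then have "simple_function borel (indicat_real (D i))"
      using rel_compact_borelD[OF D] by (intro simple_function_indicator) auto
    then show "simple_function borel (\<lambda>t. indicat_real (D i) t *\<^sub>R V i)"
      by (rule simple_function_compose1)
  qed
  moreover have "{t. Z t \<noteq> 0} \<in> sets borel" by (rule simple_function_support[OF sf])
  moreover have "{t. Z t \<noteq> 0} \<subseteq> (\<Union>i<n. D i)"
    unfolding Z by (auto simp: indicator_def elim!: sum.not_neutral_contains_not_neutral split: if_splits)
  ultimately show "simple_function borel Z \<and> {t. Z t \<noteq> 0} \<in> rel_compact_borel"
    using rel_compact_borel_subset[OF rel_compact_borel_UN[of "{..<n}" D]] D by auto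
next
  assume Z: "simple_function borel Z \<and> {t. Z t \<noteq> 0} \<in> rel_compact_borel"
  let ?I = "range Z - {0}" and ?D = "\<lambda>v. Z -` {v}"
  have fin: "finite ?I" using Z by (simp add: simple_function_def)
  have D: "?D v \<in> rel_compact_borel" if "v \<in> ?I" for v
  proof (rule rel_compact_borel_subset[of "{t. Z t \<noteq> 0}"])
    show "?D v \<in> sets borel" using Z that by (auto simp: simple_function_def)
  qed (use Z that in auto)
  have "Z t = (\<Sum>v\<in>?I. indicat_real (?D v) t *\<^sub>R v)" for t
  proof -
    have "(\<Sum>v\<in>?I. indicat_real (?D v) t *\<^sub>R v) = (\<Sum>v\<in>?I. if v = Z t then v else 0)"
      by (intro sum.cong refl) (auto simp: indicator_def)
    then show ?thesis using fin by (simp add: sum.delta)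
  qed
  then have "Z = (\<lambda>t. \<Sum>v\<in>?I. indicat_real (?D v) t *\<^sub>R v)" by blast
  then show "simple_mapping Z" using simple_mapping_rep_fun[where D="?D" and V="\<lambda>v. v", OF fin D] by simp
qed

lemma simple_mapping_compose2:
  assumes S: "simple_mapping S" "simple_mapping S'" and h: "h 0 0 = 0"
  shows "simple_mapping (\<lambda>t. h (S t) (S' t))"
  unfolding simple_mapping_iff
proof
  have sf: "simple_function borel S" "simple_function borel S'" using S by (auto simp: simple_mapping_iff)
  then show sh: "simple_function borel (\<lambda>t. h (S t) (S' t))" by (rule simple_function_compose2)
  have "{t. h (S t) (S' t) \<noteq> 0} \<subseteq> {t. S t \<noteq> 0} \<union> {t. S' t \<noteq> 0}" using h by auto
  moreover have "{t. h (S t) (S' t) \<noteq> 0} \<in> sets borel" by (rule simple_function_support[OF sh])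
  ultimately show "{t. h (S t) (S' t) \<noteq> 0} \<in> rel_compact_borel"
    using S rel_compact_borel_subset[OF rel_compact_borel_Un, of "{t. S t \<noteq> 0}" "{t. S' t \<noteq> 0}"]
    by (auto simp: simple_mapping_iff)
qed

lemma simple_mapping_scale:
  assumes S: "simple_mapping S" and g: "simple_function borel (g :: _ \<Rightarrow> real)"
  shows "simple_mapping (\<lambda>t. g t *\<^sub>R S t)"
  unfolding simple_mapping_iff
proof
  have sf: "simple_function borel S" using S by (auto simp: simple_mapping_iff)
  then show sh: "simple_function borel (\<lambda>t. g t *\<^sub>R S t)" by (rule simple_function_compose2[OF g])
  have "{t. g t *\<^sub>R S t \<noteq> 0} \<in> sets borel" by (rule simple_function_support[OF sh])
  then show "{t. g t *\<^sub>R S t \<noteq> 0} \<in> rel_compact_borel"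
    using S rel_compact_borel_subset[of "{t. S t \<noteq> 0}" "{t. g t *\<^sub>R S t \<noteq> 0}"] by (auto simp: simple_mapping_iff)
qed

lemma simple_mapping_restrict:
  assumes "simple_mapping S" "A \<in> sets borel"
  shows "simple_mapping (\<lambda>t. indicat_real A t *\<^sub>R S t)"
  using assms by (intro simple_mapping_scale simple_function_indicator) auto

lemma simple_mapping_0: "simple_mapping (\<lambda>t. 0)"
  by (simp add: simple_mapping_iff rel_compact_borel_def)

text \<open>Uniform approximability with the set \<open>A\<close> held fixed, since the norm
  constants depend on \<open>A\<close>. The epsilon form makes closure properties easier to prove
  than a form with sequences.\<close>

definition test_on :: "'t::topological_space set \<Rightarrow> ('t \<Rightarrow> 'g::real_normed_vector \<Rightarrow>\<^sub>L 'g) \<Rightarrow> bool" where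
  "test_on A Z \<longleftrightarrow> (\<forall>t. t \<notin> A \<longrightarrow> Z t = 0) \<and>
     (\<forall>e>0. \<exists>S. simple_mapping S \<and> (\<forall>t. t \<notin> A \<longrightarrow> S t = 0) \<and> (\<forall>t. norm (Z t - S t) \<le> e))"

lemma test_onI:
  assumes "\<And>t. t \<notin> A \<Longrightarrow> Z t = 0"
    and "\<And>e. e > 0 \<Longrightarrow> \<exists>S. simple_mapping S \<and> (\<forall>t. t \<notin> A \<longrightarrow> S t = 0) \<and> (\<forall>t. norm (Z t - S t) \<le> e)"
  shows "test_on A Z"
  using assms unfolding test_on_def by blast

lemma test_onD:
  "test_on A Z \<Longrightarrow> e > 0 \<Longrightarrow> \<exists>S. simple_mapping S \<and> (\<forall>t. t \<notin> A \<longrightarrow> S t = 0) \<and> (\<forall>t. norm (Z t - S t) \<le> e)"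
  unfolding test_on_def by simp

lemma test_on_outside: "test_on A Z \<Longrightarrow> t \<notin> A \<Longrightarrow> Z t = 0"
  unfolding test_on_def by blast

lemma simple_mapping_bounded:
  assumes "simple_mapping S"
  shows "\<exists>c. \<forall>t. norm (S t) \<le> c"
proof -
  have "finite (range S)" using assms unfolding simple_mapping_iff simple_function_def by simp
  then have "norm (S t) \<le> Max (norm ` range S)" for t by (intro Max_ge) auto
  then show ?thesis by blast
qed

lemma test_on_bounded:
  assumes "test_on A Z"
  shows "\<exists>c>0. \<forall>t. norm (Z t) \<le> c"
proof -
  obtain S where S: "simple_mapping S" "\<And>t. norm (Z t - S t) \<le> 1" using test_onD[OF assms zero_less_one] by blast
  obtain c where c: "\<And>t. norm (S t) \<le> c" using simple_mapping_bounded[OF S(1)] by blast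
  have "norm (Z t) \<le> \<bar>c\<bar> + 1" for t using norm_triangle_sub[of "Z t" "S t"] S(2)[of t] c[of t] by linarith
  then show ?thesis by (intro exI[of _ "\<bar>c\<bar> + 1"]) auto
qed

lemma simple_approx_imp_test_on:
  assumes "simple_approx A S Z"
  shows "test_on A Z"
proof (rule test_onI)
  have S: "simple_mapping (S n)" "t \<notin> A \<Longrightarrow> S n t = 0" for n t using assms by (auto simp: simple_approx_def)
  have u: "uniform_limit UNIV S Z sequentially" using assms by (simp add: simple_approx_def)
  show "Z t = 0" if "t \<notin> A" for t
  proof -
    have "(\<lambda>n. S n t) \<longlonglongrightarrow> Z t" by (rule tendsto_uniform_limitI[OF u]) simp
    then show ?thesis using S(2)[OF that] by (simp add: LIMSEQ_const_iff)
  qed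
  fix e :: real assume "e > 0"
  then have "\<forall>\<^sub>F n in sequentially. \<forall>t\<in>UNIV. dist (S n t) (Z t) < e" by (rule uniform_limitD[OF u])
  then obtain n where "\<forall>t. dist (S n t) (Z t) < e" by (auto simp: eventually_sequentially)
  then have "norm (Z t - S n t) \<le> e" for t by (metis dist_norm dist_commute less_imp_le)
  then show "\<exists>S. simple_mapping S \<and> (\<forall>t. t \<notin> A \<longrightarrow> S t = 0) \<and> (\<forall>t. norm (Z t - S t) \<le> e)" using S by blast
qed

lemma test_on_imp_simple_approx:
  assumes "test_on A Z"
  obtains S where "simple_approx A S Z"
proof -
  have "\<forall>n. \<exists>S. simple_mapping S \<and> (\<forall>t. t \<notin> A \<longrightarrow> S t = 0) \<and> (\<forall>t. norm (Z t - S t) \<le> inverse (real (Suc n)))"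
    using assms unfolding test_on_def by simp
  then obtain S where S: "\<And>n. simple_mapping (S n)" "\<And>n t. t \<notin> A \<Longrightarrow> S n t = 0"
    "\<And>n t. norm (Z t - S n t) \<le> inverse (real (Suc n))" by metis
  have "uniform_limit UNIV S Z sequentially"
  proof (rule uniform_limitI)
    fix e :: real assume "e > 0"
    then have "\<forall>\<^sub>F n in sequentially. inverse (real (Suc n)) < e"
      using LIMSEQ_inverse_real_of_nat by (rule order_tendstoD(2)[rotated])
    then show "\<forall>\<^sub>F n in sequentially. \<forall>t\<in>UNIV. dist (S n t) (Z t) < e"
      by eventually_elim (use S(3) in \<open>auto simp: dist_norm norm_minus_commute intro: le_less_trans\<close>)
  qed
  then show ?thesis using S that[of S] by (simp add: simple_approx_def)
qed

text \<open>The given approximants may live on a larger set than the support; cutting them off by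
  the indicator of \<open>A\<close> does not increase the error.\<close>

lemma test_on_supp:
  assumes Z: "Z \<in> op_test_functions" "op_supp Z \<subseteq> A" and A: "A \<in> rel_compact_borel"
  shows "test_on A Z"
proof (rule test_onI)
  obtain B S where "simple_approx B S Z" using Z(1) unfolding op_test_functions_def by blast
  then have B: "test_on B Z" by (rule simple_approx_imp_test_on)
  show out: "Z t = 0" if "t \<notin> A" for t using Z(2) that by (auto simp: op_supp_def)
  fix e :: real assume "e > 0"
  from test_onD[OF B this] obtain S where S: "simple_mapping S" "\<And>t. norm (Z t - S t) \<le> e" by blast
  have "norm (Z t - indicat_real A t *\<^sub>R S t) \<le> e" for t
    using S(2)[of t] out[of t] \<open>e > 0\<close> by (cases "t \<in> A") auto
  then show "\<exists>S. simple_mapping S \<and> (\<forall>t. t \<notin> A \<longrightarrow> S t = 0) \<and> (\<forall>t. norm (Z t - S t) \<le> e)"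
    using simple_mapping_restrict[OF S(1) rel_compact_borelD[OF A]]
    by (intro exI[of _ "\<lambda>t. indicat_real A t *\<^sub>R S t"]) auto
qed

text \<open>Allows products and scalar multiples to be approximated one factor at a time, with an
  intermediate test function that is not yet simple.\<close>

lemma test_on_uniform_limit:
  assumes "\<And>e. e > 0 \<Longrightarrow> \<exists>Y. test_on A Y \<and> (\<forall>t. norm (Z t - Y t) \<le> e)"
  shows "test_on A Z"
proof (rule test_onI)
  show "Z t = 0" if "t \<notin> A" for t
  proof -
    have "norm (Z t) \<le> 0 + e" if e: "e > 0" for e
    proof -
      obtain Y where "test_on A Y" "norm (Z t - Y t) \<le> e" using assms[OF e] by blast
      then show ?thesis using test_on_outside[OF _ \<open>t \<notin> A\<close>, of Y] by simp
    qed
    then have "norm (Z t) \<le> 0" by (rule field_le_epsilon)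
    then show ?thesis by simp
  qed
  fix e :: real assume "e > 0"
  then obtain Y where Y: "test_on A Y" "\<And>t. norm (Z t - Y t) \<le> e / 2" using assms[OF half_gt_zero] by blast
  obtain S where S: "simple_mapping S" "\<And>t. t \<notin> A \<Longrightarrow> S t = 0" "\<And>t. norm (Y t - S t) \<le> e / 2"
    using test_onD[OF Y(1) half_gt_zero[OF \<open>e > 0\<close>]] by blast
  have "norm (Z t - S t) \<le> e" for t
    using norm_triangle_ineq[of "Z t - Y t" "Y t - S t"] Y(2)[of t] S(3)[of t] by simp
  then show "\<exists>S. simple_mapping S \<and> (\<forall>t. t \<notin> A \<longrightarrow> S t = 0) \<and> (\<forall>t. norm (Z t - S t) \<le> e)" using S by blast
qed

lemma test_on_zero: "test_on A (\<lambda>t. 0)"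
proof (rule test_onI)
  fix e :: real assume "e > 0"
  then show "\<exists>S. simple_mapping S \<and> (\<forall>t. t \<notin> A \<longrightarrow> S t = (0 :: 'b \<Rightarrow>\<^sub>L 'b)) \<and> (\<forall>t. norm (0 - S t) \<le> e)"
    using simple_mapping_0 by (intro exI[of _ "\<lambda>_. 0"]) auto
qed simp

lemma test_on_lincomb:
  assumes "test_on A Y" "test_on A Z"
  shows "test_on A (\<lambda>t. a *\<^sub>R Y t + b *\<^sub>R Z t)"
proof (rule test_onI)
  show "a *\<^sub>R Y t + b *\<^sub>R Z t = 0" if "t \<notin> A" for t using test_on_outside[OF assms(1) that] test_on_outside[OF assms(2) that] by simp
  fix e :: real assume e: "e > 0"
  define d where "d = e / (\<bar>a\<bar> + \<bar>b\<bar> + 1)"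
  have d: "d > 0" using e by (simp add: d_def)
  obtain S where S: "simple_mapping S" "\<And>t. t \<notin> A \<Longrightarrow> S t = 0" "\<And>t. norm (Y t - S t) \<le> d"
    using test_onD[OF assms(1) d] by blast
  obtain R where R: "simple_mapping R" "\<And>t. t \<notin> A \<Longrightarrow> R t = 0" "\<And>t. norm (Z t - R t) \<le> d"
    using test_onD[OF assms(2) d] by blast
  have "norm (a *\<^sub>R Y t + b *\<^sub>R Z t - (a *\<^sub>R S t + b *\<^sub>R R t)) \<le> e" for t
  proof -
    have "a *\<^sub>R Y t + b *\<^sub>R Z t - (a *\<^sub>R S t + b *\<^sub>R R t) = a *\<^sub>R (Y t - S t) + b *\<^sub>R (Z t - R t)"
      by (simp add: algebra_simps)
    also have "norm (a *\<^sub>R (Y t - S t) + b *\<^sub>R (Z t - R t)) \<le> \<bar>a\<bar> * d + \<bar>b\<bar> * d"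
      using S(3)[of t] R(3)[of t] by (intro norm_triangle_le add_mono) (auto simp: mult_left_mono)
    also have "\<dots> \<le> (\<bar>a\<bar> + \<bar>b\<bar> + 1) * d" using d by (simp add: algebra_simps)
    also have "\<dots> = e" by (simp add: d_def add_nonneg_pos)
    finally show ?thesis .
  qed
  moreover have "simple_mapping (\<lambda>t. a *\<^sub>R S t + b *\<^sub>R R t)"
    by (rule simple_mapping_compose2[OF S(1) R(1), of "\<lambda>x y. a *\<^sub>R x + b *\<^sub>R y"]) simp
  ultimately show "\<exists>S. simple_mapping S \<and> (\<forall>t. t \<notin> A \<longrightarrow> S t = 0) \<and> (\<forall>t. norm (a *\<^sub>R Y t + b *\<^sub>R Z t - S t) \<le> e)"
    using S(2) R(2) by (intro exI[of _ "\<lambda>t. a *\<^sub>R S t + b *\<^sub>R R t"]) auto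
qed

text \<open>First the right factor is replaced by a simple mapping, using that \<open>Y\<close> is
  bounded; then the left factor, using the bound of that fixed simple mapping.\<close>

lemma test_on_compose:
  assumes Y: "test_on A Y" and Z: "test_on A Z"
  shows "test_on A (\<lambda>t. Y t o\<^sub>L Z t)"
proof (rule test_on_uniform_limit)
  fix e :: real assume e: "e > 0"
  obtain c where c: "0 < c" "\<And>t. norm (Y t) \<le> c" using test_on_bounded[OF Y] by blast
  obtain R where R: "simple_mapping R" "\<And>t. t \<notin> A \<Longrightarrow> R t = 0" "\<And>t. norm (Z t - R t) \<le> e / c"
    using test_onD[OF Z divide_pos_pos[OF e c(1)]] by blast
  have 1: "norm ((Y t o\<^sub>L Z t) - (Y t o\<^sub>L R t)) \<le> e" for t
  proof -
    have "norm (Y t o\<^sub>L (Z t - R t)) \<le> norm (Y t) * norm (Z t - R t)" by (rule norm_blinfun_compose)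
    also have "\<dots> \<le> c * (e / c)" using c R(3)[of t] by (intro mult_mono) auto
    finally show ?thesis using c by (simp add: blinfun_compose_simps)
  qed
  have "test_on A (\<lambda>t. Y t o\<^sub>L R t)"
  proof (rule test_onI)
    show "Y t o\<^sub>L R t = 0" if "t \<notin> A" for t using R(2)[OF that] by simp
    fix e :: real assume e: "e > 0"
    obtain d where d: "\<And>t. norm (R t) \<le> d" using simple_mapping_bounded[OF R(1)] by blast
    have d0: "0 \<le> d" using d[of undefined] norm_ge_zero order_trans by blast
    obtain S where S: "simple_mapping S" "\<And>t. norm (Y t - S t) \<le> e / (d + 1)"
      using test_onD[OF Y divide_pos_pos[OF e, of "d + 1"]] d0 by fastforce
    have "norm ((Y t o\<^sub>L R t) - (S t o\<^sub>L R t)) \<le> e" for t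
    proof -
      have "norm ((Y t - S t) o\<^sub>L R t) \<le> norm (Y t - S t) * norm (R t)" by (rule norm_blinfun_compose)
      also have "\<dots> \<le> e / (d + 1) * (d + 1)" using d[of t] d0 S(2)[of t] e by (intro mult_mono) auto
      finally show ?thesis using d0 by (simp add: blinfun_compose_simps)
    qed
    moreover have "simple_mapping (\<lambda>t. S t o\<^sub>L R t)"
      by (rule simple_mapping_compose2[OF S(1) R(1)]) simp
    ultimately show "\<exists>S. simple_mapping S \<and> (\<forall>t. t \<notin> A \<longrightarrow> S t = 0) \<and> (\<forall>t. norm ((Y t o\<^sub>L R t) - S t) \<le> e)"
      using R(2) by (intro exI[of _ "\<lambda>t. S t o\<^sub>L R t"]) auto
  qed
  with 1 show "\<exists>X. test_on A X \<and> (\<forall>t. norm ((Y t o\<^sub>L Z t) - X t) \<le> e)" by blast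
qed

text \<open>The scalar function is rounded down to a grid of width e / d, where \<open>d\<close>
  bounds the norm of \<open>Z\<close>, which makes an error of at most \<open>e\<close> after
  scaling.\<close>

lemma test_on_scale:
  assumes Z: "test_on A Z" and A: "A \<in> sets borel"
    and g: "g \<in> borel_measurable borel" "\<And>t. t \<in> A \<Longrightarrow> \<bar>g t\<bar> \<le> c"
  shows "test_on A (\<lambda>t. g t *\<^sub>R Z t)"
proof (rule test_on_uniform_limit)
  fix e :: real assume e: "e > 0"
  obtain d where d: "0 < d" "\<And>t. norm (Z t) \<le> d" using test_on_bounded[OF Z] by blast
  define k where "k = e / d"
  have k: "k > 0" using e d by (simp add: k_def)
  \<comment> \<open>The bound on \<open>g\<close> is known only on \<open>A\<close>; the indicator
    makes the rounded function take finitely many values everywhere.\<close>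
  define q where "q t = k * real_of_int \<lfloor>indicat_real A t * g t / k\<rfloor>" for t
  have q: "\<bar>g t - q t\<bar> \<le> k" if "t \<in> A" for t
  proof -
    have "real_of_int \<lfloor>g t / k\<rfloor> \<le> g t / k" "g t / k < real_of_int \<lfloor>g t / k\<rfloor> + 1" by linarith+
    then have "k * real_of_int \<lfloor>g t / k\<rfloor> \<le> k * (g t / k)" "k * (g t / k) \<le> k * (real_of_int \<lfloor>g t / k\<rfloor> + 1)"
      using k by (simp_all add: mult_left_mono del: times_divide_eq_right)
    then have "k * real_of_int \<lfloor>g t / k\<rfloor> \<le> g t" "g t \<le> k * real_of_int \<lfloor>g t / k\<rfloor> + k"
      using k by (simp_all add: distrib_left)
    then show ?thesis using that by (simp add: q_def)
  qed
  have "simple_function borel q"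
  proof -
    have "(\<lambda>t. \<lfloor>indicat_real A t * g t / k\<rfloor>) \<in> measurable borel (count_space UNIV)"
      using A g(1) by measurable
    moreover have "(\<lambda>t. \<lfloor>indicat_real A t * g t / k\<rfloor>) ` space borel \<subseteq> {- \<lceil>\<bar>c\<bar> / k\<rceil> - 1 .. \<lceil>\<bar>c\<bar> / k\<rceil>}"
    proof (rule image_subsetI)
      fix t
      have "\<bar>indicat_real A t * g t\<bar> \<le> \<bar>c\<bar>" using g(2)[of t] by (cases "t \<in> A") auto
      from divide_right_mono[OF this less_imp_le[OF k]]
      have "\<bar>indicat_real A t * g t / k\<bar> \<le> \<bar>c\<bar> / k" by (simp only: abs_divide abs_of_pos[OF k])
      then show "\<lfloor>indicat_real A t * g t / k\<rfloor> \<in> {- \<lceil>\<bar>c\<bar> / k\<rceil> - 1 .. \<lceil>\<bar>c\<bar> / k\<rceil>}"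
        unfolding atLeastAtMost_iff by linarith
    qed
    then have "finite ((\<lambda>t. \<lfloor>indicat_real A t * g t / k\<rfloor>) ` space borel)" by (rule finite_subset) simp
    ultimately have "simple_function borel (\<lambda>t. \<lfloor>indicat_real A t * g t / k\<rfloor>)"
      by (simp add: simple_function_eq_measurable)
    then show ?thesis unfolding q_def by (rule simple_function_compose1)
  qed
  then have qs: "simple_function borel q" .
  have 1: "norm (g t *\<^sub>R Z t - q t *\<^sub>R Z t) \<le> e" for t
  proof (cases "t \<in> A")
    case True
    have "norm (g t *\<^sub>R Z t - q t *\<^sub>R Z t) = \<bar>g t - q t\<bar> * norm (Z t)"
      by (simp add: scaleR_diff_left[symmetric])
    also have "\<dots> \<le> k * d" using q[OF True] d k by (intro mult_mono) auto
    finally show ?thesis using d by (simp add: k_def)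
  qed (use test_on_outside[OF Z] e in simp)
  have "test_on A (\<lambda>t. q t *\<^sub>R Z t)"
  proof (rule test_onI)
    show "q t *\<^sub>R Z t = 0" if "t \<notin> A" for t using test_on_outside[OF Z that] by simp
    fix e :: real assume e: "e > 0"
    have "finite (range q)" using qs by (simp add: simple_function_def)
    then obtain b where b: "\<And>t. \<bar>q t\<bar> \<le> b"
      using finite_imp_bounded[of "range q"] by (auto simp: bounded_iff)
    have b0: "0 \<le> b" using b[of undefined] by linarith
    obtain S where S: "simple_mapping S" "\<And>t. t \<notin> A \<Longrightarrow> S t = 0" "\<And>t. norm (Z t - S t) \<le> e / (b + 1)"
      using test_onD[OF Z divide_pos_pos[OF e, of "b + 1"]] b0 by fastforce
    have "norm (q t *\<^sub>R Z t - q t *\<^sub>R S t) \<le> e" for t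
    proof -
      have "norm (q t *\<^sub>R Z t - q t *\<^sub>R S t) = \<bar>q t\<bar> * norm (Z t - S t)"
        by (simp add: scaleR_diff_right[symmetric])
      also have "\<dots> \<le> (b + 1) * (e / (b + 1))" using b[of t] b0 S(3)[of t] by (intro mult_mono) auto
      finally show ?thesis using b0 by simp
    qed
    then show "\<exists>S. simple_mapping S \<and> (\<forall>t. t \<notin> A \<longrightarrow> S t = 0) \<and> (\<forall>t. norm (q t *\<^sub>R Z t - S t) \<le> e)"
      using simple_mapping_scale[OF S(1) qs] S(2) by (intro exI[of _ "\<lambda>t. q t *\<^sub>R S t"]) auto
  qed
  with 1 show "\<exists>Y. test_on A Y \<and> (\<forall>t. norm (g t *\<^sub>R Z t - Y t) \<le> e)" by blast
qed

section \<open>The integral of operator-valued functions\<close>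

text \<open>Measurability of a difference is not automatic in a space of values without a countable
  base. A simple function has finitely many values, so on each of finitely many pieces only a
  constant is subtracted.\<close>

lemma borel_measurable_diff_simple:
  fixes f :: "'a \<Rightarrow> 'b::real_normed_vector"
  assumes "f \<in> borel_measurable M" "simple_function M s"
  shows "(\<lambda>x. f x - s x) \<in> borel_measurable M"
proof (rule measurable_compose_countable'[where f="\<lambda>i x. f x - i" and g=s and I="s ` space M"])
  show "(\<lambda>x. f x - i) \<in> borel_measurable M" for i
    by (rule measurable_compose[OF assms(1)]) (intro borel_measurable_continuous_onI continuous_intros)
  show "s \<in> M \<rightarrow>\<^sub>M count_space (s ` space M)"
    using assms(2) by (subst measurable_count_space_eq2) (auto simp: simple_function_def)
  show "countable (s ` space M)" using assms(2) by (simp add: simple_function_def countable_finite)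
qed

text \<open>For approximating sequences \<open>s\<close> and \<open>r\<close> the distance of the
  simple integrals is at most the sum of both L^1 errors, so the limits agree.\<close>

lemma has_op_integral_unique:
  assumes "has_op_integral M f x" "has_op_integral M f y"
  shows "x = y"
proof -
  obtain s r where f: "f \<in> borel_measurable M"
    and s: "\<And>i. Bochner_Integration.simple_bochner_integrable M (s i)"
      "(\<lambda>i. \<integral>\<^sup>+t. ennreal (norm (f t - s i t)) \<partial>M) \<longlonglongrightarrow> 0" "(\<lambda>i. Bochner_Integration.simple_bochner_integral M (s i)) \<longlonglongrightarrow> x"
    and r: "\<And>i. Bochner_Integration.simple_bochner_integrable M (r i)"
      "(\<lambda>i. \<integral>\<^sup>+t. ennreal (norm (f t - r i t)) \<partial>M) \<longlonglongrightarrow> 0" "(\<lambda>i. Bochner_Integration.simple_bochner_integral M (r i)) \<longlonglongrightarrow> y"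
    using assms unfolding has_op_integral_def by blast
  let ?I = "Bochner_Integration.simple_bochner_integral M"
  have m: "(\<lambda>t. ennreal (norm (f t - u t))) \<in> borel_measurable M"
    if "Bochner_Integration.simple_bochner_integrable M u" for u
  proof -
    have "simple_function M u" using that by (rule Bochner_Integration.simple_bochner_integrable.cases) simp
    from borel_measurable_diff_simple[OF f this]
    have "(\<lambda>t. norm (f t - u t)) \<in> borel_measurable M"
      by (rule measurable_compose[OF _ borel_measurable_norm])
    then show ?thesis by (rule measurable_compose[OF _ measurable_ennreal])
  qed
  have le: "ennreal (norm (?I (s i) - ?I (r i))) \<le>
      (\<integral>\<^sup>+t. ennreal (norm (f t - s i t)) \<partial>M) + (\<integral>\<^sup>+t. ennreal (norm (f t - r i t)) \<partial>M)" for i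
  proof -
    have d: "Bochner_Integration.simple_bochner_integrable M (\<lambda>t. s i t - r i t)"
      by (rule Bochner_Integration.simple_bochner_integrable_compose2[where p="(-)", OF _ s(1) r(1)]) simp
    have "ennreal (norm (?I (s i) - ?I (r i))) = ennreal (norm (?I (\<lambda>t. s i t - r i t)))"
      by (simp add: Bochner_Integration.simple_bochner_integral_diff s(1) r(1))
    also have "\<dots> \<le> ennreal (Bochner_Integration.simple_bochner_integral M (\<lambda>t. norm (s i t - r i t)))"
      by (intro ennreal_leI Bochner_Integration.simple_bochner_integral_norm_bound d)
    also have "\<dots> = (\<integral>\<^sup>+t. ennreal (norm (s i t - r i t)) \<partial>M)"
      using Bochner_Integration.simple_bochner_integrable_compose2[of "\<lambda>x y. norm (x - y)", OF _ s(1) r(1)]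
      by (intro Bochner_Integration.simple_bochner_integral_eq_nn_integral) auto
    also have "\<dots> \<le> (\<integral>\<^sup>+t. ennreal (norm (f t - s i t)) + ennreal (norm (f t - r i t)) \<partial>M)"
    proof (rule nn_integral_mono)
      fix t
      have "norm (s i t - r i t) \<le> norm (f t - s i t) + norm (f t - r i t)"
        using norm_triangle_ineq4[of "f t - r i t" "f t - s i t"] by simp
      then show "ennreal (norm (s i t - r i t)) \<le> ennreal (norm (f t - s i t)) + ennreal (norm (f t - r i t))"
        by (simp flip: ennreal_plus add: ennreal_leI)
    qed
    also have "\<dots> = (\<integral>\<^sup>+t. ennreal (norm (f t - s i t)) \<partial>M) + (\<integral>\<^sup>+t. ennreal (norm (f t - r i t)) \<partial>M)"
      by (intro nn_integral_add m s r)
    finally show ?thesis .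
  qed
  have "(\<lambda>i. ennreal (norm (?I (s i) - ?I (r i)))) \<longlonglongrightarrow> 0"
  proof (rule tendsto_sandwich[OF _ _ tendsto_const])
    show "\<forall>\<^sub>F i in sequentially. ennreal (norm (?I (s i) - ?I (r i))) \<le>
      (\<integral>\<^sup>+t. ennreal (norm (f t - s i t)) \<partial>M) + (\<integral>\<^sup>+t. ennreal (norm (f t - r i t)) \<partial>M)"
      using le by simp
    show "(\<lambda>i. (\<integral>\<^sup>+t. ennreal (norm (f t - s i t)) \<partial>M) + (\<integral>\<^sup>+t. ennreal (norm (f t - r i t)) \<partial>M)) \<longlonglongrightarrow> 0"
      using tendsto_add[OF s(2) r(2)] by simp
  qed simp
  then have "(\<lambda>i. norm (?I (s i) - ?I (r i))) \<longlonglongrightarrow> 0" by (simp flip: ennreal_0)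
  moreover have "(\<lambda>i. norm (?I (s i) - ?I (r i))) \<longlonglongrightarrow> norm (x - y)"
    by (intro tendsto_norm tendsto_diff s r)
  ultimately have "norm (x - y) = 0" using LIMSEQ_unique by blast
  then show ?thesis by simp
qed

lemma op_integral_eq: "has_op_integral M f x \<Longrightarrow> op_integral M f = x"
  unfolding op_integral_def using has_op_integral_unique by (intro the_equality) auto

section \<open>Extension from simple mappings to test functions\<close>

lemma simple_approx_eventually:
  assumes "simple_approx A S Z" "e > 0"
  shows "\<forall>\<^sub>F n in sequentially. \<forall>t. norm (S n t - Z t) \<le> e"
proof -
  have "\<forall>\<^sub>F n in sequentially. \<forall>t\<in>UNIV. dist (S n t) (Z t) < e"
    using assms unfolding simple_approx_def by (blast intro: uniform_limitD)
  then show ?thesis by eventually_elim (auto simp: dist_norm intro: less_imp_le)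
qed

lemma simple_approx_mono: "simple_approx A S Z \<Longrightarrow> A \<subseteq> B \<Longrightarrow> simple_approx B S Z"
  unfolding simple_approx_def by blast

lemma simple_approx_lincomb:
  assumes "simple_approx A S Y" "simple_approx A R Z"
  shows "simple_approx A (\<lambda>n t. a *\<^sub>R S n t + b *\<^sub>R R n t) (\<lambda>t. a *\<^sub>R Y t + b *\<^sub>R Z t)"
proof -
  have S: "simple_mapping (S n)" "t \<notin> A \<Longrightarrow> S n t = 0" "uniform_limit UNIV S Y sequentially" for n t
    using assms(1) by (auto simp: simple_approx_def)
  have R: "simple_mapping (R n)" "t \<notin> A \<Longrightarrow> R n t = 0" "uniform_limit UNIV R Z sequentially" for n t
    using assms(2) by (auto simp: simple_approx_def)
  have "simple_mapping (\<lambda>t. a *\<^sub>R S n t + b *\<^sub>R R n t)" for n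
    by (rule simple_mapping_compose2[OF S(1) R(1), where h="\<lambda>x y. a *\<^sub>R x + b *\<^sub>R y"]) simp
  moreover have "uniform_limit UNIV (\<lambda>n t. a *\<^sub>R S n t + b *\<^sub>R R n t) (\<lambda>t. a *\<^sub>R Y t + b *\<^sub>R Z t) sequentially"
    by (intro uniform_limit_add bounded_linear.uniform_limit[OF bounded_linear_scaleR_right] S(3) R(3))
  ultimately show ?thesis using S(2) R(2) by (simp add: simple_approx_def)
qed

text \<open>The common core of pairing and integral: a Lipschitz map on simple mappings vanishing
  off \<open>A\<close> extends uniquely to uniform limits, with the same constant. Both uses have
  such an estimate for differences, so linearity is not part of the interface.\<close>

locale simple_functional =
  fixes A :: "'t::topological_space set" and L :: "('t \<Rightarrow> 'g::real_normed_vector \<Rightarrow>\<^sub>L 'g) \<Rightarrow> 'c::banach" and K :: real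
  assumes K: "0 \<le> K"
    and diff_le: "simple_mapping S \<Longrightarrow> (\<And>t. t \<notin> A \<Longrightarrow> S t = 0) \<Longrightarrow> simple_mapping R \<Longrightarrow> (\<And>t. t \<notin> A \<Longrightarrow> R t = 0) \<Longrightarrow>
      (\<And>t. norm (S t - R t) \<le> c) \<Longrightarrow> norm (L S - L R) \<le> K * c"
    and L0: "L (\<lambda>t. 0) = 0"
begin

lemma approx_diff_le:
  assumes "simple_approx A S Z" "simple_approx A R Z"
    and "\<And>t. norm (S m t - Z t) \<le> e" "\<And>t. norm (R n t - Z t) \<le> e"
  shows "norm (L (S m) - L (R n)) \<le> K * (2 * e)"
proof (rule diff_le)
  show "norm (S m t - R n t) \<le> 2 * e" for t
    using norm_triangle_ineq4[of "S m t - Z t" "R n t - Z t"] assms(3)[of t] assms(4)[of t] by simp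
qed (use assms(1,2) in \<open>auto simp: simple_approx_def\<close>)

lemma convergent:
  assumes S: "simple_approx A S Z"
  shows "\<exists>U. (\<lambda>n. L (S n)) \<longlonglongrightarrow> U"
proof -
  have "Cauchy (\<lambda>n. L (S n))"
  proof (rule CauchyI)
    fix e :: real assume e: "e > 0"
    \<comment> \<open>Two approximants within \<open>d\<close> of \<open>Z\<close> are within 2 d of
      each other; the added 1 keeps the denominator positive and the final inequality
      strict.\<close>
    define d where "d = e / (2 * K + 1)"
    have d: "d > 0" using e K by (simp add: d_def)
    obtain N where N: "\<And>n t. n \<ge> N \<Longrightarrow> norm (S n t - Z t) \<le> d"
      using simple_approx_eventually[OF S d] unfolding eventually_sequentially by blast
    have "norm (L (S m) - L (S n)) < e" if "m \<ge> N" "n \<ge> N" for m n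
    proof -
      have "norm (L (S m) - L (S n)) \<le> K * (2 * d)" using N that by (intro approx_diff_le[OF S S]) auto
      also have "\<dots> < (2 * K + 1) * d" using d by (simp add: algebra_simps)
      also have "\<dots> = e" using K by (simp add: d_def)
      finally show ?thesis .
    qed
    then show "\<exists>N. \<forall>m\<ge>N. \<forall>n\<ge>N. norm (L (S m) - L (S n)) < e" by blast
  qed
  then show ?thesis using Cauchy_convergent convergent_def by blast
qed

lemma limit_unique:
  assumes S: "simple_approx A S Z" "(\<lambda>n. L (S n)) \<longlonglongrightarrow> U"
    and R: "simple_approx A R Z" "(\<lambda>n. L (R n)) \<longlonglongrightarrow> U'"
  shows "U = U'"
proof -
  have "(\<lambda>n. L (S n) - L (R n)) \<longlonglongrightarrow> 0"
  proof (rule tendstoI)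
    fix e :: real assume e: "e > 0"
    define d where "d = e / (2 * K + 1)"
    have d: "d > 0" using e K by (simp add: d_def)
    show "\<forall>\<^sub>F n in sequentially. dist (L (S n) - L (R n)) 0 < e"
      using simple_approx_eventually[OF S(1) d] simple_approx_eventually[OF R(1) d]
    proof eventually_elim
      case (elim n)
      have "norm (L (S n) - L (R n)) \<le> K * (2 * d)" using elim by (intro approx_diff_le[OF S(1) R(1)]) auto
      also have "\<dots> < (2 * K + 1) * d" using d by (simp add: algebra_simps)
      also have "\<dots> = e" using K by (simp add: d_def)
      finally show ?case by (simp add: dist_norm)
    qed
  qed
  moreover have "(\<lambda>n. L (S n) - L (R n)) \<longlonglongrightarrow> U - U'" by (intro tendsto_diff S R)
  ultimately have "U - U' = 0" using LIMSEQ_unique by blast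
  then show ?thesis by simp
qed

lemma limit_bound:
  assumes S: "simple_approx A S Z" "(\<lambda>n. L (S n)) \<longlonglongrightarrow> U" and c: "\<And>t. norm (Z t) \<le> c"
  shows "norm U \<le> K * c"
proof (rule field_le_epsilon)
  fix e :: real assume e: "e > 0"
  define d where "d = e / (K + 1)"
  have d: "d > 0" using e K by (simp add: d_def)
  have "\<forall>\<^sub>F n in sequentially. norm (L (S n)) \<le> K * (c + d)"
    using simple_approx_eventually[OF S(1) d]
  proof eventually_elim
    case (elim n)
    \<comment> \<open>The bound on the norm is the Lipschitz estimate against the zero
      mapping.\<close>
    have "norm (L (S n) - L (\<lambda>t. 0)) \<le> K * (c + d)"
    proof (rule diff_le)
      show "norm (S n t - 0) \<le> c + d" for t
        using norm_triangle_ineq[of "S n t - Z t" "Z t"] elim[rule_format, of t] c[of t] by simp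
    qed (use S(1) simple_mapping_0 in \<open>auto simp: simple_approx_def\<close>)
    then show ?case by (simp add: L0)
  qed
  then have "norm U \<le> K * (c + d)"
    by (rule tendsto_upperbound[OF tendsto_norm[OF S(2)]]) simp
  also have "\<dots> \<le> K * c + (K + 1) * d" using d by (simp add: algebra_simps)
  also have "\<dots> = K * c + e" using K by (simp add: d_def)
  finally show "norm U \<le> K * c + e" .
qed

end

section \<open>Pairing and integral on test functions\<close>

context meixner
begin

abbreviation simple_W :: "('t \<Rightarrow> 'g \<Rightarrow>\<^sub>L 'g) \<Rightarrow> ('h \<Rightarrow>\<^sub>L 'h)" where
  "simple_W \<equiv> simple_pairing \<sigma> lam \<eta> J ten"

abbreviation W :: "('t \<Rightarrow> 'g \<Rightarrow>\<^sub>L 'g) \<Rightarrow> ('h \<Rightarrow>\<^sub>L 'h)" where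
  "W \<equiv> pairing \<sigma> lam \<eta> J ten"

lemma simple_W_lincomb:
  assumes "simple_mapping S" "simple_mapping R"
  shows "simple_W (\<lambda>t. a *\<^sub>R S t + b *\<^sub>R R t) = a *\<^sub>R simple_W S + b *\<^sub>R simple_W R"
proof -
  obtain n D V where S: "\<And>i. i \<in> {..<n} \<Longrightarrow> D i \<in> rel_compact_borel" "S = rep_fun {..<n::nat} D V"
    by (rule simple_mappingE[OF assms(1)], rule that)
  obtain m D' V' where R: "\<And>i. i \<in> {..<m} \<Longrightarrow> D' i \<in> rel_compact_borel" "R = rep_fun {..<m::nat} D' V'"
    by (rule simple_mappingE[OF assms(2)], rule that)
  let ?I = "{..<n} <+> {..<m}" and ?D = "case_sum D D'" and ?V = "case_sum (\<lambda>i. a *\<^sub>R V i) (\<lambda>i. b *\<^sub>R V' i)"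
  have "(\<lambda>t. a *\<^sub>R S t + b *\<^sub>R R t) = rep_fun ?I ?D ?V"
    unfolding S(2) R(2) by (rule ext, subst sum.Plus, simp, simp, simp only: scaleR_sum_right sum.case scaleR_scaleR mult.commute comp_def)
  moreover have "\<And>i. i \<in> ?I \<Longrightarrow> ?D i \<in> rel_compact_borel" using S(1) R(1) by auto
  ultimately have "simple_W (\<lambda>t. a *\<^sub>R S t + b *\<^sub>R R t) = pair_rep ?I ?D ?V"
    using simple_pairing_eq[of ?I ?D ?V] by simp
  also have "\<dots> = a *\<^sub>R pair_rep {..<n} D V + b *\<^sub>R pair_rep {..<m} D' V'"
    unfolding pair_rep_def by (subst sum.Plus) (simp_all add: op_tensor_linear scaleR_sum_right)
  also have "\<dots> = a *\<^sub>R simple_W S + b *\<^sub>R simple_W R"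
    using simple_pairing_eq[of "{..<n}" D V] simple_pairing_eq[of "{..<m}" D' V'] S R by simp
  finally show ?thesis .
qed

lemma simple_functional_W:
  assumes A: "A \<in> rel_compact_borel"
  shows "simple_functional A simple_W (pairing_const A)"
proof
  show "0 \<le> pairing_const A" by (simp add: pairing_const_def)
  fix S R :: "'t \<Rightarrow> 'g \<Rightarrow>\<^sub>L 'g" and c
  assume S: "simple_mapping S" and S0: "\<And>t. t \<notin> A \<Longrightarrow> S t = 0"
    and R: "simple_mapping R" and R0: "\<And>t. t \<notin> A \<Longrightarrow> R t = 0" and c: "\<And>t. norm (S t - R t) \<le> c"
  obtain n D V where 1: "\<And>i. i \<in> {..<n} \<Longrightarrow> D i \<in> rel_compact_borel" "S = rep_fun {..<n::nat} D V"
    by (rule simple_mappingE[OF S], rule that)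
  obtain m D' V' where 2: "\<And>i. i \<in> {..<m} \<Longrightarrow> D' i \<in> rel_compact_borel" "R = rep_fun {..<m::nat} D' V'"
    by (rule simple_mappingE[OF R], rule that)
  have "norm (pair_rep {..<n} D V - pair_rep {..<m} D' V') \<le> pairing_const A * c"
    by (rule norm_pair_rep_diff_le[OF A]) (use 1 2 S0 R0 c in auto)
  then show "norm (simple_W S - simple_W R) \<le> pairing_const A * c"
    using simple_pairing_eq[of "{..<n}" D V] simple_pairing_eq[of "{..<m}" D' V'] 1 2 by simp
next
  show "simple_W (\<lambda>t. 0) = 0" using simple_W_lincomb[OF simple_mapping_0 simple_mapping_0, of 0 0] by simp
qed

text \<open>The description of the pairing ranges over all supporting sets and all sequences. Two
  competitors are compared on the union of their supporting sets, where one Lipschitz constant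
  serves both.\<close>

lemma W_tendsto:
  assumes A: "A \<in> rel_compact_borel" and S: "simple_approx A S Z"
  shows "(\<lambda>n. simple_W (S n)) \<longlonglongrightarrow> W Z"
proof -
  obtain U where U: "(\<lambda>n. simple_W (S n)) \<longlonglongrightarrow> U"
    using simple_functional.convergent[OF simple_functional_W[OF A] S] by blast
  have "W Z = U"
    unfolding pairing_def
  proof (rule the_equality)
    show "\<exists>A\<in>rel_compact_borel. \<exists>S. simple_approx A S Z \<and> (\<lambda>n. simple_W (S n)) \<longlonglongrightarrow> U"
      using A S U by blast
    fix U' assume "\<exists>A\<in>rel_compact_borel. \<exists>S. simple_approx A S Z \<and> (\<lambda>n. simple_W (S n)) \<longlonglongrightarrow> U'"
    then obtain B R where R: "B \<in> rel_compact_borel" "simple_approx B R Z" "(\<lambda>n. simple_W (R n)) \<longlonglongrightarrow> U'" by blast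
    show "U' = U"
      using simple_functional.limit_unique[OF simple_functional_W[OF rel_compact_borel_Un[OF A R(1)]]
          simple_approx_mono[OF R(2)] R(3) simple_approx_mono[OF S] U] by auto
  qed
  then show ?thesis using U by simp
qed

lemma W_lincomb:
  assumes A: "A \<in> rel_compact_borel" and Y: "test_on A Y" and Z: "test_on A Z"
  shows "W (\<lambda>t. a *\<^sub>R Y t + b *\<^sub>R Z t) = a *\<^sub>R W Y + b *\<^sub>R W Z"
proof -
  obtain S where S: "simple_approx A S Y" using Y by (rule test_on_imp_simple_approx)
  obtain R where R: "simple_approx A R Z" using Z by (rule test_on_imp_simple_approx)
  have "(\<lambda>n. simple_W (\<lambda>t. a *\<^sub>R S n t + b *\<^sub>R R n t)) = (\<lambda>n. a *\<^sub>R simple_W (S n) + b *\<^sub>R simple_W (R n))"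
    using S R by (intro ext simple_W_lincomb) (auto simp: simple_approx_def)
  with W_tendsto[OF A simple_approx_lincomb[OF S R], of a b]
  have "(\<lambda>n. a *\<^sub>R simple_W (S n) + b *\<^sub>R simple_W (R n)) \<longlonglongrightarrow> W (\<lambda>t. a *\<^sub>R Y t + b *\<^sub>R Z t)" by simp
  moreover have "(\<lambda>n. a *\<^sub>R simple_W (S n) + b *\<^sub>R simple_W (R n)) \<longlonglongrightarrow> a *\<^sub>R W Y + b *\<^sub>R W Z"
    by (intro tendsto_intros W_tendsto[OF A] S R)
  ultimately show ?thesis by (rule LIMSEQ_unique)
qed

lemma norm_W_le:
  assumes A: "A \<in> rel_compact_borel" and Z: "test_on A Z" and c: "\<And>t. norm (Z t) \<le> c"
  shows "norm (W Z) \<le> pairing_const A * c"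
proof -
  obtain S where S: "simple_approx A S Z" using Z by (rule test_on_imp_simple_approx)
  show ?thesis by (rule simple_functional.limit_bound[OF simple_functional_W[OF A] S W_tendsto[OF A S] c])
qed

abbreviation simple_int :: "('t \<Rightarrow> 'g \<Rightarrow>\<^sub>L 'g) \<Rightarrow> ('g \<Rightarrow>\<^sub>L 'g)" where
  "simple_int \<equiv> Bochner_Integration.simple_bochner_integral \<sigma>"

lemma simple_mapping_integrable:
  assumes "simple_mapping S"
  shows "Bochner_Integration.simple_bochner_integrable \<sigma> S"
proof
  have "space \<sigma> = space borel" by (rule sets_eq_imp_space_eq[OF sets_\<sigma>])
  then show "simple_function \<sigma> S"
    using assms simple_function_cong_algebra[OF sets_\<sigma>] by (auto simp: simple_mapping_iff)
  show "emeasure \<sigma> {t \<in> space \<sigma>. S t \<noteq> 0} \<noteq> \<infinity>"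
    using finite_\<sigma>[of "{t. S t \<noteq> 0}"] assms \<open>space \<sigma> = space borel\<close> by (simp add: simple_mapping_iff)
qed

lemma nn_integral_vanishing_le:
  assumes A: "A \<in> rel_compact_borel" and "\<And>t. t \<notin> A \<Longrightarrow> f t = 0" "\<And>t. f t \<le> c" "0 \<le> c"
  shows "(\<integral>\<^sup>+t. ennreal (f t) \<partial>\<sigma>) \<le> ennreal (measure \<sigma> A * c)"
proof -
  have "(\<integral>\<^sup>+t. ennreal (f t) \<partial>\<sigma>) \<le> (\<integral>\<^sup>+t. ennreal c * indicator A t \<partial>\<sigma>)"
    using assms(2-4) by (intro nn_integral_mono) (auto simp: indicator_def ennreal_leI)
  also have "\<dots> = ennreal c * emeasure \<sigma> A"
    using rel_compact_borelD[OF A] sets_\<sigma> by (intro nn_integral_cmult_indicator) auto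
  also have "\<dots> = ennreal (measure \<sigma> A * c)"
    using finite_\<sigma>[OF A] assms(4) by (simp add: emeasure_eq_ennreal_measure ennreal_mult mult.commute)
  finally show ?thesis .
qed

lemma simple_functional_int:
  assumes A: "A \<in> rel_compact_borel"
  shows "simple_functional A simple_int (measure \<sigma> A)"
proof
  fix S R :: "'t \<Rightarrow> 'g \<Rightarrow>\<^sub>L 'g" and c
  assume S: "simple_mapping S" and S0: "\<And>t. t \<notin> A \<Longrightarrow> S t = 0"
    and R: "simple_mapping R" and R0: "\<And>t. t \<notin> A \<Longrightarrow> R t = 0" and c: "\<And>t. norm (S t - R t) \<le> c"
  have c0: "0 \<le> c" using c[of undefined] norm_ge_zero order_trans by blast
  have d: "simple_mapping (\<lambda>t. S t - R t)" by (rule simple_mapping_compose2[OF S R]) simp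
  have n: "Bochner_Integration.simple_bochner_integrable \<sigma> (\<lambda>t. norm (S t - R t))"
    using Bochner_Integration.simple_bochner_integrable_compose2[of "\<lambda>x y. norm (x - y)",
        OF _ simple_mapping_integrable[OF S] simple_mapping_integrable[OF R]] by simp
  have "ennreal (norm (simple_int (\<lambda>t. S t - R t))) \<le> ennreal (Bochner_Integration.simple_bochner_integral \<sigma> (\<lambda>t. norm (S t - R t)))"
    by (intro ennreal_leI Bochner_Integration.simple_bochner_integral_norm_bound simple_mapping_integrable d)
  also have "\<dots> = (\<integral>\<^sup>+t. ennreal (norm (S t - R t)) \<partial>\<sigma>)"
    by (intro Bochner_Integration.simple_bochner_integral_eq_nn_integral n) simp
  also have "\<dots> \<le> ennreal (measure \<sigma> A * c)"
    using S0 R0 c c0 by (intro nn_integral_vanishing_le[OF A]) auto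
  finally show "norm (simple_int S - simple_int R) \<le> measure \<sigma> A * c"
    using c0 by (simp add: Bochner_Integration.simple_bochner_integral_diff simple_mapping_integrable S R)
next
  show "simple_int (\<lambda>t. 0) = 0" unfolding Bochner_Integration.simple_bochner_integral_def by (rule sum.neutral) auto
qed simp

lemma int_tendsto:
  assumes A: "A \<in> rel_compact_borel" and S: "simple_approx A S Z"
  shows "(\<lambda>n. simple_int (S n)) \<longlonglongrightarrow> op_integral \<sigma> Z"
proof -
  obtain U where U: "(\<lambda>n. simple_int (S n)) \<longlonglongrightarrow> U"
    using simple_functional.convergent[OF simple_functional_int[OF A] S] by blast
  have Sn: "simple_mapping (S n)" "t \<notin> A \<Longrightarrow> S n t = 0" and u: "uniform_limit UNIV S Z sequentially" for n t
    using S by (auto simp: simple_approx_def)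
  have "has_op_integral \<sigma> Z U"
    unfolding has_op_integral_def
  proof (intro conjI exI[of _ S] allI simple_mapping_integrable Sn U)
    show "Z \<in> borel_measurable \<sigma>"
    proof (rule borel_measurable_LIMSEQ_metric)
      show "S n \<in> borel_measurable \<sigma>" for n
        using Sn(1) by (auto simp: measurable_\<sigma> simple_mapping_iff intro: borel_measurable_simple_function)
      show "(\<lambda>n. S n t) \<longlonglongrightarrow> Z t" for t by (rule tendsto_uniform_limitI[OF u]) simp
    qed
    show "(\<lambda>i. \<integral>\<^sup>+t. ennreal (norm (Z t - S i t)) \<partial>\<sigma>) \<longlonglongrightarrow> 0"
    proof (rule order_tendstoI)
      fix a :: ennreal assume "0 < a"
      then obtain b where b: "0 < b" "b < a" using dense by blast
      then obtain r where r: "0 < r" "ennreal r < a"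
        by (cases b) (auto simp: ennreal_less_zero_iff)
      define d where "d = r / (measure \<sigma> A + 1)"
      have m: "measure \<sigma> A + 1 > 0" using measure_nonneg[of \<sigma> A] by linarith
      have d: "d > 0" using r m by (simp add: d_def)
      show "\<forall>\<^sub>F i in sequentially. (\<integral>\<^sup>+t. ennreal (norm (Z t - S i t)) \<partial>\<sigma>) < a"
        using simple_approx_eventually[OF S d]
      proof eventually_elim
        case (elim i)
        have Z0: "Z t = 0" if "t \<notin> A" for t
          using test_on_outside[OF simple_approx_imp_test_on[OF S] that] .
        have "(\<integral>\<^sup>+t. ennreal (norm (Z t - S i t)) \<partial>\<sigma>) \<le> ennreal (measure \<sigma> A * d)"
          using elim Sn(2) Z0 d by (intro nn_integral_vanishing_le[OF A]) (auto simp: norm_minus_commute)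
        also have "\<dots> \<le> ennreal ((measure \<sigma> A + 1) * d)" using d by (intro ennreal_leI mult_right_mono) auto
        also have "\<dots> = ennreal r" using m by (simp add: d_def)
        finally show ?case using r(2) by (rule le_less_trans)
      qed
    qed simp
  qed
  from op_integral_eq[OF this] show ?thesis using U by simp
qed

lemma int_lincomb:
  fixes Y Z :: "'t \<Rightarrow> 'g \<Rightarrow>\<^sub>L 'g"
  assumes A: "A \<in> rel_compact_borel" and Y: "test_on A Y" and Z: "test_on A Z"
  shows "op_integral \<sigma> (\<lambda>t. a *\<^sub>R Y t + b *\<^sub>R Z t) = a *\<^sub>R op_integral \<sigma> Y + b *\<^sub>R op_integral \<sigma> Z"
proof -
  obtain S where S: "simple_approx A S Y" using Y by (rule test_on_imp_simple_approx)
  obtain R where R: "simple_approx A R Z" using Z by (rule test_on_imp_simple_approx)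
  have "simple_int (\<lambda>t. a *\<^sub>R S n t + b *\<^sub>R R n t) = a *\<^sub>R simple_int (S n) + b *\<^sub>R simple_int (R n)" for n
  proof -
    have s: "simple_mapping (S n)" "simple_mapping (R n)" using S R by (auto simp: simple_approx_def)
    have sc: "simple_mapping (\<lambda>t. c *\<^sub>R S n t)" "simple_mapping (\<lambda>t. c *\<^sub>R R n t)" for c
      by (rule simple_mapping_compose2[OF s(1) s(1), where h="\<lambda>x y. c *\<^sub>R x"], simp,
          rule simple_mapping_compose2[OF s(2) s(2), where h="\<lambda>x y. c *\<^sub>R x"], simp)
    have lin: "linear (\<lambda>x :: 'g \<Rightarrow>\<^sub>L 'g. c *\<^sub>R x)" for c by (rule linear_scaleR)
    show ?thesis
      unfolding Bochner_Integration.simple_bochner_integral_add[OF simple_mapping_integrable[OF sc(1)] simple_mapping_integrable[OF sc(2)]]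
        Bochner_Integration.simple_bochner_integral_linear[OF lin simple_mapping_integrable[OF s(1)]]
        Bochner_Integration.simple_bochner_integral_linear[OF lin simple_mapping_integrable[OF s(2)]] ..
  qed
  with int_tendsto[OF A simple_approx_lincomb[OF S R], of a b]
  have "(\<lambda>n. a *\<^sub>R simple_int (S n) + b *\<^sub>R simple_int (R n)) \<longlonglongrightarrow> op_integral \<sigma> (\<lambda>t. a *\<^sub>R Y t + b *\<^sub>R Z t)" by simp
  moreover have "(\<lambda>n. a *\<^sub>R simple_int (S n) + b *\<^sub>R simple_int (R n)) \<longlonglongrightarrow> a *\<^sub>R op_integral \<sigma> Y + b *\<^sub>R op_integral \<sigma> Z"
    by (intro tendsto_intros int_tendsto[OF A] S R)
  ultimately show ?thesis by (rule LIMSEQ_unique)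
qed

lemma norm_int_le:
  fixes Z :: "'t \<Rightarrow> 'g \<Rightarrow>\<^sub>L 'g"
  assumes A: "A \<in> rel_compact_borel" and Z: "test_on A Z" and c: "\<And>t. norm (Z t) \<le> c"
  shows "norm (op_integral \<sigma> Z) \<le> measure \<sigma> A * c"
proof -
  obtain S where S: "simple_approx A S Z" using Z by (rule test_on_imp_simple_approx)
  show ?thesis by (rule simple_functional.limit_bound[OF simple_functional_int[OF A] S int_tendsto[OF A S] c])
qed

end

section \<open>The generating function\<close>

lemma rel_compact_coeffs_bounded:
  fixes lam \<eta> :: "'t::t2_space \<Rightarrow> real"
  assumes "continuous_on UNIV lam" "continuous_on UNIV \<eta>" "A \<in> rel_compact_borel"
  shows "\<exists>c. \<forall>t\<in>A. \<bar>lam t\<bar> \<le> c \<and> \<eta> t \<le> c"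
proof -
  have A: "compact (closure A)" using assms(3) by (simp add: rel_compact_borel_def)
  have "compact (lam ` closure A)" "compact (\<eta> ` closure A)"
    using assms A by (auto intro!: compact_continuous_image continuous_on_subset[of UNIV])
  then have "bounded (lam ` closure A)" "bounded (\<eta> ` closure A)" by (auto intro: compact_imp_bounded)
  then obtain b c where "\<forall>x\<in>lam ` closure A. \<bar>x\<bar> \<le> b" "\<forall>x\<in>\<eta> ` closure A. \<bar>x\<bar> \<le> c"
    unfolding bounded_iff real_norm_def by blast
  then have "\<forall>t\<in>A. \<bar>lam t\<bar> \<le> max b c \<and> \<eta> t \<le> max b c"
    using closure_subset[of A] by (fastforce simp: le_max_iff_disj)
  then show ?thesis by blast
qed

text \<open>By local compactness the open sets contained in compact sets cover the space; countably
  many suffice by second countability, and each has finite measure.\<close>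

lemma radon_sigma_finite:
  fixes \<sigma> :: "'t::{t2_space, second_countable_topology} measure"
  assumes lc: "locally_compact_space (euclidean :: 't topology)" and radon: "radon_measure \<sigma>"
  shows "sigma_finite_measure \<sigma>"
proof
  have bor: "sets \<sigma> = sets borel" and fin: "\<And>K. compact K \<Longrightarrow> emeasure \<sigma> K < \<infinity>"
    using radon by (auto simp: radon_measure_def)
  define \<U> where "\<U> = {U :: 't set. open U \<and> (\<exists>K. compact K \<and> U \<subseteq> K)}"
  have "\<Union>\<U> = UNIV"
  proof -
    have "\<exists>U\<in>\<U>. x \<in> U" for x
    proof -
      have "\<exists>U K. openin euclidean U \<and> compactin euclidean K \<and> x \<in> U \<and> U \<subseteq> K"
        using lc unfolding locally_compact_space_def by (metis UNIV_I topspace_euclidean)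
      then obtain U K where UK: "openin euclidean U" "compactin euclidean K" "x \<in> U" "U \<subseteq> K" by blast
      have "open U" using UK(1) by (simp only: open_openin)
      moreover have "compact K" using UK(2) by simp
      ultimately show ?thesis using UK(3,4) unfolding \<U>_def by blast
    qed
    then show ?thesis by blast
  qed
  moreover obtain \<V> where "\<V> \<subseteq> \<U>" "countable \<V>" "\<Union>\<V> = \<Union>\<U>"
    using Lindelof[of \<U>] unfolding \<U>_def by blast
  moreover have "U \<in> sets \<sigma> \<and> emeasure \<sigma> U \<noteq> \<infinity>" if U: "U \<in> \<U>" for U
  proof -
    obtain K where K: "open U" "compact K" "U \<subseteq> K" using U unfolding \<U>_def by blast
    then have "emeasure \<sigma> U \<le> emeasure \<sigma> K" using bor by (intro emeasure_mono) (auto intro: borel_compact)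
    then show ?thesis using fin[OF K(2)] K(1) bor by auto
  qed
  moreover have "space \<sigma> = UNIV" using sets_eq_imp_space_eq[OF bor] by simp
  ultimately show "\<exists>A. countable A \<and> A \<subseteq> sets \<sigma> \<and> \<Union>A = space \<sigma> \<and> (\<forall>a\<in>A. emeasure \<sigma> a \<noteq> \<infinity>)"
    by (intro exI[of _ \<V>]) auto
qed

lemma norm_diff_le3:
  fixes a :: "'a::real_normed_vector"
  assumes "norm a \<le> w" "norm b \<le> x" "norm c \<le> y"
  shows "norm (a - b - c) \<le> w + x + y"
  using norm_triangle_ineq4[of "a - b" c] norm_triangle_ineq4[of a b] assms by linarith

section \<open>Growth and summation of the polynomials\<close>

context meixner
begin

abbreviation poly :: "('t \<Rightarrow> 'g \<Rightarrow>\<^sub>L 'g) list \<Rightarrow> ('h \<Rightarrow>\<^sub>L 'h)" where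
  "poly \<equiv> meixner_poly \<sigma> lam \<eta> J ten"

abbreviation int_op :: "('t \<Rightarrow> 'g \<Rightarrow>\<^sub>L 'g) \<Rightarrow> ('h \<Rightarrow>\<^sub>L 'h)" where
  "int_op Y \<equiv> left_op ten (op_integral \<sigma> Y)"

definition lamZ :: "('t \<Rightarrow> 'g \<Rightarrow>\<^sub>L 'g) \<Rightarrow> ('t \<Rightarrow> 'g \<Rightarrow>\<^sub>L 'g) \<Rightarrow> 't \<Rightarrow> 'g \<Rightarrow>\<^sub>L 'g" where
  "lamZ Z Y = (\<lambda>t. lam t *\<^sub>R (Y t o\<^sub>L Z t))"

definition etaZZ :: "('t \<Rightarrow> 'g \<Rightarrow>\<^sub>L 'g) \<Rightarrow> ('t \<Rightarrow> 'g \<Rightarrow>\<^sub>L 'g) \<Rightarrow> 't \<Rightarrow> 'g \<Rightarrow>\<^sub>L 'g" where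
  "etaZZ Z Y = (\<lambda>t. \<eta> t *\<^sub>R (Y t o\<^sub>L Z t o\<^sub>L Z t))"

text \<open>\<open>n\<close> counts the copies of \<open>Z\<close>, so the degree is n + 1. With Y
  in the first place, the recursion leads only to polynomials of the same kind, with Y replaced by
  \<open>Z\<close>, \<open>lamZ Z Y\<close> or \<open>etaZZ Z Y\<close>.\<close>

definition P :: "('t \<Rightarrow> 'g \<Rightarrow>\<^sub>L 'g) \<Rightarrow> nat \<Rightarrow> ('t \<Rightarrow> 'g \<Rightarrow>\<^sub>L 'g) \<Rightarrow> ('h \<Rightarrow>\<^sub>L 'h)" where
  "P Z n Y = poly (Y # replicate n Z)"

lemma P_simps:
  "P Z 0 Y = W Y"
  "P Z (Suc 0) Y = (W Y o\<^sub>L P Z 0 Z) - P Z 0 (lamZ Z Y) - int_op (\<lambda>t. Y t o\<^sub>L Z t)"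
  "P Z (Suc (Suc n)) Y = (W Y o\<^sub>L P Z (Suc n) Z) - P Z (Suc n) (lamZ Z Y)
     - (int_op (\<lambda>t. Y t o\<^sub>L Z t) o\<^sub>L P Z n Z) - P Z n (etaZZ Z Y)"
  by (simp_all add: P_def lamZ_def etaZZ_def blinfun_compose_simps(11))

lemma int_op_lincomb:
  assumes A: "A \<in> rel_compact_borel" and Y: "test_on A Y" and Y': "test_on A Y'"
  shows "int_op (\<lambda>t. a *\<^sub>R Y t + b *\<^sub>R Y' t) = a *\<^sub>R int_op Y + b *\<^sub>R int_op Y'"
  by (simp add: int_lincomb[OF A Y Y'] op_tensor_linear)

lemma norm_int_op_le:
  assumes A: "A \<in> rel_compact_borel" and Z: "test_on A Z" and c: "\<And>t. norm (Z t) \<le> c"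
  shows "norm (int_op Z) \<le> measure \<sigma> A * c"
  using norm_left_op_le[of "op_integral \<sigma> Z"] norm_int_le[OF A Z c] by linarith

lemma test_on_lamZ:
  assumes A: "A \<in> rel_compact_borel" and "test_on A Z" "test_on A Y"
  shows "test_on A (lamZ Z Y)" "test_on A (etaZZ Z Y)"
proof -
  obtain c where c: "\<And>t. t \<in> A \<Longrightarrow> \<bar>lam t\<bar> \<le> c" "\<And>t. t \<in> A \<Longrightarrow> \<bar>\<eta> t\<bar> \<le> c"
    using bounded_coeffs[OF A] eta_nonneg by fastforce
  show "test_on A (lamZ Z Y)" "test_on A (etaZZ Z Y)"
    unfolding lamZ_def etaZZ_def
    by (rule test_on_scale[OF _ rel_compact_borelD[OF A] lam c(1)],
        intro test_on_compose assms, assumption,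
        rule test_on_scale[OF _ rel_compact_borelD[OF A] eta c(2)],
        intro test_on_compose assms, assumption)
qed

text \<open>Every operation of the recursion on the first argument is linear. The recursion descends
  by one and by two degrees, hence the induction with two base cases.\<close>

lemma P_lincomb:
  assumes A: "A \<in> rel_compact_borel" and Z: "test_on A Z"
  shows "test_on A Y \<Longrightarrow> test_on A Y' \<Longrightarrow> P Z n (\<lambda>t. a *\<^sub>R Y t + b *\<^sub>R Y' t) = a *\<^sub>R P Z n Y + b *\<^sub>R P Z n Y'"
proof (induction n arbitrary: Y Y' rule: induct_nat_012)
  case 0
  then show ?case by (simp add: P_simps W_lincomb[OF A])
next
  case 1
  have l: "lamZ Z (\<lambda>t. a *\<^sub>R Y t + b *\<^sub>R Y' t) = (\<lambda>t. a *\<^sub>R lamZ Z Y t + b *\<^sub>R lamZ Z Y' t)"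
    by (simp add: lamZ_def blinfun_compose_simps scaleR_add_right mult.commute)
  have i: "(\<lambda>t. (a *\<^sub>R Y t + b *\<^sub>R Y' t) o\<^sub>L Z t) = (\<lambda>t. a *\<^sub>R (Y t o\<^sub>L Z t) + b *\<^sub>R (Y' t o\<^sub>L Z t))"
    by (simp add: blinfun_compose_simps)
  show ?case
    unfolding P_simps l i W_lincomb[OF A 1] W_lincomb[OF A test_on_lamZ(1)[OF A Z 1(1)] test_on_lamZ(1)[OF A Z 1(2)]]
      int_op_lincomb[OF A test_on_compose[OF 1(1) Z] test_on_compose[OF 1(2) Z]]
    by (simp add: blinfun_compose_simps algebra_simps)
next
  case (ge2 n)
  note Y = ge2(3,4)
  have l: "lamZ Z (\<lambda>t. a *\<^sub>R Y t + b *\<^sub>R Y' t) = (\<lambda>t. a *\<^sub>R lamZ Z Y t + b *\<^sub>R lamZ Z Y' t)"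
    by (simp add: lamZ_def blinfun_compose_simps scaleR_add_right mult.commute)
  have e: "etaZZ Z (\<lambda>t. a *\<^sub>R Y t + b *\<^sub>R Y' t) = (\<lambda>t. a *\<^sub>R etaZZ Z Y t + b *\<^sub>R etaZZ Z Y' t)"
    by (simp add: etaZZ_def blinfun_compose_simps scaleR_add_right mult.commute)
  have i: "(\<lambda>t. (a *\<^sub>R Y t + b *\<^sub>R Y' t) o\<^sub>L Z t) = (\<lambda>t. a *\<^sub>R (Y t o\<^sub>L Z t) + b *\<^sub>R (Y' t o\<^sub>L Z t))"
    by (simp add: blinfun_compose_simps)
  show ?case
    unfolding P_simps l i e W_lincomb[OF A Y] ge2.IH(2)[OF test_on_lamZ(1)[OF A Z Y(1)] test_on_lamZ(1)[OF A Z Y(2)]]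
      ge2.IH(1)[OF test_on_lamZ(2)[OF A Z Y(1)] test_on_lamZ(2)[OF A Z Y(2)]]
      int_op_lincomb[OF A test_on_compose[OF Y(1) Z] test_on_compose[OF Y(2) Z]]
    by (simp add: blinfun_compose_simps algebra_simps)
qed

lemma norm_lamZ_le:
  assumes b: "\<And>t. t \<in> A \<Longrightarrow> \<bar>lam t\<bar> \<le> b \<and> \<eta> t \<le> b" "0 \<le> b"
    and Z: "test_on A Z" "\<And>t. norm (Z t) \<le> z" and Y: "\<And>t. norm (Y t) \<le> y"
  shows "norm (Y t o\<^sub>L Z t) \<le> y * z" "norm (lamZ Z Y t) \<le> b * (y * z)" "norm (etaZZ Z Y t) \<le> b * (y * z * z)"
proof -
  have y: "0 \<le> y" using Y[of t] norm_ge_zero order_trans by blast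
  have z: "0 \<le> z" using Z(2)[of t] norm_ge_zero order_trans by blast
  show 1: "norm (Y t o\<^sub>L Z t) \<le> y * z"
    by (rule order_trans[OF norm_blinfun_compose mult_mono[OF Y Z(2) y norm_ge_zero]])
  have 2: "norm (Y t o\<^sub>L Z t o\<^sub>L Z t) \<le> y * z * z"
    by (rule order_trans[OF norm_blinfun_compose mult_mono[OF 1 Z(2) _ norm_ge_zero]]) (use y z in simp)
  show "norm (lamZ Z Y t) \<le> b * (y * z)"
  proof (cases "t \<in> A")
    case True
    then show ?thesis unfolding lamZ_def norm_scaleR using b 1 by (intro mult_mono) auto
  qed (use test_on_outside[OF Z(1)] b y z in \<open>simp add: lamZ_def\<close>)
  show "norm (etaZZ Z Y t) \<le> b * (y * z * z)"
  proof (cases "t \<in> A")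
    case True
    then show ?thesis unfolding etaZZ_def norm_scaleR using b 2 eta_nonneg by (intro mult_mono) auto
  qed (use test_on_outside[OF Z(1)] b y z in \<open>simp add: etaZZ_def\<close>)
qed

text \<open>Let K be \<open>pairing_const A\<close>, s the measure of A, and C = K + s + 2 b + 1.
  Then C^2 = (K + b) C + (s + b + 1) C \<ge> K C + b C + s + b since C \<ge> 1, which is the
  inequality a geometric bound needs to survive the recursion.\<close>

definition growth :: "'t set \<Rightarrow> real \<Rightarrow> real" where
  "growth A b = pairing_const A + measure \<sigma> A + 2 * b + 1"

text \<open>The bound must hold for all first arguments at once and be linear in their norm
  \<open>y\<close>, since the recursion replaces the first argument. After taking out a common
  factor, its four terms contribute K C, b C, s and b, which add up to at most the square of the
  growth constant.\<close>

lemma norm_P_le: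
  assumes A: "A \<in> rel_compact_borel" and b: "\<And>t. t \<in> A \<Longrightarrow> \<bar>lam t\<bar> \<le> b \<and> \<eta> t \<le> b" "0 \<le> b"
    and Z: "test_on A Z" "\<And>t. norm (Z t) \<le> z"
  shows "test_on A Y \<Longrightarrow> (\<And>t. norm (Y t) \<le> y) \<Longrightarrow> norm (P Z n Y) \<le> y * (growth A b ^ Suc n * z ^ n)"
proof (induction n arbitrary: Y y rule: induct_nat_012)
  case 0
  define K where "K = pairing_const A"
  have K: "0 \<le> K" by (simp add: K_def pairing_const_def)
  have y: "0 \<le> y" using 0(2)[of undefined] norm_ge_zero order_trans by blast
  have "norm (W Y) \<le> K * y" unfolding K_def by (rule norm_W_le[OF A 0])
  also have "\<dots> \<le> growth A b * y" using y b(2) by (intro mult_right_mono) (auto simp: growth_def K_def)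
  finally show ?case by (simp add: P_simps mult.commute)
next
  case 1
  note Y = 1
  define K s C where "K = pairing_const A" and "s = measure \<sigma> A" and "C = growth A b"
  have K: "0 \<le> K" "0 \<le> s" by (simp_all add: K_def s_def pairing_const_def)
  have C: "C = K + s + 2 * b + 1" by (simp add: C_def growth_def K_def s_def)
  have y: "0 \<le> y" using Y(2)[of undefined] norm_ge_zero order_trans by blast
  have z: "0 \<le> z" using Z(2)[of undefined] norm_ge_zero order_trans by blast
  note bd = norm_lamZ_le[OF b Z Y(2)]
  have 1: "norm (W Y o\<^sub>L P Z 0 Z) \<le> (K * y) * (K * z)"
    unfolding K_def P_simps by (intro order_trans[OF norm_blinfun_compose] mult_mono norm_W_le[OF A] Y Z)
      (use K y in \<open>auto simp: K_def\<close>)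
  have 2: "norm (P Z 0 (lamZ Z Y)) \<le> K * (b * (y * z))"
    unfolding K_def P_simps(1) by (intro norm_W_le[OF A] test_on_lamZ[OF A] Y Z bd)
  have 3: "norm (int_op (\<lambda>t. Y t o\<^sub>L Z t)) \<le> s * (y * z)"
    unfolding s_def by (intro norm_int_op_le[OF A] test_on_compose Y Z bd)
  have "norm (P Z (Suc 0) Y) \<le> (K * y) * (K * z) + K * (b * (y * z)) + s * (y * z)"
    unfolding P_simps(2) by (rule norm_diff_le3[OF 1 2 3])
  also have "\<dots> = (y * z) * (K * K + K * b + s)" by (simp add: algebra_simps)
  also have "\<dots> \<le> (y * z) * (C * C)"
    using K b(2) y z by (intro mult_left_mono) (auto simp: C algebra_simps intro!: add_nonneg_nonneg mult_nonneg_nonneg)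
  finally show ?case by (simp add: C_def mult_ac)
next
  case (ge2 n)
  define K s C where "K = pairing_const A" and "s = measure \<sigma> A" and "C = growth A b"
  have K: "0 \<le> K" "0 \<le> s" by (simp_all add: K_def s_def pairing_const_def)
  have C: "C = K + s + 2 * b + 1" by (simp add: C_def growth_def K_def s_def)
  have C0: "0 \<le> C" using K b(2) by (simp add: C)
  have y: "0 \<le> y" using ge2(4)[of undefined] norm_ge_zero order_trans by blast
  have z: "0 \<le> z" using Z(2)[of undefined] norm_ge_zero order_trans by blast
  note bd = norm_lamZ_le[OF b Z ge2(4)]
  note IH = ge2.IH[folded C_def]
  have 1: "norm (W Y o\<^sub>L P Z (Suc n) Z) \<le> (K * y) * (z * (C ^ Suc (Suc n) * z ^ Suc n))"
    unfolding K_def by (intro order_trans[OF norm_blinfun_compose] mult_mono norm_W_le[OF A] IH(2) ge2 Z)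
      (use K y in \<open>auto simp: K_def\<close>)
  have 2: "norm (P Z (Suc n) (lamZ Z Y)) \<le> (b * (y * z)) * (C ^ Suc (Suc n) * z ^ Suc n)"
    by (intro IH(2) test_on_lamZ[OF A] ge2 Z bd)
  have 3: "norm (int_op (\<lambda>t. Y t o\<^sub>L Z t) o\<^sub>L P Z n Z) \<le> (s * (y * z)) * (z * (C ^ Suc n * z ^ n))"
    unfolding s_def by (intro order_trans[OF norm_blinfun_compose] mult_mono norm_int_op_le[OF A] IH(1) test_on_compose ge2 Z bd)
      (use K y z in \<open>auto simp: s_def\<close>)
  have 4: "norm (P Z n (etaZZ Z Y)) \<le> (b * (y * z * z)) * (C ^ Suc n * z ^ n)"
    by (intro IH(1) test_on_lamZ[OF A] ge2 Z bd)
  have "norm (P Z (Suc (Suc n)) Y) \<le> (K * y) * (z * (C ^ Suc (Suc n) * z ^ Suc n))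
      + (b * (y * z)) * (C ^ Suc (Suc n) * z ^ Suc n) + (s * (y * z)) * (z * (C ^ Suc n * z ^ n))
      + (b * (y * z * z)) * (C ^ Suc n * z ^ n)"
    unfolding P_simps
    by (rule order_trans[OF norm_triangle_ineq4 add_mono[OF norm_diff_le3[OF 1 2 3] 4]])
  also have "\<dots> = (y * z * z * C ^ Suc n * z ^ n) * (K * C + b * C + s + b)" by (simp add: algebra_simps)
  also have "\<dots> \<le> (y * z * z * C ^ Suc n * z ^ n) * (C * C)"
    using K b(2) y z C0 by (intro mult_left_mono) (auto simp: C algebra_simps intro!: add_nonneg_nonneg mult_nonneg_nonneg)
  finally show ?case by (simp add: C_def mult_ac)
qed

text \<open>Of \<open>Y\<close> only the algebraic equation \<open>YZ\<close> is used, not its power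
  series. The equation decomposes \<open>Z\<close> into the three arguments on which the summed
  recursion is evaluated.\<close>

lemma gen_fun_equation:
  assumes A: "A \<in> rel_compact_borel" and b: "\<And>t. t \<in> A \<Longrightarrow> \<bar>lam t\<bar> \<le> b \<and> \<eta> t \<le> b" "0 \<le> b"
    and Z: "test_on A Z" "\<And>t. norm (Z t) \<le> z" and small: "growth A b * z < 1" and Y: "test_on A Y"
    and YZ: "\<And>t. Y t + lam t *\<^sub>R (Y t o\<^sub>L Z t) + \<eta> t *\<^sub>R (Y t o\<^sub>L Z t o\<^sub>L Z t) = Z t"
  defines "G \<equiv> gen_fun \<sigma> lam \<eta> J ten Z"
  shows "gen_fun_converges \<sigma> lam \<eta> J ten Z" "(id_blinfun - W Y + int_op (\<lambda>t. Y t o\<^sub>L Z t)) o\<^sub>L G = id_blinfun"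
proof -
  define C where "C = growth A b"
  have C0: "0 \<le> C" using b(2) by (simp add: C_def growth_def pairing_const_def)
  have z: "0 \<le> z" using Z(2)[of undefined] norm_ge_zero order_trans by blast
  define H where "H X = (\<Sum>n. P Z n X)" for X
  have H: "(\<lambda>n. P Z n X) sums H X" if X: "test_on A X" for X
  proof -
    obtain c where c: "\<And>t. norm (X t) \<le> c" using test_on_bounded[OF X] by blast
    have "summable (\<lambda>n. (c * C) * (C * z) ^ n)"
      using small C0 z by (intro summable_mult summable_geometric) (simp add: C_def)
    then have "summable (\<lambda>n. P Z n X)"
    proof (rule summable_comparison_test'[of _ 0])
      show "norm (P Z n X) \<le> (c * C) * (C * z) ^ n" for n
        using norm_P_le[OF A b Z X c, of n] by (simp add: C_def power_mult_distrib mult_ac)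
    qed
    then show ?thesis unfolding H_def by (rule summable_sums)
  qed
  have PZ: "poly (replicate (Suc n) Z) = P Z n Z" for n by (simp add: P_def)
  show "gen_fun_converges \<sigma> lam \<eta> J ten Z"
    unfolding gen_fun_converges_def PZ using H[OF Z(1)] by (rule sums_summable)
  have G: "G = id_blinfun + H Z" unfolding G_def gen_fun_def PZ H_def ..
  \<comment> \<open>Index shifted by one so that the constant term of \<open>G\<close> becomes the
    polynomial of degree 0.\<close>
  define p where "p n = (case n of 0 \<Rightarrow> id_blinfun | Suc m \<Rightarrow> P Z m Z)" for n
  have p: "p sums G"
  proof -
    have "(\<lambda>n. p (Suc n)) sums H Z" using H[OF Z(1)] by (simp add: p_def)
    from sums_Suc[OF this] show ?thesis by (simp add: G add.commute p_def[of 0])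
  qed
  define I where "I = int_op (\<lambda>t. Y t o\<^sub>L Z t)"
  let ?s1 = "\<lambda>f n. case n of 0 \<Rightarrow> 0 | Suc m \<Rightarrow> f m"
  note tl = test_on_lamZ[OF A Z(1) Y]
  \<comment> \<open>The shifts align the four series by degree. The value \<open>p 0\<close>
    supplies the bare integral term at n = 1, and the double shift makes the \<eta> term start at n
    = 2.\<close>
  have "(\<lambda>n. (W Y o\<^sub>L p n) - ?s1 (\<lambda>m. P Z m (lamZ Z Y)) n - ?s1 (\<lambda>m. I o\<^sub>L p m) n
      - ?s1 (?s1 (\<lambda>m. P Z m (etaZZ Z Y))) n)
    sums ((W Y o\<^sub>L G) - H (lamZ Z Y) - (I o\<^sub>L G) - H (etaZZ Z Y))"
    by (intro sums_diff sums_shift_case H tl p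
        bounded_linear.sums[OF bounded_bilinear.bounded_linear_right[OF bounded_bilinear_blinfun_compose]])
  moreover have "(W Y o\<^sub>L p n) - ?s1 (\<lambda>m. P Z m (lamZ Z Y)) n - ?s1 (\<lambda>m. I o\<^sub>L p m) n
      - ?s1 (?s1 (\<lambda>m. P Z m (etaZZ Z Y))) n = P Z n Y" for n
  proof (cases n)
    case (Suc m)
    then show ?thesis by (cases m) (simp_all add: p_def P_simps I_def blinfun_compose_simps(10,11))
  qed (simp add: p_def P_simps blinfun_compose_simps(10,11))
  ultimately have "(\<lambda>n. P Z n Y) sums ((W Y o\<^sub>L G) - H (lamZ Z Y) - (I o\<^sub>L G) - H (etaZZ Z Y))" by simp
  then have HY: "H Y = (W Y o\<^sub>L G) - H (lamZ Z Y) - (I o\<^sub>L G) - H (etaZZ Z Y)"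
    using H[OF Y] sums_unique2 by blast
  have add: "P Z n (\<lambda>t. X t + X' t) = P Z n X + P Z n X'" if "test_on A X" "test_on A X'" for n X X'
    using P_lincomb[OF A Z(1) that, of n 1 1] by simp
  have tadd: "test_on A (\<lambda>t. Y t + lamZ Z Y t)" using test_on_lincomb[OF Y tl(1), of 1 1] by simp
  have "Z = (\<lambda>t. (Y t + lamZ Z Y t) + etaZZ Z Y t)"
    unfolding lamZ_def etaZZ_def using YZ by simp
  then have "P Z n Z = P Z n Y + P Z n (lamZ Z Y) + P Z n (etaZZ Z Y)" for n
    using add[OF tadd tl(2), of n] add[OF Y tl(1), of n] by simp
  then have "(\<lambda>n. P Z n Z) sums (H Y + H (lamZ Z Y) + H (etaZZ Z Y))"
    using sums_add[OF sums_add[OF H[OF Y] H[OF tl(1)]] H[OF tl(2)]] by simp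
  then have "H Z = H Y + H (lamZ Z Y) + H (etaZZ Z Y)" using H[OF Z(1)] sums_unique2 by blast
  then have "H Z = (W Y o\<^sub>L G) - (I o\<^sub>L G)" using HY by simp
  then show "(id_blinfun - W Y + int_op (\<lambda>t. Y t o\<^sub>L Z t)) o\<^sub>L G = id_blinfun"
    unfolding I_def[symmetric] using G by (simp add: blinfun_compose_simps algebra_simps)
qed

end

section \<open>The test function \<Psi>(Z) and the inversion\<close>

context meixner
begin

text \<open>\<open>\<Psi>(Z)\<close> is the fixed point of the contraction \<open>Y \<mapsto> Z - \<lambda> Y Z - \<eta> Y Z\<^sup>2\<close>, which preserves
  the test functions.\<close>

lemma test_on_fixed_point:
  fixes Y Z :: "'t \<Rightarrow> 'g \<Rightarrow>\<^sub>L 'g"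
  assumes A: "A \<in> rel_compact_borel" and b: "\<And>t. t \<in> A \<Longrightarrow> \<bar>lam t\<bar> \<le> b \<and> \<eta> t \<le> b" "0 \<le> b"
    and Z: "test_on A Z" "\<And>t. norm (Z t) \<le> z" and small: "z \<le> 1" "4 * (b * z) \<le> 1"
    and Y: "\<And>t. t \<notin> A \<Longrightarrow> Y t = 0" "\<And>t. norm (Y t) \<le> y"
    and YZ: "\<And>t. Y t + lam t *\<^sub>R (Y t o\<^sub>L Z t) + \<eta> t *\<^sub>R (Y t o\<^sub>L Z t o\<^sub>L Z t) = Z t"
  shows "test_on A Y"
proof -
  have z: "0 \<le> z" using Z(2)[of undefined] norm_ge_zero order_trans by blast
  have y: "0 \<le> y" using Y(2)[of undefined] norm_ge_zero order_trans by blast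
  have "\<exists>X. test_on A X \<and> (\<forall>t. norm (Y t - X t) \<le> y * (1/2) ^ k)" for k
  proof (induction k)
    case 0
    show ?case using Y(2) test_on_zero by (intro exI[of _ "\<lambda>_. 0"]) auto
  next
    case (Suc k)
    then obtain X where X: "test_on A X" "\<And>t. norm (Y t - X t) \<le> y * (1/2) ^ k" by blast
    let ?d = "y * (1/2) ^ k"
    let ?X = "\<lambda>t. 1 *\<^sub>R (1 *\<^sub>R Z t + (-1) *\<^sub>R lamZ Z X t) + (-1) *\<^sub>R etaZZ Z X t"
    have tX: "test_on A ?X"
      by (intro test_on_lincomb Z(1) test_on_lamZ[OF A Z(1) X(1)])
    have "norm (Y t - ?X t) \<le> y * (1/2) ^ Suc k" for t
    proof -
      define D where "D = (\<lambda>t. Y t - X t)"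
      have "Y t = Z t - lamZ Z Y t - etaZZ Z Y t"
        using YZ[of t] by (simp add: lamZ_def etaZZ_def algebra_simps)
      then have "Y t - ?X t = - (lamZ Z D t + etaZZ Z D t)"
        by (simp add: lamZ_def etaZZ_def D_def blinfun_compose_simps(3) algebra_simps)
      then have "norm (Y t - ?X t) = norm (lamZ Z D t + etaZZ Z D t)" by (simp only: norm_minus_cancel)
      also have "\<dots> \<le> b * (?d * z) + b * (?d * z * z)"
        using norm_lamZ_le[OF b Z, of D ?d t] X(2) by (intro norm_triangle_le add_mono) (auto simp: D_def)
      also have "\<dots> = ?d * (b * z) + ?d * (b * z) * z" by (simp add: algebra_simps)
      also have "\<dots> \<le> ?d * (1/4) + ?d * (1/4) * 1"
        \<comment> \<open>One iteration multiplies the error by at most b z + b z^2, which is at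
          most 1/2 because b z \<le> 1/4 and z \<le> 1.\<close>
        using small b(2) y z by (intro add_mono mult_mono mult_left_mono) auto
      finally show ?thesis by simp
    qed
    with tX show ?case by blast
  qed
  note it = this
  show ?thesis
  proof (rule test_on_uniform_limit)
    fix e :: real assume e: "e > 0"
    have "(\<lambda>k. y * (1/2 :: real) ^ k) \<longlonglongrightarrow> y * 0" by (intro tendsto_mult tendsto_const LIMSEQ_power_zero) simp
    then have "\<forall>\<^sub>F k in sequentially. y * (1/2) ^ k < e" using e by (intro order_tendstoD(2)) auto
    then obtain k where "y * (1/2) ^ k < e" by (auto simp: eventually_sequentially)
    then show "\<exists>X. test_on A X \<and> (\<forall>t. norm (Y t - X t) \<le> e)"
      using it[of k] by (meson less_imp_le order_trans)
  qed
qed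

text \<open>The factor 32 is 16, from the Neumann series, times 2, from the bound 2 z on the norm of
  \<Psi>(Z). The growth constant in the hypothesis makes it cover pairing, integral and coefficients
  at once, and also the smallness that the pointwise calculus and the fixed point require.\<close>

lemma generating_function:
  fixes Z :: "'t \<Rightarrow> 'g \<Rightarrow>\<^sub>L 'g"
  assumes A: "A \<in> rel_compact_borel" and bA: "\<forall>t\<in>A. \<bar>lam t\<bar> \<le> b \<and> \<eta> t \<le> b" and b0: "0 \<le> b"
    and Z: "test_on A Z" "\<And>t. norm (Z t) \<le> z" and small: "32 * growth A b * z \<le> 1"
  defines "G \<equiv> gen_fun \<sigma> lam \<eta> J ten Z"
    and "PsiZ \<equiv> (\<lambda>t. op_fun (Psi_fun (lam t) (\<eta> t)) (Z t))"
    and "Q2 \<equiv> (\<lambda>t. op_fun (\<lambda>z. z\<^sup>2 / (1 + lam t * z + \<eta> t * z\<^sup>2)) (Z t))"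
  defines "D \<equiv> id_blinfun - W PsiZ + int_op Q2"
    and "E \<equiv> id_blinfun + op_integral \<sigma> Q2"
  defines "f \<equiv> left_op ten (blinfun_inverse E)"
  shows "(\<lambda>t. op_fun (\<lambda>z. z / (1 + lam t * z + \<eta> t * z\<^sup>2)) (Z t)) = PsiZ"
    "(\<lambda>t. op_fun (C_fun (lam t) (\<eta> t)) (PsiZ t)) = Q2"
    "gen_fun_converges \<sigma> lam \<eta> J ten Z"
    "blinfun_invertible D" "G = blinfun_inverse D" "blinfun_invertible E"
    "blinfun_invertible (id_blinfun - (f o\<^sub>L W PsiZ))"
    "G = blinfun_inverse (id_blinfun - (f o\<^sub>L W PsiZ)) o\<^sub>L f"
proof -
  have b: "\<And>t. t \<in> A \<Longrightarrow> \<bar>lam t\<bar> \<le> b \<and> \<eta> t \<le> b" "0 \<le> b" using bA b0 by auto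
  have z: "0 \<le> z" using Z(2)[of undefined] norm_ge_zero order_trans by blast
  define K s where "K = pairing_const A" and "s = measure \<sigma> A"
  have K: "0 \<le> K" "0 \<le> s" by (simp_all add: K_def s_def pairing_const_def)
  have sm: "32 * (K * z) + 32 * (s * z) + 64 * (b * z) + 32 * z \<le> 1"
    using small by (simp add: growth_def K_def s_def algebra_simps)
  have nn: "0 \<le> K * z" "0 \<le> s * z" "0 \<le> b * z" using K b(2) z by auto
  have z1: "z \<le> 1 / 32" "b * z \<le> 1 / 64" using sm nn z by linarith+
  have small_t: "8 * (1 + \<bar>lam t\<bar> + \<bar>\<eta> t\<bar>) * norm (Z t) \<le> 1" for t
  proof (cases "t \<in> A")
    case True
    have "8 * (1 + \<bar>lam t\<bar> + \<bar>\<eta> t\<bar>) * norm (Z t) \<le> 8 * (1 + b + b) * z"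
      using b(1)[OF True] b(2) eta_nonneg Z(2) by (intro mult_mono add_mono) auto
    also have "\<dots> = 8 * z + 16 * (b * z)" by (simp add: algebra_simps)
    finally show ?thesis using z1 by linarith
  qed (use test_on_outside[OF Z(1)] in simp)
  define good where "good t N \<longleftrightarrow>
      N + lam t *\<^sub>R (Z t o\<^sub>L N) + \<eta> t *\<^sub>R (Z t o\<^sub>L Z t o\<^sub>L N) = id_blinfun \<and> Z t o\<^sub>L N = N o\<^sub>L Z t \<and> norm N \<le> 2 \<and>
      op_fun (Psi_fun (lam t) (\<eta> t)) (Z t) = Z t o\<^sub>L N \<and>
      op_fun (\<lambda>z. z / (1 + lam t * z + \<eta> t * z\<^sup>2)) (Z t) = Z t o\<^sub>L N \<and>
      op_fun (\<lambda>z. z\<^sup>2 / (1 + lam t * z + \<eta> t * z\<^sup>2)) (Z t) = Z t o\<^sub>L Z t o\<^sub>L N \<and>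
      op_fun (C_fun (lam t) (\<eta> t)) (Z t o\<^sub>L N) = Z t o\<^sub>L Z t o\<^sub>L N" for t N
  have "\<exists>N. good t N" for t
    by (rule op_calculus[OF small_t[of t]], rule exI, unfold good_def, intro conjI)
  then obtain N where good: "\<And>t. good t (N t)" by metis
  have N: "\<And>t. N t + lam t *\<^sub>R (Z t o\<^sub>L N t) + \<eta> t *\<^sub>R (Z t o\<^sub>L Z t o\<^sub>L N t) = id_blinfun"
    "\<And>t. Z t o\<^sub>L N t = N t o\<^sub>L Z t" "\<And>t. norm (N t) \<le> 2"
    and Psi: "\<And>t. PsiZ t = Z t o\<^sub>L N t"
    and Q1: "\<And>t. op_fun (\<lambda>z. z / (1 + lam t * z + \<eta> t * z\<^sup>2)) (Z t) = Z t o\<^sub>L N t"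
    and Q2: "\<And>t. Q2 t = Z t o\<^sub>L Z t o\<^sub>L N t"
    and CPsi: "\<And>t. op_fun (C_fun (lam t) (\<eta> t)) (Z t o\<^sub>L N t) = Z t o\<^sub>L Z t o\<^sub>L N t"
    using good unfolding good_def PsiZ_def Q2_def by blast+
  show "(\<lambda>t. op_fun (\<lambda>z. z / (1 + lam t * z + \<eta> t * z\<^sup>2)) (Z t)) = PsiZ" using Q1 Psi by auto
  show "(\<lambda>t. op_fun (C_fun (lam t) (\<eta> t)) (PsiZ t)) = Q2" using Q2 CPsi Psi by auto
  \<comment> \<open>Commuting N with Z brings all factors Z to the left, where the defining identity
    of N applies.\<close>
  have PsiZ2: "PsiZ t o\<^sub>L Z t = Z t o\<^sub>L Z t o\<^sub>L N t" for t
    unfolding Psi by (metis N(2) blinfun_compose_simps(9))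
  then have Q2': "Q2 = (\<lambda>t. PsiZ t o\<^sub>L Z t)" using Q2 by auto
  have YZ: "PsiZ t + lam t *\<^sub>R (PsiZ t o\<^sub>L Z t) + \<eta> t *\<^sub>R (PsiZ t o\<^sub>L Z t o\<^sub>L Z t) = Z t" for t
  proof -
    have e: "Z t o\<^sub>L Z t o\<^sub>L N t o\<^sub>L Z t = Z t o\<^sub>L (Z t o\<^sub>L Z t o\<^sub>L N t)" by (metis N(2) blinfun_compose_simps(9))
    have "PsiZ t + lam t *\<^sub>R (PsiZ t o\<^sub>L Z t) + \<eta> t *\<^sub>R (PsiZ t o\<^sub>L Z t o\<^sub>L Z t)
        = Z t o\<^sub>L (N t + lam t *\<^sub>R (Z t o\<^sub>L N t) + \<eta> t *\<^sub>R (Z t o\<^sub>L Z t o\<^sub>L N t))"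
      unfolding PsiZ2 e unfolding Psi by (simp add: blinfun_compose_simps)
    then show ?thesis by (simp add: N(1) blinfun_compose_simps(11))
  qed
  have nPsi: "norm (PsiZ t) \<le> z * 2" for t
    unfolding Psi by (rule order_trans[OF norm_blinfun_compose mult_mono[OF Z(2) N(3) z norm_ge_zero]])
  \<comment> \<open>The calculus is applied at each \<open>t\<close> separately and says nothing
    about dependence on \<open>t\<close>; approximability by simple mappings comes from the equation
    \<open>YZ\<close>.\<close>
  have tPsi: "test_on A PsiZ"
  proof (rule test_on_fixed_point[OF A b Z _ _ _ nPsi YZ])
    show "PsiZ t = 0" if "t \<notin> A" for t using test_on_outside[OF Z(1) that] by (simp add: Psi)
  qed (use z1 in auto)
  have tQ2: "test_on A Q2" unfolding Q2' by (rule test_on_compose[OF tPsi Z(1)])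
  have nQ2: "norm (Q2 t) \<le> z * 2 * z" for t
    unfolding Q2' by (rule order_trans[OF norm_blinfun_compose mult_mono[OF nPsi Z(2) _ norm_ge_zero]]) (use z in simp)
  have "growth A b * z < 1" using small by (simp add: mult.assoc)
  note eq = gen_fun_equation[OF A b Z this tPsi YZ, folded Q2' G_def]
  show "gen_fun_converges \<sigma> lam \<eta> J ten Z" by (rule eq(1))
  have DG: "D o\<^sub>L G = id_blinfun" unfolding D_def by (rule eq(2))
  have szz: "s * (z * 2 * z) \<le> s * z"
    using K z z1 by (intro mult_left_mono) (auto intro: mult_left_le_one_le)
  have nW: "norm (W PsiZ) \<le> K * (z * 2)" unfolding K_def by (rule norm_W_le[OF A tPsi nPsi])
  have nI: "norm (op_integral \<sigma> Q2) \<le> s * (z * 2 * z)" unfolding s_def by (rule norm_int_le[OF A tQ2 nQ2])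
  have nJ: "norm (int_op Q2) \<le> s * (z * 2 * z)" unfolding s_def by (rule norm_int_op_le[OF A tQ2 nQ2])
  have "norm (int_op Q2 - W PsiZ) \<le> s * z + K * (z * 2)"
    using norm_triangle_ineq4[of "int_op Q2" "W PsiZ"] nW nJ szz by linarith
  then have n16: "16 * norm (int_op Q2 - W PsiZ) \<le> 1" using sm nn z by (simp add: algebra_simps)
  obtain S where S: "(id_blinfun + (int_op Q2 - W PsiZ)) o\<^sub>L S = id_blinfun" "S o\<^sub>L (id_blinfun + (int_op Q2 - W PsiZ)) = id_blinfun"
    by (rule blinfun_Neumann[OF n16], rule that)
  have "D = id_blinfun + (int_op Q2 - W PsiZ)" by (simp add: D_def)
  with S have DS: "D o\<^sub>L S = id_blinfun" "S o\<^sub>L D = id_blinfun" by simp_all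
  \<comment> \<open>A right inverse of an operator with a two-sided inverse is that inverse.\<close>
  have "G = S o\<^sub>L (D o\<^sub>L G)" using DS(2) by (simp add: blinfun_compose_simps(9,10))
  then have GS: "G = S" by (simp add: DG blinfun_compose_simps(11))
  show "blinfun_invertible D" "G = blinfun_inverse D" using blinfun_inverse_eqI[OF DS] GS by auto
  have n16: "16 * norm (op_integral \<sigma> Q2) \<le> 1" using nI szz sm nn z by linarith
  obtain R where R: "E o\<^sub>L R = id_blinfun" "R o\<^sub>L E = id_blinfun"
    by (rule blinfun_Neumann[OF n16, folded E_def], rule that)
  show "blinfun_invertible E" by (rule blinfun_inverse_eqI(1)[OF R])
  have f: "f = left_op ten R" unfolding f_def blinfun_inverse_eqI(2)[OF R] ..
  define F where "F = left_op ten E"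
  have Ff: "F o\<^sub>L f = id_blinfun" "f o\<^sub>L F = id_blinfun"
    unfolding F_def f using R by (simp_all add: op_tensor_compose[symmetric] blinfun_compose_simps(10) op_tensor_id)
  have "F = id_blinfun + int_op Q2" unfolding F_def E_def by (simp add: op_tensor_linear op_tensor_id)
  then have D: "D = F - W PsiZ" by (simp add: D_def)
  \<comment> \<open>Since \<open>f\<close> inverts \<open>F\<close> and D = F - W(\<Psi>(Z)), this
    is f D. Its inverse is S F, and composing with \<open>f\<close> returns S = G, which is the last
    formula of the theorem.\<close>
  define B where "B = id_blinfun - (f o\<^sub>L W PsiZ)"
  have B: "B = f o\<^sub>L D" unfolding B_def D by (simp add: blinfun_compose_simps(4) Ff)
  have "B o\<^sub>L (S o\<^sub>L F) = id_blinfun" "(S o\<^sub>L F) o\<^sub>L B = id_blinfun"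
  proof -
    have "B o\<^sub>L (S o\<^sub>L F) = f o\<^sub>L (D o\<^sub>L S) o\<^sub>L F" unfolding B by (simp add: blinfun_compose_simps(9))
    then show "B o\<^sub>L (S o\<^sub>L F) = id_blinfun" by (simp add: DS Ff blinfun_compose_simps(11))
    have "(S o\<^sub>L F) o\<^sub>L B = S o\<^sub>L (F o\<^sub>L f) o\<^sub>L D" unfolding B by (simp add: blinfun_compose_simps(9))
    then show "(S o\<^sub>L F) o\<^sub>L B = id_blinfun" by (simp add: DS Ff blinfun_compose_simps(11))
  qed
  note Binv = blinfun_inverse_eqI[OF this]
  show "blinfun_invertible (id_blinfun - (f o\<^sub>L W PsiZ))" using Binv(1) by (simp add: B_def)
  have "blinfun_inverse B o\<^sub>L f = S o\<^sub>L (F o\<^sub>L f)" unfolding Binv(2) by (simp add: blinfun_compose_simps(9))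
  then show "G = blinfun_inverse (id_blinfun - (f o\<^sub>L W PsiZ)) o\<^sub>L f"
    by (simp add: Ff GS B_def blinfun_compose_simps(11))
qed

end

section \<open>Radon measure, continuous coefficients and the choice of the constant\<close>

theorem theorem3p1:
  fixes \<sigma> :: "'t::polish_space measure"
    and lam \<eta> :: "'t \<Rightarrow> real"
    and J :: "nat \<Rightarrow> ((nat \<Rightarrow> 't) \<Rightarrow> real) \<Rightarrow> 'f::{real_inner, banach}"
    and ten :: "'g::{real_inner, banach, second_countable_topology} \<Rightarrow> 'f \<Rightarrow> 'h::{real_inner, banach}"
    and A :: "'t set"
  assumes "locally_compact_space (euclidean :: 't topology)"
    and "radon_measure \<sigma>" and "non_atomic \<sigma>"
    and "\<And>U. open U \<Longrightarrow> U \<noteq> {} \<Longrightarrow> 0 < emeasure \<sigma> U"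
    and "continuous_on UNIV lam" and "continuous_on UNIV \<eta>" and "\<And>t. 0 \<le> \<eta> t"
    and "extended_fock_space \<sigma> \<eta> J"
    and "hilbert_tensor ten"
    and "A \<in> rel_compact_borel"
  shows "\<exists>C5>0. \<forall>Z\<in>op_test_functions. op_supp Z \<subseteq> A \<and> op_sup_norm Z < C5 \<longrightarrow>
    (let
       W = pairing \<sigma> lam \<eta> J ten;
       G = gen_fun \<sigma> lam \<eta> J ten Z;
       PsiZ = (\<lambda>t. op_fun (Psi_fun (lam t) (\<eta> t)) (Z t));
       CPsiZ = (\<lambda>t. op_fun (C_fun (lam t) (\<eta> t)) (PsiZ t));
       Q1 = (\<lambda>t. op_fun (\<lambda>z. z / (1 + lam t * z + \<eta> t * z\<^sup>2)) (Z t));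
       Q2 = (\<lambda>t. op_fun (\<lambda>z. z\<^sup>2 / (1 + lam t * z + \<eta> t * z\<^sup>2)) (Z t));
       D1 = id_blinfun - W PsiZ + left_op ten (op_integral \<sigma> CPsiZ);
       D2 = id_blinfun - W Q1 + left_op ten (op_integral \<sigma> Q2);
       E = id_blinfun + op_integral \<sigma> Q2;
       fZ = left_op ten (blinfun_inverse E);
       D3 = id_blinfun - (fZ o\<^sub>L W PsiZ)
     in gen_fun_converges \<sigma> lam \<eta> J ten Z \<and>
        blinfun_invertible D1 \<and> G = blinfun_inverse D1 \<and>
        blinfun_invertible D2 \<and> G = blinfun_inverse D2 \<and>
        blinfun_invertible E \<and> blinfun_invertible D3 \<and>
        G = blinfun_inverse D3 o\<^sub>L fZ)"
proof -
  have bor: "sets \<sigma> = sets borel" and fin: "\<And>K. compact K \<Longrightarrow> emeasure \<sigma> K < \<infinity>"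
    using assms(2) by (auto simp: radon_measure_def)
  interpret m: meixner \<sigma> lam \<eta> J ten
  proof (intro meixner.intro fock_space.intro tensor_space.intro meixner_axioms.intro)
    show "sigma_finite_measure \<sigma>" by (rule radon_sigma_finite[OF assms(1,2)])
    show "sets \<sigma> = sets borel" by (rule bor)
    show "lam \<in> borel_measurable borel" "\<eta> \<in> borel_measurable borel"
      using assms(5,6) by (auto intro: borel_measurable_continuous_onI)
    show "emeasure \<sigma> B < \<infinity>" if "B \<in> rel_compact_borel" for B
    proof -
      have "emeasure \<sigma> B \<le> emeasure \<sigma> (closure B)"
        using bor by (intro emeasure_mono closure_subset) simp
      also have "\<dots> < \<infinity>" using that by (intro fin) (simp add: rel_compact_borel_def)
      finally show ?thesis .
    qed
    show "\<exists>c. \<forall>t\<in>B. \<bar>lam t\<bar> \<le> c \<and> \<eta> t \<le> c" if "B \<in> rel_compact_borel" for B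
      by (rule rel_compact_coeffs_bounded[OF assms(5,6) that])
  qed (use assms(7-9) in auto)
  obtain c where c: "\<And>t. t \<in> A \<Longrightarrow> \<bar>lam t\<bar> \<le> c \<and> \<eta> t \<le> c" using m.bounded_coeffs[OF assms(10)] by blast
  \<comment> \<open>For empty \<open>A\<close> the bound \<open>c\<close> can be negative; the
    estimates require \<open>0 \<le> b\<close>.\<close>
  define b where "b = max c 0"
  have b: "\<forall>t\<in>A. \<bar>lam t\<bar> \<le> b \<and> \<eta> t \<le> b" "0 \<le> b" using c by (fastforce simp: b_def)+
  have g: "0 < m.growth A b" unfolding m.growth_def m.pairing_const_def using b(2) by (intro add_nonneg_pos) auto
  define r where "r = 1 / (32 * m.growth A b)"
  have r: "0 < r" "32 * m.growth A b * r \<le> 1" using g by (simp_all add: r_def)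
  show ?thesis
  proof (intro exI[of _ r] conjI ballI impI r(1))
    fix Z :: "'t \<Rightarrow> 'g \<Rightarrow>\<^sub>L 'g"
    assume Z: "Z \<in> op_test_functions" and "op_supp Z \<subseteq> A \<and> op_sup_norm Z < r"
    then have supp: "op_supp Z \<subseteq> A" and norm: "op_sup_norm Z < r" by auto
    have tZ: "test_on A Z" by (rule test_on_supp[OF Z supp assms(10)])
    obtain d where d: "\<And>t. norm (Z t) \<le> d" using test_on_bounded[OF tZ] by blast
    \<comment> \<open>The real supremum is an upper bound only for a bounded family; test functions
      are bounded because they are uniformly close to a simple mapping.\<close>
    have "norm (Z t) \<le> op_sup_norm Z" for t
      unfolding op_sup_norm_def by (rule cSUP_upper) (use d in \<open>auto intro!: bdd_aboveI[of _ d]\<close>)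
    then have nZ: "norm (Z t) \<le> r" for t using norm by (metis less_imp_le order_trans)
    note gf = m.generating_function[OF assms(10) b tZ nZ r(2)]
    show "let
       W = pairing \<sigma> lam \<eta> J ten;
       G = gen_fun \<sigma> lam \<eta> J ten Z;
       PsiZ = (\<lambda>t. op_fun (Psi_fun (lam t) (\<eta> t)) (Z t));
       CPsiZ = (\<lambda>t. op_fun (C_fun (lam t) (\<eta> t)) (PsiZ t));
       Q1 = (\<lambda>t. op_fun (\<lambda>z. z / (1 + lam t * z + \<eta> t * z\<^sup>2)) (Z t));
       Q2 = (\<lambda>t. op_fun (\<lambda>z. z\<^sup>2 / (1 + lam t * z + \<eta> t * z\<^sup>2)) (Z t));
       D1 = id_blinfun - W PsiZ + left_op ten (op_integral \<sigma> CPsiZ);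
       D2 = id_blinfun - W Q1 + left_op ten (op_integral \<sigma> Q2);
       E = id_blinfun + op_integral \<sigma> Q2;
       fZ = left_op ten (blinfun_inverse E);
       D3 = id_blinfun - (fZ o\<^sub>L W PsiZ)
     in gen_fun_converges \<sigma> lam \<eta> J ten Z \<and>
        blinfun_invertible D1 \<and> G = blinfun_inverse D1 \<and>
        blinfun_invertible D2 \<and> G = blinfun_inverse D2 \<and>
        blinfun_invertible E \<and> blinfun_invertible D3 \<and>
        G = blinfun_inverse D3 o\<^sub>L fZ"
      \<comment> \<open>Here \<open>Q1\<close> becomes \<open>PsiZ\<close> and \<open>CPsiZ\<close>
        becomes \<open>Q2\<close>, so that the two denominators \<open>D1\<close> and
        \<open>D2\<close> are one operator.\<close>
      unfolding Let_def gf(1,2) by (intro conjI gf(3-8))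
  qed
qed

end
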